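(* There is a $\phi$-approximation algorithm for the Drones Warehouse Problem, where $\phi=\frac{1+\sqrt5}{2}$ is the golden ratio; that is, the algorithm always outputs a valid schedule $f$ with $T(f)\le \phi\cdot T(f^* )$, where $f^*$ is an optimal valid schedule. The algorithm runs in $O((n+m)(\log^2 m+\log n))$ time, where $m$ and $n$ are the number of drones and parcels, respectively.
   Context: Drones Warehouse Problem (DWP): a warehouse has $m$ drones $D_1,\dots,D_m$ and $n$ parcels $P_1,\dots,P_n$. Parcel $P_i$ must be delivered at distance $\ell_i/2$ from the warehouse, so delivering it requires a round trip of total length $\ell_i>0$. Drone $D_j$ has speed $v_j>0$ and battery life $d_j$ (the maximum distance it can travel on one trip); a drone carries one parcel at a time, recharging at the warehouse takes negligible time, and drone $D_j$ can deliver parcel $P_i$ only if $\ell_i\le d_j$. A valid schedule is a map $f$ from drones to sets of parcels such that every parcel is assigned to exactly one drone and every parcel $P_i\in f(D_j)$ satisfies $\ell_i\le d_j$. Its delivery time is $T(f)=\max_{j\in[m]}\sum_{i:P_i\in f(D_j)}\ell_i/v_j$. It is assumed that at least one drone can deliver all parcels (so a valid schedule exists). The goal is to find a valid schedule minimizing $T(f)$. Arithmetic operations and comparisons on real numbers are assumed to take constant time. *)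

theory Defs
  imports Complex_Main
begin

text \<open>Drones are indexed 0..m-1, parcels 0..n-1. Drone j has speed v j and
battery life d j; parcel i needs a round trip of length l i.
A schedule maps each drone to a set of parcels.\<close>

definition valid_schedule ::
  "nat \<Rightarrow> nat \<Rightarrow> (nat \<Rightarrow> real) \<Rightarrow> (nat \<Rightarrow> real) \<Rightarrow> (nat \<Rightarrow> nat set) \<Rightarrow> bool" where
  "valid_schedule m n l d f \<longleftrightarrow>
     (\<forall>j<m. f j \<subseteq> {..<n}) \<and>
     (\<forall>i<n. \<exists>!j. j < m \<and> i \<in> f j) \<and>
     (\<forall>j<m. \<forall>i\<in>f j. l i \<le> d j)"

definition delivery_time ::
  "nat \<Rightarrow> (nat \<Rightarrow> real) \<Rightarrow> (nat \<Rightarrow> real) \<Rightarrow> (nat \<Rightarrow> nat set) \<Rightarrow> real" where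
  "delivery_time m l v f = Max ((\<lambda>j. \<Sum>i\<in>f j. l i / v j) ` {..<m})"

definition golden_ratio :: real where
  "golden_ratio = (1 + sqrt 5) / 2"

text \<open>Integer registers I :: nat => int and real registers R :: nat => real.
Real registers support the four arithmetic operations and comparisons (unit
cost, as assumed in the paper); integer registers support addition,
subtraction, halving and comparison; both support indirect addressing through
integer registers. There is no conversion from reals to integers.\<close>

datatype instr =
    IConst nat int
  | IAdd nat nat nat
  | ISub nat nat nat
  | IHalf nat nat
  | ILoad nat nat
  | IStore nat nat
  | RConst nat real
  | RAdd nat nat nat
  | RSub nat nat nat
  | RMul nat nat nat
  | RDiv nat nat nat
  | RLoad nat nat
  | RStore nat nat
  | IJle nat nat nat
  | RJle nat nat nat
  | Halt

type_synonym conf = "nat \<times> (nat \<Rightarrow> int) \<times> (nat \<Rightarrow> real)"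

fun exec :: "instr \<Rightarrow> conf \<Rightarrow> conf" where
  "exec (IConst a c) (pc, I, R) = (Suc pc, I(a := c), R)"
| "exec (IAdd a b c) (pc, I, R) = (Suc pc, I(a := I b + I c), R)"
| "exec (ISub a b c) (pc, I, R) = (Suc pc, I(a := I b - I c), R)"
| "exec (IHalf a b) (pc, I, R) = (Suc pc, I(a := I b div 2), R)"
| "exec (ILoad a b) (pc, I, R) = (Suc pc, I(a := I (nat (I b))), R)"
| "exec (IStore a b) (pc, I, R) = (Suc pc, I(nat (I a) := I b), R)"
| "exec (RConst a c) (pc, I, R) = (Suc pc, I, R(a := c))"
| "exec (RAdd a b c) (pc, I, R) = (Suc pc, I, R(a := R b + R c))"
| "exec (RSub a b c) (pc, I, R) = (Suc pc, I, R(a := R b - R c))"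
| "exec (RMul a b c) (pc, I, R) = (Suc pc, I, R(a := R b * R c))"
| "exec (RDiv a b c) (pc, I, R) = (Suc pc, I, R(a := R b / R c))"
| "exec (RLoad a b) (pc, I, R) = (Suc pc, I, R(a := R (nat (I b))))"
| "exec (RStore a b) (pc, I, R) = (Suc pc, I, R(nat (I a) := R b))"
| "exec (IJle a b t) (pc, I, R) = ((if I a \<le> I b then t else Suc pc), I, R)"
| "exec (RJle a b t) (pc, I, R) = ((if R a \<le> R b then t else Suc pc), I, R)"
| "exec Halt c = c"

definition halted :: "instr list \<Rightarrow> conf \<Rightarrow> bool" where
  "halted P c \<longleftrightarrow> length P \<le> fst c \<or> P ! fst c = Halt"

definition step :: "instr list \<Rightarrow> conf \<Rightarrow> conf" where
  "step P c = (if halted P c then c else exec (P ! fst c) c)"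

definition steps :: "instr list \<Rightarrow> nat \<Rightarrow> conf \<Rightarrow> conf" where
  "steps P k c = (step P ^^ k) c"

definition dwp_input ::
  "nat \<Rightarrow> nat \<Rightarrow> (nat \<Rightarrow> real) \<Rightarrow> (nat \<Rightarrow> real) \<Rightarrow> (nat \<Rightarrow> real) \<Rightarrow> conf" where
  "dwp_input m n v d l =
     (0,
      (\<lambda>a. if a = 0 then int m else if a = 1 then int n else 0),
      (\<lambda>a. if a < m then v a else if a < 2*m then d (a - m)
           else if a < 2*m + n then l (a - 2*m) else 0))"

definition dwp_output :: "nat \<Rightarrow> conf \<Rightarrow> (nat \<Rightarrow> nat set)" where
  "dwp_output n c = (\<lambda>j. {i. i < n \<and> fst (snd c) (2 + i) = int j})"

end

theory Submission
  imports Defs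
begin

text \<open>
  Fix a guess \<open>T\<close> for the optimum and assign the parcels in order of decreasing length, each to
  \<^emph>\<open>any\<close> eligible drone whose load stays at most \<open>\<rho> T v\<^sub>j\<close>, where \<open>\<rho> = \<phi> - \<epsilon>\<close> and
  \<open>\<epsilon> \<le> 1 / (8 m)\<close>. If some parcel \<open>e\<close> fits nowhere, then the optimum exceeds \<open>T\<close>: normalise
  \<open>l\<^sub>e = T = 1\<close> and give a parcel of length \<open>x\<close> the weight \<open>\<lfloor>x\<rfloor> - 1 + max 1 (\<phi> frac x)\<close>. This weight is
  superadditive, so a schedule of delivery time at most 1 puts weight at most \<open>weight v\<^sub>j\<close> on drone \<open>j\<close>,
  whereas a load exceeding \<open>\<rho> v\<^sub>j - 1\<close> has weight at least \<open>weight v\<^sub>j - \<phi> \<epsilon> v\<^sub>j\<close>. A volume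
  argument gives \<open>\<Sum> v\<^sub>j < m / (\<rho> - 1)\<close>, so the total deficit is less than 1, the weight of \<open>e\<close>.

  The slack \<open>\<epsilon>\<close> of order \<open>1 / m\<close> makes a bisection for \<open>T\<close> affordable: the maximum \<open>U\<close> over \<open>i\<close> of the total
  length of the \<open>i\<close> longest parcels divided by the top speed among the drones eligible for the \<open>i\<close>-th
  one satisfies \<open>U / m \<le> OPT\<close>, and the guess \<open>T = U\<close> always succeeds, so \<open>O(log m)\<close> halvings of \<open>U\<close>
  suffice. A round costs \<open>O((n + m) log m)\<close> with a tournament tree over the residual capacities of
  the drones. The parcels and the drones are sorted once, by the same kind of tree.
\<close>

section \<open>The weight argument\<close>

text \<open>The ratio has to be \<phi> itself, yet finitely many halvings locate the optimum only up
  to a relative error. That error is paid for inside the any-fit test: budgets are scaled by \<rho>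
  = \<phi> - \<epsilon>, and (\<phi> - \<epsilon>)(1 + \<epsilon>/2) \<le> \<phi> because \<phi> <
  2. The price is a weight deficit that adds up over all drones, to \<phi> \<epsilon> times a total
  normalized speed of O(m); so \<epsilon> may be as large as order 1/m. About 2 log m rounds result:
  one log m for the factor m lost in U, one for the precision 1/m.

  \<phi> itself comes from the smallest blocking situation. Ignoring \<epsilon>, a drone of
  normalized speed v that is blocked by a single parcel of length y satisfies \<phi> v - 1 < y. For
  y < \<phi> the equation \<phi>^2 = \<phi> + 1 turns this into v < \<phi>, and the weight is
  constantly 1 on [1, \<phi>], so the drone carries at least its own weight.

  The failure argument never asks which drone with enough room was chosen. Hence a placement costs
  one descent and one repair of a tree path, and log n enters only through sorting.\<close>

lemma golden_ratio_sq: "golden_ratio * golden_ratio = golden_ratio + 1"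
  unfolding golden_ratio_def by (simp add: field_simps)

lemma golden_ratio_bounds: "8 / 5 < golden_ratio" "golden_ratio < 2"
proof -
  have "11 / 5 < sqrt 5" by (rule real_less_rsqrt) (simp add: power2_eq_square)
  moreover have "sqrt 5 < 3" by (rule real_less_lsqrt) (auto simp: power2_eq_square)
  ultimately show "8 / 5 < golden_ratio" "golden_ratio < 2"
    unfolding golden_ratio_def by auto
qed

text \<open>Equivalently
  \<open>\<lfloor>x\<rfloor> + \<phi> * max 0 (frac x - (\<phi> - 1))\<close>: whole units count
  fully, and of the fraction only the excess over 1/\<phi> = \<phi> - 1 counts, with slope
  \<phi>.\<close>

definition weight :: "real \<Rightarrow> real" where
  "weight x = of_int \<lfloor>x\<rfloor> - 1 + max 1 (golden_ratio * frac x)"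

text \<open>Without a carry this is the superadditivity of \<open>max 0 (\<phi> * t - 1)\<close> for
  t \<ge> 0. A carry raises the floor by 1 and lowers the term \<phi> times fraction by \<phi>; the
  estimate closes because \<phi> < 2.\<close>

lemma weight_superadd: "weight x + weight y \<le> weight (x + y)"
proof -
  note g = golden_ratio_bounds
  have f: "0 \<le> frac x" "frac x < 1" "0 \<le> frac y" "frac y < 1"
    by (auto simp: frac_lt_1)
  have gf: "0 \<le> golden_ratio * frac x" "golden_ratio * frac x < 2"
    "0 \<le> golden_ratio * frac y" "golden_ratio * frac y < 2"
    using f g mult_strict_mono[of golden_ratio 2 "frac x" 1] mult_strict_mono[of golden_ratio 2 "frac y" 1]
    by auto
  show ?thesis
  proof (cases "frac x + frac y < 1")
    case True
    then have "\<lfloor>x + y\<rfloor> = \<lfloor>x\<rfloor> + \<lfloor>y\<rfloor>" "frac (x + y) = frac x + frac y"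
      by (auto simp: floor_add frac_add)
    then show ?thesis using gf by (auto simp: weight_def algebra_simps)
  next
    case False
    then have *: "\<lfloor>x + y\<rfloor> = \<lfloor>x\<rfloor> + \<lfloor>y\<rfloor> + 1" "frac (x + y) = frac x + frac y - 1"
      by (auto simp: floor_add frac_add)
    have "golden_ratio * frac (x + y) = golden_ratio * frac x + golden_ratio * frac y - golden_ratio"
      by (simp add: * algebra_simps)
    then show ?thesis using gf g unfolding weight_def *(1) by auto
  qed
qed

lemma weight_nonneg: "0 \<le> x \<Longrightarrow> 0 \<le> weight x"
  using zero_le_floor[of x] unfolding weight_def by linarith

lemma weight_ge_1: "1 \<le> x \<Longrightarrow> 1 \<le> weight x"
  using one_le_floor[of x] unfolding weight_def by linarith

lemma weight_mono: "x \<le> y \<Longrightarrow> weight x \<le> weight y"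
  using weight_superadd[of x "y - x"] weight_nonneg[of "y - x"] by simp

lemma weight_le: "weight x \<le> x"
proof -
  have f: "0 \<le> frac x" "frac x < 1" by (auto simp: frac_lt_1)
  have "(golden_ratio - 1) * frac x \<le> 1 * 1"
    using f golden_ratio_bounds by (intro mult_mono) auto
  then have "max 1 (golden_ratio * frac x) - 1 \<le> frac x" using f by (auto simp: algebra_simps)
  then show ?thesis unfolding weight_def frac_def by simp
qed

lemma weight_sum: "finite X \<Longrightarrow> (\<Sum>x\<in>X. weight (y x)) \<le> weight (\<Sum>x\<in>X. y x)"
proof (induction X rule: finite_induct)
  case empty
  then show ?case by (simp add: weight_nonneg)
next
  case (insert x F)
  then show ?case using weight_superadd[of "y x" "\<Sum>x\<in>F. y x"] by simp
qed

text \<open>As every piece is at least 1, its fraction up to \<phi> - 1 can be charged to its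
  integer part at rate \<phi> - 1, so each piece is at most \<phi> times its floor plus its excess.
  With q the sum of floors, D the sum of excesses and E = \<epsilon> v, the load bound becomes v < q
  + (1 + D + E)/\<phi>. The pieces weigh q + \<phi> D, so it remains to bound
  \<open>weight v\<close> by q + \<phi> D + \<phi> E.\<close>

lemma weight_sum_lower:
  assumes "finite X" and y1: "\<And>x. x \<in> X \<Longrightarrow> 1 \<le> y x" and "0 \<le> v" "0 \<le> \<epsilon>"
    and less: "(golden_ratio - \<epsilon>) * v - 1 < (\<Sum>x\<in>X. y x)"
  shows "weight v - golden_ratio * (\<epsilon> * v) \<le> (\<Sum>x\<in>X. weight (y x))"
proof -
  let ?g = golden_ratio
  note g = golden_ratio_bounds golden_ratio_sq
  define q where "q = (\<Sum>x\<in>X. \<lfloor>y x\<rfloor>)"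
  define D where "D = (\<Sum>x\<in>X. max 0 (frac (y x) - (?g - 1)))"
  define E where "E = \<epsilon> * v"
  have D0: "0 \<le> D" unfolding D_def by (intro sum_nonneg) auto
  have E0: "0 \<le> E" unfolding E_def using assms by auto
  have w: "weight z = of_int \<lfloor>z\<rfloor> + ?g * max 0 (frac z - (?g - 1))" for z
  proof -
    have "?g * max 0 (frac z - (?g - 1)) = max 0 (?g * frac z - 1)"
      using g by (simp add: max_mult_distrib_left algebra_simps)
    then show ?thesis unfolding weight_def by auto
  qed
  have W: "(\<Sum>x\<in>X. weight (y x)) = of_int q + ?g * D"
    unfolding w q_def D_def by (simp add: sum.distrib sum_distrib_left)
  have "(\<Sum>x\<in>X. y x) \<le> (\<Sum>x\<in>X. ?g * of_int \<lfloor>y x\<rfloor> + max 0 (frac (y x) - (?g - 1)))"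
  proof (rule sum_mono)
    fix x assume "x \<in> X"
    then have "(1::real) \<le> of_int \<lfloor>y x\<rfloor>" using y1 by (simp add: le_floor_iff)
    then have "(?g - 1) * 1 \<le> (?g - 1) * of_int \<lfloor>y x\<rfloor>"
      using g by (intro mult_left_mono) auto
    then show "y x \<le> ?g * of_int \<lfloor>y x\<rfloor> + max 0 (frac (y x) - (?g - 1))"
      by (simp add: frac_def algebra_simps max_def)
  qed
  also have "\<dots> = ?g * of_int q + D"
    unfolding q_def D_def by (simp add: sum.distrib sum_distrib_left)
  finally have "?g * v < ?g * of_int q + (1 + D + E)"
    using less by (simp add: E_def algebra_simps)
  then have "(?g - 1) * (?g * v) < (?g - 1) * (?g * of_int q + (1 + D + E))"
    using g by (intro mult_strict_left_mono) auto
  \<comment> \<open>\<phi> - 1 is the inverse of \<phi>.\<close>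
  moreover have "(?g - 1) * (?g * z) = z" for z :: real
  proof -
    have "(?g - 1) * (?g * z) = (?g * ?g - ?g) * z" by (simp add: algebra_simps)
    then show ?thesis by (simp add: golden_ratio_sq)
  qed
  ultimately have v: "v < of_int q + (?g - 1) * (1 + D + E)" by (simp only: distrib_left)
  have gDE: "D \<le> ?g * D" "E \<le> ?g * E" using D0 E0 g mult_right_mono[of 1 ?g D] mult_right_mono[of 1 ?g E] by auto
  have "weight v \<le> of_int q + ?g * D + ?g * E"
  proof (cases "v < of_int q + 1")
    case True
    show ?thesis
    proof (cases "\<lfloor>v\<rfloor> < q")
      case True
      then have "real_of_int \<lfloor>v\<rfloor> + 1 \<le> real_of_int q" by linarith
      moreover have "?g * frac v \<le> 2 * 1" using g frac_lt_1[of v] by (intro mult_mono) auto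
      ultimately have "weight v \<le> of_int q" by (auto simp: weight_def)
      then show ?thesis using D0 E0 gDE by auto
    next
      case False
      then have fl: "\<lfloor>v\<rfloor> = q" using \<open>v < of_int q + 1\<close> by linarith
      then have "frac v < (?g - 1) * (1 + D + E)" using v by (simp add: frac_def)
      then have "?g * frac v < ?g * ((?g - 1) * (1 + D + E))" using g by simp
      also have "?g * ((?g - 1) * (1 + D + E)) = (?g * ?g - ?g) * (1 + D + E)"
        by (simp add: algebra_simps)
      finally have "?g * frac v < 1 + D + E" by (simp add: golden_ratio_sq)
      then show ?thesis using D0 E0 gDE fl by (auto simp: weight_def)
    qed
  next
    case False
    \<comment> \<open>Now D + E > \<phi> - 1, and the crude bound \<open>weight v \<le> v\<close> is
      enough: (\<phi> - 1)(1 + D + E) is below \<phi> (D + E).\<close>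
    then have "1 < (?g - 1) * (1 + D + E)" using v by linarith
    then have "?g * 1 < ?g * ((?g - 1) * (1 + D + E))" using g by (intro mult_strict_left_mono) auto
    also have "?g * ((?g - 1) * (1 + D + E)) = (?g * ?g - ?g) * (1 + D + E)"
      by (simp add: algebra_simps)
    finally have "?g < 1 + D + E" by (simp add: golden_ratio_sq)
    then show ?thesis using weight_le[of v] v by (simp add: algebra_simps)
  qed
  then show ?thesis unfolding W E_def by simp
qed

text \<open>Weight is counted twice. \<open>Opt\<close> packs \<open>X\<close> together with
  \<open>e\<close>, so the drones have total weight at least 1 more than \<open>X\<close>; but each
  drone blocks \<open>e\<close>, so the load given to it by \<open>A\<close> has nearly the weight
  of the drone. The gap of 1 would have to be covered by the total deficit \<phi> \<epsilon> S,
  where S is the total of \<open>V\<close>.\<close>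

lemma any_fit_failure_normalized:
  fixes y V :: "nat \<Rightarrow> real" and m :: nat and \<epsilon> :: real
  assumes J: "finite J" "card J \<le> m" and X: "finite X" "e \<notin> X"
    and y1: "\<And>x. x \<in> insert e X \<Longrightarrow> 1 \<le> y x"
    and OJ: "\<And>x. x \<in> insert e X \<Longrightarrow> Opt x \<in> J"
    and Oload: "\<And>j. j \<in> J \<Longrightarrow> (\<Sum>x | x \<in> insert e X \<and> Opt x = j. y x) \<le> V j"
    and eps: "0 \<le> \<epsilon>" "8 * (\<epsilon> * m) \<le> 1" "\<epsilon> \<le> 1 / 8"
    and full: "\<And>j. j \<in> J \<Longrightarrow> (golden_ratio - \<epsilon>) * V j < (\<Sum>x | x \<in> X \<and> A x = j. y x) + 1"
  shows False
proof -
  let ?g = golden_ratio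
  note g = golden_ratio_bounds golden_ratio_sq
  \<comment> \<open>Normalized lengths are at least 1, so a drone with \<open>V j < 1\<close>
    carries nothing in \<open>Opt\<close>.\<close>
  define K where "K = {j \<in> J. 1 \<le> V j}"
  have K: "finite K" "K \<subseteq> J" "card K \<le> m"
    using J card_mono[of J K] by (auto simp: K_def)
  have OK: "Opt x \<in> K" if x: "x \<in> insert e X" for x
  proof -
    have "y x \<le> (\<Sum>x' | x' \<in> insert e X \<and> Opt x' = Opt x. y x')"
      using x X y1 by (intro member_le_sum) (auto simp: order_trans[OF zero_le_one])
    then show ?thesis using Oload[OF OJ[OF x]] y1[OF x] OJ[OF x] by (auto simp: K_def)
  qed
  have optsum: "(\<Sum>x\<in>insert e X. f x) = (\<Sum>j\<in>K. \<Sum>x | x \<in> insert e X \<and> Opt x = j. f x)" for f :: "nat \<Rightarrow> real"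
    using X K OK by (intro sum.group[symmetric]) auto
  \<comment> \<open>Only an inequality, since \<open>A\<close> is arbitrary and may send parcels
    outside \<open>K\<close>.\<close>
  have algsum: "(\<Sum>j\<in>K. \<Sum>x | x \<in> X \<and> A x = j. f x) \<le> (\<Sum>x\<in>X. f x)"
    if "\<And>x. x \<in> X \<Longrightarrow> 0 \<le> f x" for f :: "nat \<Rightarrow> real"
  proof -
    have "(\<Sum>j\<in>K. \<Sum>x | x \<in> X \<and> A x = j. f x) = (\<Sum>j\<in>K. \<Sum>x | x \<in> {x\<in>X. A x \<in> K} \<and> A x = j. f x)"
      by (intro sum.cong) auto
    also have "\<dots> = (\<Sum>x\<in>{x\<in>X. A x \<in> K}. f x)"
      using X K by (intro sum.group) auto
    also have "\<dots> \<le> (\<Sum>x\<in>X. f x)" using X that by (intro sum_mono2) auto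
    finally show ?thesis .
  qed
  define S where "S = (\<Sum>j\<in>K. V j)"
  have S0: "0 \<le> S" unfolding S_def by (intro sum_nonneg) (auto simp: K_def)
  have vol: "(?g - \<epsilon> - 1) * S \<le> m"
  proof -
    have "(\<Sum>j\<in>K. (?g - \<epsilon>) * V j) \<le> (\<Sum>j\<in>K. (\<Sum>x | x \<in> X \<and> A x = j. y x) + 1)"
      using full K by (intro sum_mono) (auto intro: less_imp_le)
    also have "\<dots> = (\<Sum>j\<in>K. \<Sum>x | x \<in> X \<and> A x = j. y x) + card K" by (simp add: sum.distrib)
    also have "\<dots> \<le> (\<Sum>x\<in>X. y x) + card K"
      using algsum[of y] y1 by (auto simp: order_trans[OF zero_le_one])
    also have "(\<Sum>x\<in>X. y x) \<le> (\<Sum>x\<in>insert e X. y x)" using X y1[of e] by simp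
    also have "\<dots> \<le> S" unfolding optsum S_def using Oload K by (intro sum_mono) auto
    finally have "(?g - \<epsilon>) * S \<le> S + card K" by (simp add: S_def sum_distrib_left)
    then show ?thesis using K by (simp add: algebra_simps)
  qed
  have "(\<Sum>j\<in>K. weight (V j)) - ?g * (\<epsilon> * S) = (\<Sum>j\<in>K. weight (V j) - ?g * (\<epsilon> * V j))"
    by (simp add: S_def sum_subtractf sum_distrib_left)
  also have "\<dots> \<le> (\<Sum>j\<in>K. \<Sum>x | x \<in> X \<and> A x = j. weight (y x))"
  proof (intro sum_mono weight_sum_lower)
    fix j assume j: "j \<in> K"
    then show "(?g - \<epsilon>) * V j - 1 < (\<Sum>x | x \<in> X \<and> A x = j. y x)"
      using full[of j] K by auto
  qed (use X y1 eps in \<open>auto simp: K_def\<close>)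
  also have "\<dots> \<le> (\<Sum>x\<in>X. weight (y x))"
    using y1 by (intro algsum weight_nonneg) (auto simp: order_trans[OF zero_le_one])
  also have "\<dots> + 1 \<le> (\<Sum>x\<in>insert e X. weight (y x))"
    using X weight_ge_1[OF y1[of e]] by simp
  also have "\<dots> \<le> (\<Sum>j\<in>K. weight (V j))"
  proof -
    have "(\<Sum>x | x \<in> insert e X \<and> Opt x = j. weight (y x)) \<le> weight (V j)" if "j \<in> K" for j
      using weight_sum[of "{x. x \<in> insert e X \<and> Opt x = j}" y] weight_mono[OF Oload[of j]] that X K
      by (auto intro: order_trans)
    then show ?thesis unfolding optsum by (intro sum_mono) auto
  qed
  finally have c: "1 \<le> ?g * (\<epsilon> * S)" by simp
  \<comment> \<open>19/40 = 8/5 - 1/8 - 1 from the bounds on \<phi> and \<epsilon>. It yields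
    \<epsilon> S \<le> 5/19, hence \<phi> \<epsilon> S \<le> 10/19 < 1.\<close>
  have "(19/40) * S \<le> (?g - \<epsilon> - 1) * S" using g eps S0 by (intro mult_right_mono) auto
  then have "19 * S \<le> 40 * real m" using vol by linarith
  then have "\<epsilon> * (19 * S) \<le> \<epsilon> * (40 * real m)" using eps by (intro mult_left_mono) auto
  then have "19 * (\<epsilon> * S) \<le> 5" using eps by (simp add: algebra_simps)
  moreover have "?g * (\<epsilon> * S) \<le> 2 * (\<epsilon> * S)" using g eps S0 by (intro mult_right_mono) auto
  ultimately show False using c by linarith
qed

lemma any_fit_failure:
  fixes l v :: "nat \<Rightarrow> real" and m :: nat and \<epsilon> :: real
  assumes J: "finite J" "card J \<le> m" and X: "finite X" "e \<notin> X"
    and le: "0 < l e" "\<And>x. x \<in> X \<Longrightarrow> l e \<le> l x"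
    and OJ: "\<And>x. x \<in> insert e X \<Longrightarrow> Opt x \<in> J"
    and Oload: "\<And>j. j \<in> J \<Longrightarrow> (\<Sum>x | x \<in> insert e X \<and> Opt x = j. l x) \<le> T * v j"
    and eps: "0 \<le> \<epsilon>" "8 * (\<epsilon> * m) \<le> 1" "\<epsilon> \<le> 1 / 8"
    and full: "\<And>j. j \<in> J \<Longrightarrow> (golden_ratio - \<epsilon>) * T * v j < (\<Sum>x | x \<in> X \<and> A x = j. l x) + l e"
  shows False
proof (rule any_fit_failure_normalized
      [where y = "\<lambda>x. l x / l e" and V = "\<lambda>j. T * v j / l e" and A = A, OF J X _ OJ _ eps])
  show "1 \<le> l x / l e" if "x \<in> insert e X" for x
    using that le by (auto simp: field_simps)
  show "(\<Sum>x | x \<in> insert e X \<and> Opt x = j. l x / l e) \<le> T * v j / l e" if "j \<in> J" for j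
    using Oload[OF that] le by (auto simp: sum_divide_distrib[symmetric] intro!: divide_right_mono)
  show "(golden_ratio - \<epsilon>) * (T * v j / l e) < (\<Sum>x | x \<in> X \<and> A x = j. l x / l e) + 1" if "j \<in> J" for j
    using divide_strict_right_mono[OF full[OF that] le(1)] le(1)
    by (simp add: sum_divide_distrib[symmetric] add_divide_distrib mult.assoc)
qed

section \<open>A structured language for the register machine\<close>

type_synonym state = "(nat \<Rightarrow> int) \<times> (nat \<Rightarrow> real)"

datatype com =
    Block "instr list"
  | Seq com com (infixr ";;" 60)
  | IfI nat nat com com
  | IfR nat nat com com
  | While nat nat com

fun eff :: "instr \<Rightarrow> state \<Rightarrow> state" where
  "eff (IConst a c) (I, R) = (I(a := c), R)"
| "eff (IAdd a b c) (I, R) = (I(a := I b + I c), R)"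
| "eff (ISub a b c) (I, R) = (I(a := I b - I c), R)"
| "eff (IHalf a b) (I, R) = (I(a := I b div 2), R)"
| "eff (ILoad a b) (I, R) = (I(a := I (nat (I b))), R)"
| "eff (IStore a b) (I, R) = (I(nat (I a) := I b), R)"
| "eff (RConst a c) (I, R) = (I, R(a := c))"
| "eff (RAdd a b c) (I, R) = (I, R(a := R b + R c))"
| "eff (RSub a b c) (I, R) = (I, R(a := R b - R c))"
| "eff (RMul a b c) (I, R) = (I, R(a := R b * R c))"
| "eff (RDiv a b c) (I, R) = (I, R(a := R b / R c))"
| "eff (RLoad a b) (I, R) = (I, R(a := R (nat (I b))))"
| "eff (RStore a b) (I, R) = (I, R(nat (I a) := R b))"
| "eff _ s = s"

fun plain :: "instr \<Rightarrow> bool" where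
  "plain (IJle _ _ _) = False"
| "plain (RJle _ _ _) = False"
| "plain Halt = False"
| "plain _ = True"

fun well_formed :: "com \<Rightarrow> bool" where
  "well_formed (Block is) = list_all plain is"
| "well_formed (c1 ;; c2) = (well_formed c1 \<and> well_formed c2)"
| "well_formed (IfI a b c1 c2) = (well_formed c1 \<and> well_formed c2)"
| "well_formed (IfR a b c1 c2) = (well_formed c1 \<and> well_formed c2)"
| "well_formed (While a b c) = well_formed c"

fun effs :: "instr list \<Rightarrow> state \<Rightarrow> state" where
  "effs [] s = s"
| "effs (i # is) s = effs is (eff i s)"

lemma effs_append: "effs (xs @ ys) s = effs ys (effs xs s)"
  by (induction xs arbitrary: s) auto

text \<open>\<open>IfI a b\<close> and \<open>IfR a b\<close> take the first branch iff register \<open>a\<close> is at most register \<open>b\<close>;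
  \<open>While a b\<close> iterates as long as integer register \<open>b\<close> is strictly less than integer register \<open>a\<close>.
  The number counts the machine steps of the compiled code.\<close>

inductive run :: "com \<Rightarrow> state \<Rightarrow> nat \<Rightarrow> state \<Rightarrow> bool" where
  run_Block: "run (Block is) s (length is) (effs is s)"
| run_Seq: "run c1 s k1 s1 \<Longrightarrow> run c2 s1 k2 s2 \<Longrightarrow> run (c1 ;; c2) s (k1 + k2) s2"
| run_IfI_True: "fst s a \<le> fst s b \<Longrightarrow> run c1 s k s' \<Longrightarrow> run (IfI a b c1 c2) s (k + 1) s'"
| run_IfI_False: "\<not> fst s a \<le> fst s b \<Longrightarrow> run c2 s k s' \<Longrightarrow> run (IfI a b c1 c2) s (k + 2) s'"
| run_IfR_True: "snd s a \<le> snd s b \<Longrightarrow> run c1 s k s' \<Longrightarrow> run (IfR a b c1 c2) s (k + 1) s'"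
| run_IfR_False: "\<not> snd s a \<le> snd s b \<Longrightarrow> run c2 s k s' \<Longrightarrow> run (IfR a b c1 c2) s (k + 2) s'"
| run_While_False: "fst s a \<le> fst s b \<Longrightarrow> run (While a b c) s 1 s"
| run_While_True: "\<not> fst s a \<le> fst s b \<Longrightarrow> run c s k1 s1 \<Longrightarrow> run (While a b c) s1 k2 s2
    \<Longrightarrow> run (While a b c) s (k1 + k2 + 2) s2"

text \<open>Jump targets are absolute, hence the start address \<open>p\<close>. \<open>IJle\<close>
  and \<open>RJle\<close> jump when the test holds, so the second branch comes directly behind the
  test and then leaps over the first one by \<open>IJle 0 0\<close>, which always jumps. This is the
  additional step in the False rules of \<open>run\<close>.\<close>

fun compile :: "nat \<Rightarrow> com \<Rightarrow> instr list" where
  "compile p (Block is) = is"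
| "compile p (c1 ;; c2) = (let x = compile p c1 in x @ compile (p + length x) c2)"
| "compile p (IfI a b c1 c2) = (let y = compile (p + 1) c2; q = p + length y + 2; x = compile q c1
     in IJle a b q # y @ IJle 0 0 (q + length x) # x)"
| "compile p (IfR a b c1 c2) = (let y = compile (p + 1) c2; q = p + length y + 2; x = compile q c1
     in RJle a b q # y @ IJle 0 0 (q + length x) # x)"
| "compile p (While a b c) = (let x = compile (p + 1) c
     in IJle a b (p + length x + 2) # x @ [IJle 0 0 p])"

lemma steps_add: "steps P (a + b) c = steps P b (steps P a c)"
  by (simp add: steps_def add.commute[of a] funpow_add)

lemma steps_Suc: "steps P (Suc k) c = steps P k (step P c)"
  by (simp add: steps_def funpow_swap1)

lemma steps_0 [simp]: "steps P 0 c = c"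
  by (simp add: steps_def)

lemma step_at:
  assumes "P = A @ i # B" "length A = p" "i \<noteq> Halt"
  shows "step P (p, s) = exec i (p, s)"
  using assms by (auto simp: step_def halted_def)

lemma exec_plain: "plain i \<Longrightarrow> exec i (p, s) = (Suc p, eff i s)"
  by (cases s; cases i) auto

lemma steps_plain:
  assumes "P = A @ is @ B" "length A = p" "list_all plain is"
  shows "steps P (length is) (p, s) = (p + length is, effs is s)"
  using assms
proof (induction "is" arbitrary: A p s)
  case (Cons i "is")
  have i: "plain i" "i \<noteq> Halt" using Cons.prems by auto
  have "step P (p, s) = (Suc p, eff i s)"
    using step_at[of P A i "is @ B" p s] Cons.prems i by (simp add: exec_plain)
  moreover have "steps P (length is) (Suc p, eff i s) = (Suc p + length is, effs is (eff i s))"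
    using Cons.prems by (intro Cons.IH[of "A @ [i]"]) auto
  ultimately show ?case by (simp add: steps_Suc)
qed simp

text \<open>The code sits at address \<open>p\<close> of an arbitrary larger program, so that the
  induction hypotheses apply to its sub-blocks within the same \<open>P\<close>. The induction
  follows \<open>run\<close> rather than the syntax, because a loop recurs unchanged in its own
  premise.\<close>

lemma steps_compile:
  assumes "run c s k s'" "well_formed c" "P = A @ compile p c @ B" "length A = p"
  shows "steps P k (p, s) = (p + length (compile p c), s')"
  using assms
proof (induction arbitrary: A B p rule: run.induct)
  case (run_Block "is" s)
  then show ?case using steps_plain[of P A "is" B p s] by simp
next
  case (run_Seq c1 s k1 s1 c2 k2 s2)
  let ?x = "compile p c1"
  have "steps P k1 (p, s) = (p + length ?x, s1)"
    using run_Seq.prems by (intro run_Seq.IH(1)[of A _ "compile (p + length ?x) c2 @ B"]) (auto simp: Let_def)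
  moreover have "steps P k2 (p + length ?x, s1) = (p + length ?x + length (compile (p + length ?x) c2), s2)"
    using run_Seq.prems by (intro run_Seq.IH(2)[of "A @ ?x" _ B]) (auto simp: Let_def)
  ultimately show ?case by (simp add: steps_add Let_def)
next
  case (run_IfI_True s a b c1 k s' c2)
  define y where "y = compile (p + 1) c2"
  define q where "q = p + length y + 2"
  define x where "x = compile q c1"
  have P: "P = A @ IJle a b q # y @ IJle 0 0 (q + length x) # x @ B"
    and c: "compile p (IfI a b c1 c2) = IJle a b q # y @ IJle 0 0 (q + length x) # x"
    using run_IfI_True.prems by (simp_all add: Let_def x_def y_def q_def)
  have "step P (p, s) = exec (IJle a b q) (p, s)"
    using P run_IfI_True.prems(3) by (rule step_at) simp
  then have "step P (p, s) = (q, s)" using run_IfI_True.hyps(1) by (cases s) simp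
  moreover have "steps P k (q, s) = (q + length x, s')"
    unfolding x_def
    by (rule run_IfI_True.IH[of "A @ IJle a b q # y @ [IJle 0 0 (q + length x)]" _ B])
      (use run_IfI_True.prems in \<open>simp_all add: P x_def q_def\<close>)
  ultimately show ?case unfolding c by (simp add: steps_Suc q_def)
next
  case (run_IfI_False s a b c2 k s' c1)
  define y where "y = compile (p + 1) c2"
  define q where "q = p + length y + 2"
  define x where "x = compile q c1"
  have P: "P = A @ IJle a b q # y @ IJle 0 0 (q + length x) # x @ B"
    and c: "compile p (IfI a b c1 c2) = IJle a b q # y @ IJle 0 0 (q + length x) # x"
    using run_IfI_False.prems by (simp_all add: Let_def x_def y_def q_def)
  have "step P (p, s) = exec (IJle a b q) (p, s)"
    using P run_IfI_False.prems(3) by (rule step_at) simp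
  then have "step P (p, s) = (p + 1, s)" using run_IfI_False.hyps(1) by (cases s) simp
  moreover have "steps P k (p + 1, s) = (p + 1 + length y, s')"
    unfolding y_def
    by (rule run_IfI_False.IH[of "A @ [IJle a b q]" _ "IJle 0 0 (q + length x) # x @ B"])
      (use run_IfI_False.prems in \<open>simp_all add: P y_def\<close>)
  moreover have "step P (p + 1 + length y, s') = exec (IJle 0 0 (q + length x)) (p + 1 + length y, s')"
    by (rule step_at[of _ "A @ IJle a b q # y" _ "x @ B"])
      (use run_IfI_False.prems(3) in \<open>simp_all add: P\<close>)
  then have "step P (p + 1 + length y, s') = (q + length x, s')" by (cases s') simp
  ultimately show ?case
    unfolding c using steps_add[of P "Suc k" 1 "(p, s)"] by (simp add: steps_Suc q_def)
next
  case (run_IfR_True s a b c1 k s' c2)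
  define y where "y = compile (p + 1) c2"
  define q where "q = p + length y + 2"
  define x where "x = compile q c1"
  have P: "P = A @ RJle a b q # y @ IJle 0 0 (q + length x) # x @ B"
    and c: "compile p (IfR a b c1 c2) = RJle a b q # y @ IJle 0 0 (q + length x) # x"
    using run_IfR_True.prems by (simp_all add: Let_def x_def y_def q_def)
  have "step P (p, s) = exec (RJle a b q) (p, s)"
    using P run_IfR_True.prems(3) by (rule step_at) simp
  then have "step P (p, s) = (q, s)" using run_IfR_True.hyps(1) by (cases s) simp
  moreover have "steps P k (q, s) = (q + length x, s')"
    unfolding x_def
    by (rule run_IfR_True.IH[of "A @ RJle a b q # y @ [IJle 0 0 (q + length x)]" _ B])
      (use run_IfR_True.prems in \<open>simp_all add: P x_def q_def\<close>)
  ultimately show ?case unfolding c by (simp add: steps_Suc q_def)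
next
  case (run_IfR_False s a b c2 k s' c1)
  define y where "y = compile (p + 1) c2"
  define q where "q = p + length y + 2"
  define x where "x = compile q c1"
  have P: "P = A @ RJle a b q # y @ IJle 0 0 (q + length x) # x @ B"
    and c: "compile p (IfR a b c1 c2) = RJle a b q # y @ IJle 0 0 (q + length x) # x"
    using run_IfR_False.prems by (simp_all add: Let_def x_def y_def q_def)
  have "step P (p, s) = exec (RJle a b q) (p, s)"
    using P run_IfR_False.prems(3) by (rule step_at) simp
  then have "step P (p, s) = (p + 1, s)" using run_IfR_False.hyps(1) by (cases s) simp
  moreover have "steps P k (p + 1, s) = (p + 1 + length y, s')"
    unfolding y_def
    by (rule run_IfR_False.IH[of "A @ [RJle a b q]" _ "IJle 0 0 (q + length x) # x @ B"])
      (use run_IfR_False.prems in \<open>simp_all add: P y_def\<close>)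
  moreover have "step P (p + 1 + length y, s') = exec (IJle 0 0 (q + length x)) (p + 1 + length y, s')"
    by (rule step_at[of _ "A @ RJle a b q # y" _ "x @ B"])
      (use run_IfR_False.prems(3) in \<open>simp_all add: P\<close>)
  then have "step P (p + 1 + length y, s') = (q + length x, s')" by (cases s') simp
  ultimately show ?case
    unfolding c using steps_add[of P "Suc k" 1 "(p, s)"] by (simp add: steps_Suc q_def)
next
  case (run_While_False s a b c)
  define x where "x = compile (p + 1) c"
  have P: "P = A @ IJle a b (p + length x + 2) # x @ IJle 0 0 p # B"
    and c: "compile p (While a b c) = IJle a b (p + length x + 2) # x @ [IJle 0 0 p]"
    using run_While_False.prems by (simp_all add: Let_def x_def)
  have "step P (p, s) = exec (IJle a b (p + length x + 2)) (p, s)"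
    using P run_While_False.prems(3) by (rule step_at) simp
  then have "step P (p, s) = (p + length x + 2, s)" using run_While_False.hyps(1) by (cases s) simp
  then show ?case unfolding c by (simp add: steps_Suc)
next
  case (run_While_True s a b c k1 s1 k2 s2)
  define x where "x = compile (p + 1) c"
  have P: "P = A @ IJle a b (p + length x + 2) # x @ IJle 0 0 p # B"
    using run_While_True.prems by (simp add: Let_def x_def)
  have "step P (p, s) = exec (IJle a b (p + length x + 2)) (p, s)"
    using P run_While_True.prems(3) by (rule step_at) simp
  then have "step P (p, s) = (p + 1, s)" using run_While_True.hyps(1) by (cases s) simp
  moreover have "steps P k1 (p + 1, s) = (p + 1 + length x, s1)"
    unfolding x_def
    by (rule run_While_True.IH(1)[of "A @ [IJle a b (p + length x + 2)]" _ "IJle 0 0 p # B"])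
      (use run_While_True.prems in \<open>simp_all add: P x_def\<close>)
  moreover have "step P (p + 1 + length x, s1) = exec (IJle 0 0 p) (p + 1 + length x, s1)"
    by (rule step_at[of _ "A @ IJle a b (p + length x + 2) # x" _ B])
      (use run_While_True.prems(3) in \<open>simp_all add: P\<close>)
  then have "step P (p + 1 + length x, s1) = (p, s1)" by (cases s1) simp
  moreover have "steps P k2 (p, s1) = (p + length (compile p (While a b c)), s2)"
    using run_While_True.prems by (rule run_While_True.IH(2))
  ultimately show ?case
    using steps_add[of P "Suc k1" "Suc k2" "(p, s)"] by (simp add: steps_Suc)
qed

section \<open>Total correctness with step bounds\<close>

definition tc :: "com \<Rightarrow> state \<Rightarrow> nat \<Rightarrow> (state \<Rightarrow> bool) \<Rightarrow> bool" where
  "tc c s t Q \<longleftrightarrow> (\<exists>k s'. run c s k s' \<and> k \<le> t \<and> Q s')"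

lemma tc_conseq: "tc c s t Q \<Longrightarrow> t \<le> t' \<Longrightarrow> (\<And>s'. Q s' \<Longrightarrow> Q' s') \<Longrightarrow> tc c s t' Q'"
  unfolding tc_def using order_trans by blast

lemma tc_Block: "Q (effs is s) \<Longrightarrow> length is \<le> t \<Longrightarrow> tc (Block is) s t Q"
  unfolding tc_def using run_Block by blast

lemma tc_Seq:
  assumes "tc c1 s t1 P" "\<And>s'. P s' \<Longrightarrow> tc c2 s' t2 Q" "t1 + t2 \<le> t"
  shows "tc (c1 ;; c2) s t Q"
proof -
  obtain k1 s1 where 1: "run c1 s k1 s1" "k1 \<le> t1" "P s1" using assms(1) unfolding tc_def by blast
  then obtain k2 s2 where 2: "run c2 s1 k2 s2" "k2 \<le> t2" "Q s2" using assms(2)[of s1] unfolding tc_def by blast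
  show ?thesis unfolding tc_def using run_Seq[OF 1(1) 2(1)] 1 2 assms(3)
    by (intro exI[of _ "k1 + k2"] exI[of _ s2]) auto
qed

lemma tc_Block_Seq:
  "tc c (effs is s) t' Q \<Longrightarrow> length is + t' \<le> t \<Longrightarrow> tc (Block is ;; c) s t Q"
  by (rule tc_Seq[where P = "\<lambda>s'. s' = effs is s" and ?t1.0 = "length is" and ?t2.0 = t'])
    (auto intro: tc_Block)

lemma tc_IfI:
  assumes "fst s a \<le> fst s b \<Longrightarrow> tc c1 s t' Q" "\<not> fst s a \<le> fst s b \<Longrightarrow> tc c2 s t' Q" "t' + 2 \<le> t"
  shows "tc (IfI a b c1 c2) s t Q"
proof (cases "fst s a \<le> fst s b")
  case True
  then obtain k s' where "run c1 s k s'" "k \<le> t'" "Q s'" using assms unfolding tc_def by blast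
  then show ?thesis using run_IfI_True[OF True, of c1 k s' c2] assms(3) unfolding tc_def
    by (intro exI[of _ "k + 1"] exI[of _ s']) auto
next
  case False
  then obtain k s' where "run c2 s k s'" "k \<le> t'" "Q s'" using assms unfolding tc_def by blast
  then show ?thesis using run_IfI_False[OF False, of c2 k s' c1] assms(3) unfolding tc_def
    by (intro exI[of _ "k + 2"] exI[of _ s']) auto
qed

lemma tc_IfR:
  assumes "snd s a \<le> snd s b \<Longrightarrow> tc c1 s t' Q" "\<not> snd s a \<le> snd s b \<Longrightarrow> tc c2 s t' Q" "t' + 2 \<le> t"
  shows "tc (IfR a b c1 c2) s t Q"
proof (cases "snd s a \<le> snd s b")
  case True
  then obtain k s' where "run c1 s k s'" "k \<le> t'" "Q s'" using assms unfolding tc_def by blast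
  then show ?thesis using run_IfR_True[OF True, of c1 k s' c2] assms(3) unfolding tc_def
    by (intro exI[of _ "k + 1"] exI[of _ s']) auto
next
  case False
  then obtain k s' where "run c2 s k s'" "k \<le> t'" "Q s'" using assms unfolding tc_def by blast
  then show ?thesis using run_IfR_False[OF False, of c2 k s' c1] assms(3) unfolding tc_def
    by (intro exI[of _ "k + 2"] exI[of _ s']) auto
qed

text \<open>\<open>Inv k\<close> holds whenever at most \<open>k\<close> further iterations follow.\<close>

lemma tc_While:
  assumes init: "Inv N s"
    and body: "\<And>k s. Inv k s \<Longrightarrow> fst s b < fst s a \<Longrightarrow> 0 < k \<and> tc c s tb (Inv (k - 1))"
    and exit: "\<And>k s. Inv k s \<Longrightarrow> fst s a \<le> fst s b \<Longrightarrow> Q s"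
    and t: "N * (tb + 2) + 1 \<le> t"
  shows "tc (While a b c) s t Q"
proof -
  have "tc (While a b c) s (N * (tb + 2) + 1) Q"
    using init
  proof (induction N arbitrary: s)
    case 0
    have F: "fst s a \<le> fst s b" using body[OF 0] by (meson less_irrefl not_le)
    show ?case using run_While_False[OF F, of c] exit[OF 0 F] unfolding tc_def
      by (intro exI[of _ 1] exI[of _ s]) auto
  next
    case (Suc N)
    show ?case
    proof (cases "fst s a \<le> fst s b")
      case True
      then show ?thesis using run_While_False[OF True, of c] exit[OF Suc.prems True] unfolding tc_def
        by (intro exI[of _ 1] exI[of _ s]) auto
    next
      case False
      then obtain k1 s1 where 1: "run c s k1 s1" "k1 \<le> tb" "Inv N s1"
        using body[OF Suc.prems] unfolding tc_def by (auto simp: not_le)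
      obtain k2 s2 where 2: "run (While a b c) s1 k2 s2" "k2 \<le> N * (tb + 2) + 1" "Q s2"
        using Suc.IH[OF 1(3)] unfolding tc_def by blast
      show ?thesis using run_While_True[OF False 1(1) 2(1)] 1 2 unfolding tc_def
        by (intro exI[of _ "k1 + k2 + 2"] exI[of _ s2]) auto
    qed
  qed
  then show ?thesis using t by (rule tc_conseq) auto
qed

text \<open>The existence of one run is all that \<open>tc\<close> asserts; it becomes a statement
  about the function \<open>steps\<close>. The run ends exactly at the appended
  \<open>Halt\<close>.\<close>

lemma tc_steps:
  assumes "tc c s t Q" "well_formed c"
  obtains k s' where "k \<le> t" "steps (compile 0 c @ [Halt]) k (0, s) = (length (compile 0 c), s')" "Q s'"
proof -
  obtain k s' where k: "run c s k s'" "k \<le> t" "Q s'" using assms unfolding tc_def by blast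
  have "steps (compile 0 c @ [Halt]) k (0, s) = (length (compile 0 c), s')"
    using steps_compile[OF k(1) assms(2), of "compile 0 c @ [Halt]" "[]" 0 "[Halt]"] by simp
  with k that show ?thesis by blast
qed

section \<open>Tournament trees\<close>

text \<open>The frame condition of the postconditions: only cells in \<open>S\<close> may have
  changed.\<close>

definition agree_off :: "nat set \<Rightarrow> (nat \<Rightarrow> 'a) \<Rightarrow> (nat \<Rightarrow> 'a) \<Rightarrow> bool" where
  "agree_off S f g \<longleftrightarrow> (\<forall>a. a \<notin> S \<longrightarrow> g a = f a)"

lemma agree_offD: "agree_off S f g \<Longrightarrow> a \<notin> S \<Longrightarrow> g a = f a"
  by (simp add: agree_off_def)

lemma agree_off_mono: "agree_off S f g \<Longrightarrow> S \<subseteq> S' \<Longrightarrow> agree_off S' f g"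
  by (auto simp: agree_off_def)

lemma agree_off_trans:
  assumes "agree_off S f g" "agree_off S' g h" "S \<subseteq> U" "S' \<subseteq> U"
  shows "agree_off U f h"
  unfolding agree_off_def
proof (intro allI impI)
  fix a assume "a \<notin> U"
  then have "a \<notin> S" "a \<notin> S'" using assms by auto
  then show "h a = f a" using assms by (simp add: agree_off_def)
qed

lemma int_fold:
  "int a + int b = int (a + b)" "1 + int a = int (Suc a)" "int a + 1 = int (Suc a)"
  by auto

lemmas int_unfold = of_nat_add of_nat_Suc

text \<open>A tournament tree with \<open>M\<close> leaves stored at \<open>R (B + M), \<dots>, R (B + 2 * M - 1)\<close>; every inner
  node \<open>t\<close> with \<open>1 \<le> t < M\<close> holds the maximum of its children \<open>2 * t\<close> and \<open>2 * t + 1\<close>, except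
  possibly node \<open>q\<close> (no exception if \<open>q = 0\<close>).\<close>

definition tree_ok :: "(nat \<Rightarrow> real) \<Rightarrow> nat \<Rightarrow> nat \<Rightarrow> nat \<Rightarrow> bool" where
  "tree_ok R B M q \<longleftrightarrow> (\<forall>t. 1 \<le> t \<and> t < M \<and> t \<noteq> q \<longrightarrow>
     R (B + t) = max (R (B + 2 * t)) (R (B + 2 * t + 1)))"

text \<open>Values can only grow on the way from \<open>t\<close> to \<open>t div 2\<close>. Nodes
  below \<open>M\<close> are inner and nodes \<open>M\<close> to \<open>2 * M - 1\<close> are leaves
  for every \<open>M\<close>, so no padding to a power of two takes place.\<close>

lemma tree_ok_root:
  assumes "tree_ok R B M 0"
  shows "1 \<le> t \<Longrightarrow> t < 2 * M \<Longrightarrow> R (B + t) \<le> R (B + 1)"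
proof (induction t rule: less_induct)
  case (less t)
  show ?case
  proof (cases "t = 1")
    case False
    then have h: "1 \<le> t div 2" "t div 2 < M" "t div 2 < t" using less.prems by auto
    then have "R (B + t div 2) = max (R (B + 2 * (t div 2))) (R (B + 2 * (t div 2) + 1))"
      using assms by (auto simp: tree_ok_def)
    moreover have "t = 2 * (t div 2) \<or> t = 2 * (t div 2) + 1" by presburger
    ultimately have "R (B + t) \<le> R (B + t div 2)"
      by (metis add.assoc max.cobounded1 max.cobounded2)
    then show ?thesis using less.IH[OF h(3,1)] h(2) by linarith
  qed simp
qed

text \<open>A changed leaf can contradict only its parent, which becomes the one tolerated
  exception.\<close>

lemma tree_ok_store:
  assumes "tree_ok R B M 0" "M \<le> p" "\<And>a. a \<noteq> B + p \<Longrightarrow> B \<le> a \<Longrightarrow> R' a = R a"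
  shows "tree_ok R' B M (p div 2)"
  unfolding tree_ok_def
proof (intro allI impI, elim conjE)
  fix t assume t: "1 \<le> t" "t < M" "t \<noteq> p div 2"
  then have "2 * t \<noteq> p" "2 * t + 1 \<noteq> p" "t \<noteq> p" using assms by auto
  then show "R' (B + t) = max (R' (B + 2 * t)) (R' (B + 2 * t + 1))"
    using assms t by (simp add: tree_ok_def)
qed

lemma tree_ok_zero:
  assumes "\<forall>t < 2 * M. R (B + t) = 0"
  shows "tree_ok R B M 0"
  unfolding tree_ok_def using assms by (simp add: add.assoc del: add_Suc_right)

definition UPDATE :: com where
  "UPDATE = Block [IHalf 15 15] ;; While 15 23 (
     Block [IAdd 13 15 15, IAdd 13 13 6, RLoad 7 13, IAdd 13 13 2, RLoad 2 13, IAdd 13 6 15] ;;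
     IfR 7 2 (Block [RStore 13 2]) (Block [RStore 13 7]) ;;
     Block [IHalf 15 15])"

text \<open>Recomputing the defective node from its children moves the defect to its parent; when
  the index reaches 0, no defect is left. The index halves in each round, which bounds the rounds by
  \<open>b\<close>. \<open>8 \<le> B\<close> keeps the tree off the real registers 0 to 7. For
  \<open>M = 1\<close> the root is itself the leaf and the loop body never runs.\<close>

lemma tc_UPDATE:
  assumes I: "I 6 = int B" "I 2 = 1" "I 23 = 0" "I 15 = int p" and B: "8 \<le> B"
    and p: "p < 2 * M" "M \<le> 2 ^ b" and tree: "tree_ok R B M (p div 2)"
  shows "tc UPDATE (I, R) (12 * b + 2) (\<lambda>(I', R'). agree_off {13, 15} I I' \<and>
    agree_off ({2, 7} \<union> {B + 1..<B + M}) R R' \<and> tree_ok R' B M 0)"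
proof -
  define Inv where "Inv k s = (case s of (I', R') \<Rightarrow> agree_off {13, 15} I I' \<and>
    agree_off ({2, 7} \<union> {B + 1..<B + M}) R R' \<and>
    (\<exists>p. I' 15 = int p \<and> p < M \<and> p < 2 ^ k \<and> tree_ok R' B M p))" for k :: nat and s
  show ?thesis unfolding UPDATE_def
  proof (rule tc_Block_Seq, rule tc_While[where Inv = Inv and N = b and tb = 10])
    show "Inv b (effs [IHalf 15 15] (I, R))"
      using I p tree by (auto simp: Inv_def agree_off_def intro!: exI[of _ "p div 2"])
  next
    fix k s assume a: "Inv k s" "fst s 23 < fst s 15"
    obtain I' R' where s: "s = (I', R')" by (cases s)
    obtain p where p: "I' 15 = int p" "p < M" "p < 2 ^ k" and tr: "tree_ok R' B M p"
      and ag: "agree_off {13, 15} I I'" "agree_off ({2, 7} \<union> {B + 1..<B + M}) R R'"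
      using a by (auto simp: Inv_def s)
    have I': "I' 6 = int B" "I' 2 = 1" "I' 23 = 0"
      using agree_offD[OF ag(1)] I by auto
    have p0: "0 < p" using a I' p by (simp add: s)
    have k: "0 < k" using p p0 by (cases k) auto
    have pk: "p div 2 < 2 ^ (k - 1)" using p k by (cases k) auto
    let ?R = "R'(7 := R' (B + 2 * p), 2 := R' (B + 2 * p + 1),
      B + p := max (R' (B + 2 * p)) (R' (B + 2 * p + 1)))"
    have e: "effs [IAdd 13 15 15, IAdd 13 13 6, RLoad 7 13, IAdd 13 13 2, RLoad 2 13, IAdd 13 6 15] s
        = (I'(13 := int B + int p), R'(7 := R' (B + 2 * p), 2 := R' (B + 2 * p + 1)))"
      using B by (auto simp: s I' p fun_eq_iff mult_2 mult_2_right int_fold ac_simps simp del: int_unfold)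
    have tr': "tree_ok ?R B M (p div 2)"
      unfolding tree_ok_def
    proof (intro allI impI, elim conjE)
      fix t assume t: "1 \<le> t" "t < M" "t \<noteq> p div 2"
      then have "2 * t \<noteq> p" "2 * t + 1 \<noteq> p" by auto
      then show "?R (B + t) = max (?R (B + 2 * t)) (?R (B + 2 * t + 1))"
        using B t tr p0 by (auto simp: tree_ok_def)
    qed
    have "Inv (k - 1) (I'(13 := int B + int p, 15 := int p div 2), ?R)"
      unfolding Inv_def using ag p0 p pk tr'
      by (auto simp: agree_off_def intro!: exI[of _ "p div 2"])
    then have "tc (IfR 7 2 (Block [RStore 13 2]) (Block [RStore 13 7]) ;; Block [IHalf 15 15])
       (I'(13 := int B + int p), R'(7 := R' (B + 2 * p), 2 := R' (B + 2 * p + 1))) 4 (Inv (k - 1))"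
      using B p p0
      by (intro tc_Seq[where ?t1.0 = 3 and ?t2.0 = 1 and P = "\<lambda>s. s = (I'(13 := int B + int p), ?R)"]
          tc_IfR[where t' = 1] tc_Block) (auto simp: max_def int_fold simp del: int_unfold)
    then show "0 < k \<and> tc (Block [IAdd 13 15 15, IAdd 13 13 6, RLoad 7 13, IAdd 13 13 2, RLoad 2 13,
        IAdd 13 6 15] ;; IfR 7 2 (Block [RStore 13 2]) (Block [RStore 13 7]) ;; Block [IHalf 15 15])
        s 10 (Inv (k - 1))"
      using k by (auto intro!: tc_Block_Seq[where t' = 4] simp only: e) auto
  next
    fix k s assume a: "Inv k s" "fst s 15 \<le> fst s 23"
    then show "case s of (I', R') \<Rightarrow> agree_off {13, 15} I I' \<and>
      agree_off ({2, 7} \<union> {B + 1..<B + M}) R R' \<and> tree_ok R' B M 0"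
      using I by (auto simp: Inv_def agree_off_def)
  qed auto
qed

definition WALK :: com where
  "WALK = Block [IConst 15 1] ;; While 16 15 (
     Block [IAdd 15 15 15, IAdd 13 15 6, RLoad 7 13] ;;
     IfR 0 7 (Block []) (Block [IAdd 15 15 2]))"

text \<open>The current node always holds at least \<open>R 0\<close>: if the left child is too
  small, the maximum is attained on the right. The conjunct \<open>M \<le> p * 2 ^ k\<close> of the
  invariant says that at most \<open>k\<close> levels remain. Any sufficiently large leaf may be
  returned; if \<open>R 0\<close> is the value of the root, the leaf is a maximum.\<close>

lemma tc_WALK:
  assumes I: "I 6 = int B" "I 2 = 1" "I 16 = int M" and B: "8 \<le> B"
    and M: "1 \<le> M" "M \<le> 2 ^ b" and tree: "tree_ok R B M 0" and root: "R 0 \<le> R (B + 1)"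
  shows "tc WALK (I, R) (8 * b + 2) (\<lambda>(I', R'). agree_off {13, 15} I I' \<and>
    agree_off {7} R R' \<and> (\<exists>p. I' 15 = int p \<and> M \<le> p \<and> p < 2 * M \<and> R 0 \<le> R (B + p)))"
proof -
  define Inv where "Inv k s = (case s of (I', R') \<Rightarrow> agree_off {13, 15} I I' \<and>
    agree_off {7} R R' \<and>
    (\<exists>p. I' 15 = int p \<and> 1 \<le> p \<and> p < 2 * M \<and> M \<le> p * 2 ^ k \<and> R 0 \<le> R (B + p)))"
    for k :: nat and s
  show ?thesis unfolding WALK_def
  proof (rule tc_Block_Seq, rule tc_While[where Inv = Inv and N = b and tb = 6])
    show "Inv b (effs [IConst 15 1] (I, R))"
      using M root by (auto simp: Inv_def agree_off_def intro!: exI[of _ "1 :: nat"])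
  next
    fix k s assume a: "Inv k s" "fst s 15 < fst s 16"
    obtain I' R' where s: "s = (I', R')" by (cases s)
    obtain p where p: "I' 15 = int p" "1 \<le> p" "M \<le> p * 2 ^ k" and r: "R 0 \<le> R (B + p)"
      and ag: "agree_off {13, 15} I I'" "agree_off {7} R R'"
      using a by (auto simp: Inv_def s)
    have I': "I' 6 = int B" "I' 2 = 1" "I' 16 = int M"
      using agree_offD[OF ag(1)] I by auto
    have R': "R' a = R a" if "a \<noteq> 7" for a using agree_offD[OF ag(2)] that by auto
    have pM: "p < M" using a I' p by (simp add: s)
    have k: "0 < k" using p pM by (cases k) auto
    have pk: "M \<le> 2 * p * 2 ^ (k - 1)" using p k by (cases k) auto
    have pk': "M \<le> (2 * p + 1) * 2 ^ (k - 1)" using pk by (simp add: algebra_simps)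
    have e: "effs [IAdd 15 15 15, IAdd 13 15 6, RLoad 7 13] s
        = (I'(15 := int (2 * p), 13 := int (2 * p + B)), R'(7 := R (B + 2 * p)))"
      using B R'[of "B + 2 * p"] by (auto simp: s I' p fun_eq_iff mult_2 mult_2_right int_fold ac_simps simp del: int_unfold)
    have mx: "R (B + p) = max (R (B + 2 * p)) (R (B + 2 * p + 1))"
      using tree p pM by (auto simp: tree_ok_def)
    have "Inv (k - 1) (I'(15 := int (2 * p), 13 := int (2 * p + B)), R'(7 := R (B + 2 * p)))"
      if "R 0 \<le> R (B + 2 * p)"
      unfolding Inv_def using ag p pk pM that
      by (auto simp: agree_off_def intro!: exI[of _ "2 * p"])
    moreover have "Inv (k - 1) (I'(15 := int (2 * p) + 1, 13 := int (2 * p + B)), R'(7 := R (B + 2 * p)))"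
      if "\<not> R 0 \<le> R (B + 2 * p)"
      unfolding Inv_def using ag p pk' pM that r mx
      by (auto simp: agree_off_def intro!: exI[of _ "2 * p + 1"])
    ultimately have "tc (IfR 0 7 (Block []) (Block [IAdd 15 15 2]))
       (I'(15 := int (2 * p), 13 := int (2 * p + B)), R'(7 := R (B + 2 * p))) 3 (Inv (k - 1))"
      using R'[of 0] by (intro tc_IfR[where t' = 1] tc_Block) (auto simp: I' fun_upd_twist)
    then show "0 < k \<and> tc (Block [IAdd 15 15 15, IAdd 13 15 6, RLoad 7 13] ;;
        IfR 0 7 (Block []) (Block [IAdd 15 15 2])) s 6 (Inv (k - 1))"
      using k by (auto intro!: tc_Block_Seq[where t' = 3] simp only: e) auto
  next
    fix k s assume a: "Inv k s" "fst s 16 \<le> fst s 15"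
    then show "case s of (I', R') \<Rightarrow> agree_off {13, 15} I I' \<and> agree_off {7} R R' \<and>
       (\<exists>p. I' 15 = int p \<and> M \<le> p \<and> p < 2 * M \<and> R 0 \<le> R (B + p))"
      using I by (auto simp: Inv_def agree_off_def)
  qed auto
qed

definition CLEAR :: com where
  "CLEAR = Block [IConst 11 0, IAdd 14 16 16, RConst 7 0] ;; While 14 11 (
     Block [IAdd 13 6 11, RStore 13 7, IAdd 11 11 2])"

lemma tc_CLEAR:
  assumes I: "I 6 = int B" "I 2 = 1" "I 16 = int M" and B: "8 \<le> B"
  shows "tc CLEAR (I, R) (10 * M + 4) (\<lambda>(I', R'). agree_off {11, 13, 14} I I' \<and>
    agree_off ({7} \<union> {B..<B + 2 * M}) R R' \<and> (\<forall>t < 2 * M. R' (B + t) = 0))"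
proof -
  define Inv where "Inv k s = (case s of (I', R') \<Rightarrow> agree_off {11, 13, 14} I I' \<and>
    agree_off ({7} \<union> {B..<B + 2 * M}) R R' \<and> I' 14 = int (2 * M) \<and> R' 7 = 0 \<and>
    (\<exists>i. I' 11 = int i \<and> i + k = 2 * M \<and> (\<forall>t < i. R' (B + t) = 0)))"
    for k :: nat and s
  show ?thesis unfolding CLEAR_def
  proof (rule tc_Block_Seq, rule tc_While[where Inv = Inv and N = "2 * M" and tb = 3])
    show "Inv (2 * M) (effs [IConst 11 0, IAdd 14 16 16, RConst 7 0] (I, R))"
      using I by (auto simp: Inv_def agree_off_def)
  next
    fix k s assume a: "Inv k s" "fst s 11 < fst s 14"
    obtain I' R' where s: "s = (I', R')" by (cases s)
    obtain i where i: "I' 11 = int i" "i + k = 2 * M" "\<forall>t < i. R' (B + t) = 0"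
      and ag: "agree_off {11, 13, 14} I I'" "agree_off ({7} \<union> {B..<B + 2 * M}) R R'"
      and r: "I' 14 = int (2 * M)" "R' 7 = 0"
      using a by (auto simp: Inv_def s)
    have I': "I' 6 = int B" "I' 2 = 1" using agree_offD[OF ag(1)] I by auto
    have k: "0 < k" using a i r by (simp add: s)
    have e: "effs [IAdd 13 6 11, RStore 13 7, IAdd 11 11 2] s
      = (I'(13 := int (B + i), 11 := int (i + 1)), R'(B + i := 0))"
      using B by (simp add: s I' i r int_fold del: int_unfold)
    have "Inv (k - 1) (effs [IAdd 13 6 11, RStore 13 7, IAdd 11 11 2] s)"
      unfolding e Inv_def using ag i r k B
      by (auto simp: agree_off_def less_Suc_eq intro!: exI[of _ "i + 1"])
    then show "0 < k \<and> tc (Block [IAdd 13 6 11, RStore 13 7, IAdd 11 11 2]) s 3 (Inv (k - 1))"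
      using k by (auto intro!: tc_Block)
  next
    fix k s assume a: "Inv k s" "fst s 14 \<le> fst s 11"
    then show "case s of (I', R') \<Rightarrow> agree_off {11, 13, 14} I I' \<and>
      agree_off ({7} \<union> {B..<B + 2 * M}) R R' \<and> (\<forall>t < 2 * M. R' (B + t) = 0)"
      by (auto simp: Inv_def)
  qed auto
qed

section \<open>Sorting\<close>

text \<open>Keys are clamped to be nonnegative (batteries may be negative, lengths are positive), so that
  the value \<open>-1\<close> can mark the leaves that have already been selected.\<close>

definition LEAF :: com where
  "LEAF = Block [IAdd 13 20 11, RLoad 0 13, RConst 7 0] ;;
     IfR 0 7 (Block [RConst 0 0]) (Block []) ;;
     Block [IAdd 15 16 11, IAdd 13 6 15, RStore 13 0] ;; UPDATE ;; Block [IAdd 11 11 2]"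

definition SELECT :: com where
  "SELECT = Block [IAdd 13 6 2, RLoad 0 13] ;; WALK ;;
     Block [ISub 14 15 16, IAdd 13 21 11, IStore 13 14, RConst 7 (-1), IAdd 13 6 15, RStore 13 7] ;;
     UPDATE ;; Block [IAdd 11 11 2]"

definition SORT :: com where
  "SORT = CLEAR ;; Block [IConst 11 0] ;; While 16 11 LEAF ;; Block [IConst 11 0] ;; While 16 11 SELECT"

lemma tc_LEAF:
  assumes I: "I 6 = int B" "I 2 = 1" "I 16 = int N" "I 20 = int XB" "I 23 = 0" "I 11 = int i"
    and B: "8 \<le> XB" "XB + N \<le> B" and N: "i < N" "N \<le> 2 ^ b"
    and x: "R (XB + i) = x" and tree: "tree_ok R B N 0"
  shows "tc LEAF (I, R) (12 * b + 12) (\<lambda>(I', R'). agree_off {11, 13, 15} I I' \<and> I' 11 = int (i + 1) \<and>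
    agree_off ({0, 2, 7} \<union> {B + 1..<B + N} \<union> {B + N + i}) R R' \<and> R' (B + N + i) = max 0 x \<and>
    tree_ok R' B N 0)"
    (is "tc _ _ _ ?Q")
  unfolding LEAF_def
proof (rule tc_Block_Seq[where t' = "12 * b + 9"])
  have B8: "8 \<le> B" using B by simp
  have e1: "effs [IAdd 13 20 11, RLoad 0 13, RConst 7 0] (I, R) = (I(13 := int (XB + i)), R(0 := x, 7 := 0))"
    using I x by (simp add: int_fold del: int_unfold)
  let ?s1 = "(I(13 := int (XB + i)), R(0 := max 0 x, 7 := 0)) :: state"
  define I2 where "I2 = I(15 := int (N + i), 13 := int (B + N + i))"
  define R2 where "R2 = R(0 := max 0 x, 7 := 0, B + N + i := max 0 x)"
  have e2: "effs [IAdd 15 16 11, IAdd 13 6 15, RStore 13 0] ?s1 = (I2, R2)"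
    using I by (simp add: int_fold I2_def R2_def fun_upd_twist add.assoc del: int_unfold)
  have "tc UPDATE (I2, R2) (12 * b + 2) (\<lambda>(I', R'). agree_off {13, 15} I2 I' \<and>
    agree_off ({2, 7} \<union> {B + 1..<B + N}) R2 R' \<and> tree_ok R' B N 0)"
  proof (rule tc_UPDATE)
    show "tree_ok R2 B N ((N + i) div 2)"
      by (rule tree_ok_store[OF tree]) (use B in \<open>auto simp: R2_def\<close>)
  qed (use I N B8 in \<open>auto simp: I2_def\<close>)
  then have "tc (UPDATE ;; Block [IAdd 11 11 2]) (I2, R2) (12 * b + 3) ?Q"
    by (rule tc_Seq[where ?t2.0 = 1])
      (use I B8 in \<open>auto intro!: tc_Block simp: agree_off_def I2_def R2_def\<close>)
  then have 2: "tc (Block [IAdd 15 16 11, IAdd 13 6 15, RStore 13 0] ;; UPDATE ;; Block [IAdd 11 11 2])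
      ?s1 (12 * b + 6) ?Q"
    unfolding e2[symmetric] by (rule tc_Block_Seq) simp
  have 1: "tc (IfR 0 7 (Block [RConst 0 0]) (Block [])) (I(13 := int (XB + i)), R(0 := x, 7 := 0)) 3
      (\<lambda>s. s = ?s1)"
    by (intro tc_IfR[where t' = 1] tc_Block) (auto simp: max_def fun_eq_iff)
  show "tc (IfR 0 7 (Block [RConst 0 0]) (Block []) ;;
     Block [IAdd 15 16 11, IAdd 13 6 15, RStore 13 0] ;; UPDATE ;; Block [IAdd 11 11 2])
     (effs [IAdd 13 20 11, RLoad 0 13, RConst 7 0] (I, R)) (12 * b + 9) ?Q"
    unfolding e1 by (rule tc_Seq[OF 1]) (use 2 in auto)
qed simp

lemma tc_SELECT:
  assumes I: "I 6 = int B" "I 2 = 1" "I 16 = int N" "I 21 = int YB" "I 23 = 0" "I 11 = int i"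
    and B: "8 \<le> B" "24 \<le> YB" and N: "i < N" "N \<le> 2 ^ b" and tree: "tree_ok R B N 0"
  shows "tc SELECT (I, R) (20 * b + 13) (\<lambda>(I', R'). \<exists>j < N.
    (\<forall>j' < N. R (B + N + j') \<le> R (B + N + j)) \<and>
    agree_off {11, 13, 14, 15, YB + i} I I' \<and> I' 11 = int (i + 1) \<and> I' (YB + i) = int j \<and>
    agree_off ({0, 2, 7} \<union> {B + 1..<B + N} \<union> {B + N + j}) R R' \<and> R' (B + N + j) = -1 \<and>
    tree_ok R' B N 0)"
  (is "tc _ _ _ ?Q")
  unfolding SELECT_def
proof (rule tc_Block_Seq[where t' = "20 * b + 11"])
  define I1 where "I1 = I(13 := int (B + 1))"
  define R1 where "R1 = R(0 := R (B + 1))"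
  have e1: "effs [IAdd 13 6 2, RLoad 0 13] (I, R) = (I1, R1)"
    using I by (simp add: int_fold I1_def R1_def del: int_unfold)
  have tree1: "tree_ok R1 B N 0" using tree B by (auto simp: R1_def tree_ok_def)
  have root: "R (B + t) \<le> R1 0" if "1 \<le> t" "t < 2 * N" for t
    using tree_ok_root[OF tree] that B by (simp add: R1_def)
  have walk: "tc WALK (I1, R1) (8 * b + 2) (\<lambda>(I', R'). agree_off {13, 15} I1 I' \<and>
    agree_off {7} R1 R' \<and> (\<exists>p. I' 15 = int p \<and> N \<le> p \<and> p < 2 * N \<and> R1 0 \<le> R1 (B + p)))"
    by (rule tc_WALK) (use I B N tree1 in \<open>auto simp: I1_def R1_def\<close>)
  show "tc (WALK ;;
     Block [ISub 14 15 16, IAdd 13 21 11, IStore 13 14, RConst 7 (-1), IAdd 13 6 15, RStore 13 7] ;;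
     UPDATE ;; Block [IAdd 11 11 2]) (effs [IAdd 13 6 2, RLoad 0 13] (I, R)) (20 * b + 11) ?Q"
    unfolding e1
  proof (rule tc_Seq[OF walk, where ?t2.0 = "12 * b + 9"])
    fix s assume "case s of (I', R') \<Rightarrow> agree_off {13, 15} I1 I' \<and>
      agree_off {7} R1 R' \<and> (\<exists>p. I' 15 = int p \<and> N \<le> p \<and> p < 2 * N \<and> R1 0 \<le> R1 (B + p))"
    then obtain I2 R2 p where s: "s = (I2, R2)" and ag2: "agree_off {13, 15} I1 I2" "agree_off {7} R1 R2"
      and p: "I2 15 = int p" "N \<le> p" "p < 2 * N" "R1 0 \<le> R1 (B + p)" by (cases s) auto
    define j where "j = p - N"
    have pj: "p = N + j" "j < N" using p by (auto simp: j_def)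
    have I2: "I2 6 = int B" "I2 2 = 1" "I2 16 = int N" "I2 21 = int YB" "I2 23 = 0" "I2 11 = int i"
      using I ag2 by (auto simp: agree_off_def I1_def)
    have R2: "R2 a = R a" if "B \<le> a" for a
      using that ag2 B by (auto simp: agree_off_def R1_def)
    have mx: "\<forall>j' < N. R (B + N + j') \<le> R (B + N + j)"
    proof (intro allI impI)
      fix j' assume "j' < N"
      then have "R (B + (N + j')) \<le> R1 0" using N by (intro root) auto
      then show "R (B + N + j') \<le> R (B + N + j)" using p B by (simp add: pj R1_def add.assoc)
    qed
    define I3 where "I3 = I2(14 := int j, YB + i := int j, 13 := int (B + N + j))"
    define R3 where "R3 = R2(7 := -1, B + N + j := -1)"
    have "effs [ISub 14 15 16, IAdd 13 21 11, IStore 13 14, RConst 7 (-1), IAdd 13 6 15, RStore 13 7] s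
      = (I2(14 := int j, 13 := int (YB + i), YB + i := int j, 13 := int (B + (N + j))), R3)"
      using I2 B by (simp add: s p(1) pj(1) R3_def int_fold add.assoc del: int_unfold) (simp add: algebra_simps)
    also have "I2(14 := int j, 13 := int (YB + i), YB + i := int j, 13 := int (B + (N + j))) = I3"
      using B by (auto simp: I3_def)
    finally have e3: "effs [ISub 14 15 16, IAdd 13 21 11, IStore 13 14, RConst 7 (-1), IAdd 13 6 15, RStore 13 7] s
      = (I3, R3)" .
    have "tc UPDATE (I3, R3) (12 * b + 2) (\<lambda>(I', R'). agree_off {13, 15} I3 I' \<and>
      agree_off ({2, 7} \<union> {B + 1..<B + N}) R3 R' \<and> tree_ok R' B N 0)"
    proof (rule tc_UPDATE)
      show "tree_ok R3 B N ((N + j) div 2)"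
        by (rule tree_ok_store[OF tree]) (use B R2 in \<open>auto simp: R3_def\<close>)
    qed (use I2 N B p pj in \<open>auto simp: I3_def\<close>)
    then have "tc (UPDATE ;; Block [IAdd 11 11 2]) (I3, R3) (12 * b + 3) ?Q"
    proof (rule tc_Seq[where ?t2.0 = 1])
      fix s assume "case s of (I', R') \<Rightarrow> agree_off {13, 15} I3 I' \<and>
        agree_off ({2, 7} \<union> {B + 1..<B + N}) R3 R' \<and> tree_ok R' B N 0"
      then obtain I4 R4 where s: "s = (I4, R4)" and ag4: "agree_off {13, 15} I3 I4"
        "agree_off ({2, 7} \<union> {B + 1..<B + N}) R3 R4" and t4: "tree_ok R4 B N 0" by (cases s) auto
      have agI: "agree_off {13, 14, 15, YB + i} I I4"
        using ag4(1) ag2(1) by (auto simp: agree_off_def I3_def I1_def)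
      have agR: "agree_off ({0, 2, 7} \<union> {B + 1..<B + N} \<union> {B + N + j}) R R4"
        using ag4(2) ag2(2) by (auto simp: agree_off_def R3_def R1_def)
      have v4: "I4 11 = int i" "I4 2 = 1" "I4 (YB + i) = int j" "R4 (B + N + j) = -1"
        using I2 B agree_offD[OF ag4(1)] agree_offD[OF ag4(2)] by (auto simp: I3_def R3_def)
      show "tc (Block [IAdd 11 11 2]) s 1 ?Q"
        by (rule tc_Block) (use agI agR v4 t4 mx pj B in \<open>auto simp: s agree_off_def intro!: exI[of _ j]\<close>)
    qed simp
    then show "tc (Block [ISub 14 15 16, IAdd 13 21 11, IStore 13 14, RConst 7 (-1), IAdd 13 6 15, RStore 13 7] ;;
      UPDATE ;; Block [IAdd 11 11 2]) s (12 * b + 9) ?Q"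
      by (intro tc_Block_Seq[where t' = "12 * b + 3"]) (auto simp: e3 simp del: effs.simps)
  qed simp
qed simp

text \<open>Repeated selection of a maximum. The invariant \<open>S\<close> records that each
  selected key dominates all keys not selected before it; once all indices are selected, this is
  sortedness.\<close>

lemma tc_SORT:
  assumes I: "I 6 = int B" "I 2 = 1" "I 16 = int N" "I 20 = int XB" "I 21 = int YB" "I 23 = 0"
    and B: "8 \<le> XB" "XB + N \<le> B" "24 \<le> YB" and N: "N \<le> 2 ^ b"
    and x: "\<And>j. j < N \<Longrightarrow> R (XB + j) = x j"
  shows "tc SORT (I, R) (N * (32 * b + 39) + 8) (\<lambda>(I', R').
    agree_off ({11, 13, 14, 15} \<union> {YB..<YB + N}) I I' \<and> agree_off ({0, 2, 7} \<union> {B..}) R R' \<and>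
    (\<exists>y. (\<forall>i < N. I' (YB + i) = int (y i)) \<and> bij_betw y {..<N} {..<N} \<and>
      (\<forall>k < N. \<forall>i \<le> k. max 0 (x (y k)) \<le> max 0 (x (y i)))))"
    (is "tc _ _ _ ?Q")
proof -
  have B8: "8 \<le> B" using B by simp
  define L where "L k s = (case s of (I', R') \<Rightarrow> agree_off {11, 13, 14, 15} I I' \<and>
    agree_off ({0, 2, 7} \<union> {B..}) R R' \<and> tree_ok R' B N 0 \<and> (\<exists>i. I' 11 = int i \<and> i + k = N \<and>
      (\<forall>j < N. R' (B + N + j) = (if j < i then max 0 (x j) else 0))))" for k :: nat and s
  define S where "S k s = (case s of (I', R') \<Rightarrow> agree_off ({11, 13, 14, 15} \<union> {YB..<YB + N}) I I' \<and>
    agree_off ({0, 2, 7} \<union> {B..}) R R' \<and> tree_ok R' B N 0 \<and> (\<exists>i y. I' 11 = int i \<and> i + k = N \<and>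
      (\<forall>i' < i. I' (YB + i') = int (y i') \<and> y i' < N) \<and> inj_on y {..<i} \<and>
      (\<forall>j < N. R' (B + N + j) = (if j \<in> y ` {..<i} then -1 else max 0 (x j))) \<and>
      (\<forall>i' < i. \<forall>j < N. j \<notin> y ` {..<i'} \<longrightarrow> max 0 (x j) \<le> max 0 (x (y i')))))" for k :: nat and s
  have sel: "tc (While 16 11 SELECT) s (N * (20 * b + 15) + 1) ?Q" if "S N s" for s
  proof (rule tc_While[where Inv = S and N = N and tb = "20 * b + 13", OF that])
    fix k s assume a: "S k s" "fst s 11 < fst s 16"
    obtain I' R' where s: "s = (I', R')" by (cases s)
    obtain i y where ag: "agree_off ({11, 13, 14, 15} \<union> {YB..<YB + N}) I I'"
      "agree_off ({0, 2, 7} \<union> {B..}) R R'" and tree: "tree_ok R' B N 0"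
      and i: "I' 11 = int i" "i + k = N" and y: "\<And>i'. i' < i \<Longrightarrow> I' (YB + i') = int (y i') \<and> y i' < N"
      and inj: "inj_on y {..<i}"
      and lf: "\<And>j. j < N \<Longrightarrow> R' (B + N + j) = (if j \<in> y ` {..<i} then -1 else max 0 (x j))"
      and so: "\<And>i' j. i' < i \<Longrightarrow> j < N \<Longrightarrow> j \<notin> y ` {..<i'} \<Longrightarrow> max 0 (x j) \<le> max 0 (x (y i'))"
      using a unfolding S_def s prod.case by blast
    have I': "I' 6 = int B" "I' 2 = 1" "I' 16 = int N" "I' 21 = int YB" "I' 23 = 0"
      using I B agree_offD[OF ag(1)] by auto
    have iN: "i < N" using a I' i by (simp add: s)
    have "tc SELECT (I', R') (20 * b + 13) (S (k - 1))"
    proof (rule tc_conseq[OF tc_SELECT[OF I'(1-4) I'(5) i(1) B8 B(3) iN N tree]])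
      fix s' assume "case s' of (I'', R'') \<Rightarrow> \<exists>j < N.
        (\<forall>j' < N. R' (B + N + j') \<le> R' (B + N + j)) \<and>
        agree_off {11, 13, 14, 15, YB + i} I' I'' \<and> I'' 11 = int (i + 1) \<and> I'' (YB + i) = int j \<and>
        agree_off ({0, 2, 7} \<union> {B + 1..<B + N} \<union> {B + N + j}) R' R'' \<and> R'' (B + N + j) = -1 \<and>
        tree_ok R'' B N 0"
      then obtain I'' R'' j where s': "s' = (I'', R'')" and j: "j < N"
        and mx: "\<And>j'. j' < N \<Longrightarrow> R' (B + N + j') \<le> R' (B + N + j)"
        and ag': "agree_off {11, 13, 14, 15, YB + i} I' I''"
          "agree_off ({0, 2, 7} \<union> {B + 1..<B + N} \<union> {B + N + j}) R' R''"
        and v: "I'' 11 = int (i + 1)" "I'' (YB + i) = int j" "R'' (B + N + j) = -1" "tree_ok R'' B N 0"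
        by (cases s') blast
      \<comment> \<open>Fewer than \<open>N\<close> indices have been selected, so some leaf still
        holds a nonnegative key. The maximal leaf is therefore nonnegative too and cannot carry the
        mark -1, so \<open>j\<close> is new.\<close>
      have "card (y ` {..<i}) < card {..<N}" using iN by (simp add: card_image[OF inj])
      then have "\<not> {..<N} \<subseteq> y ` {..<i}" by (metis card_mono finite_imageI finite_lessThan not_le)
      then obtain j0 where "j0 < N" "j0 \<notin> y ` {..<i}" by auto
      then have "0 \<le> R' (B + N + j)" using mx[of j0] lf[of j0] by simp
      then have jn: "j \<notin> y ` {..<i}" using lf[OF j] by (auto split: if_splits)
      let ?y = "y(i := j)"
      have im: "?y ` {..<i'} = y ` {..<i'}" if "i' \<le> i" for i'
        using that by (intro image_cong) auto
      have im': "?y ` {..<i + 1} = insert j (y ` {..<i})"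
        by (auto simp: less_Suc_eq image_iff)
      show "S (k - 1) s'"
        unfolding S_def s' prod.case
      proof (intro conjI exI[of _ "i + 1"] exI[of _ ?y] allI impI)
        show "agree_off ({11, 13, 14, 15} \<union> {YB..<YB + N}) I I''"
          using ag(1) ag'(1) iN by (auto simp: agree_off_def)
        show "agree_off ({0, 2, 7} \<union> {B..}) R R''"
          using ag(2) ag'(2) by (auto simp: agree_off_def)
        show "inj_on ?y {..<i + 1}"
          using inj jn im[of i] by (auto simp: lessThan_Suc inj_on_def)
        show "i + 1 + (k - 1) = N" using iN i by simp
        show "?y i' < N" if "i' < i + 1" for i'
          using that y[of i'] j by (cases "i' = i") auto
        show "I'' (YB + i') = int (?y i')" if "i' < i + 1" for i'
          using that y[of i'] v(2) agree_offD[OF ag'(1), of "YB + i'"] B by (cases "i' = i") auto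
        show "R'' (B + N + j') = (if j' \<in> ?y ` {..<i + 1} then -1 else max 0 (x j'))" if "j' < N" for j'
          unfolding im' using lf[OF that] v(3) agree_offD[OF ag'(2), of "B + N + j'"] B8 by (cases "j' = j") auto
        show "max 0 (x j') \<le> max 0 (x (?y i'))" if "i' < i + 1" "j' < N" "j' \<notin> ?y ` {..<i'}" for i' j'
        proof (cases "i' = i")
          case True
          then show ?thesis using that im[of i] mx[of j'] lf[of j'] lf[OF j] jn by auto
        next
          case False
          then show ?thesis using that im[of i'] so[of i' j'] by auto
        qed
      qed (use v in auto)
    qed simp
    then show "0 < k \<and> tc SELECT s (20 * b + 13) (S (k - 1))" using iN i by (simp add: s)
  next
    fix k s assume a: "S k s" "fst s 16 \<le> fst s 11"
    obtain I' R' where s: "s = (I', R')" by (cases s)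
    obtain i y where ag: "agree_off ({11, 13, 14, 15} \<union> {YB..<YB + N}) I I'"
      "agree_off ({0, 2, 7} \<union> {B..}) R R'"
      and i: "I' 11 = int i" "i + k = N" and y: "\<And>i'. i' < i \<Longrightarrow> I' (YB + i') = int (y i') \<and> y i' < N"
      and inj: "inj_on y {..<i}"
      and so: "\<And>i' j. i' < i \<Longrightarrow> j < N \<Longrightarrow> j \<notin> y ` {..<i'} \<Longrightarrow> max 0 (x j) \<le> max 0 (x (y i'))"
      using a unfolding S_def s prod.case by blast
    have "I' 16 = int N" using I B agree_offD[OF ag(1)] by auto
    then have iN: "i = N" using a i by (simp add: s)
    have "y ` {..<N} \<subseteq> {..<N}" using y iN by auto
    then have "bij_betw y {..<N} {..<N}"
      using inj iN by (metis bij_betw_def card_image card_subset_eq finite_lessThan)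
    moreover have "max 0 (x (y k)) \<le> max 0 (x (y i'))" if "k < N" "i' \<le> k" for k i'
    proof (rule so)
      show "y k \<notin> y ` {..<i'}"
      proof
        assume "y k \<in> y ` {..<i'}"
        then obtain z where "z < i'" "y k = y z" by auto
        then show False using inj_onD[OF inj, of k z] that iN by auto
      qed
    qed (use that y iN in auto)
    ultimately show "?Q s" using ag y iN by (auto simp: s)
  qed simp
  have leaf: "tc (While 16 11 LEAF ;; Block [IConst 11 0] ;; While 16 11 SELECT) s
      (N * (12 * b + 14) + N * (20 * b + 15) + 3) ?Q" if "L N s" for s
  proof (rule tc_Seq[OF tc_While[where Inv = L and N = N and tb = "12 * b + 12" and Q = "L 0"], OF that])
    fix k s assume a: "L k s" "fst s 11 < fst s 16"
    obtain I' R' where s: "s = (I', R')" by (cases s)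
    obtain i where ag: "agree_off {11, 13, 14, 15} I I'"
      "agree_off ({0, 2, 7} \<union> {B..}) R R'" and tree: "tree_ok R' B N 0"
      and i: "I' 11 = int i" "i + k = N"
      and lf: "\<And>j. j < N \<Longrightarrow> R' (B + N + j) = (if j < i then max 0 (x j) else 0)"
      using a unfolding L_def s prod.case by blast
    have I': "I' 6 = int B" "I' 2 = 1" "I' 16 = int N" "I' 20 = int XB" "I' 23 = 0"
      using I B agree_offD[OF ag(1)] by auto
    have iN: "i < N" using a I' i by (simp add: s)
    have xi: "R' (XB + i) = x i" using x[OF iN] agree_offD[OF ag(2)] B iN by auto
    have "tc LEAF (I', R') (12 * b + 12) (L (k - 1))"
    proof (rule tc_conseq[OF tc_LEAF[OF I'(1-5) i(1) B(1,2) iN N xi tree]])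
      fix s' assume "case s' of (I'', R'') \<Rightarrow> agree_off {11, 13, 15} I' I'' \<and> I'' 11 = int (i + 1) \<and>
        agree_off ({0, 2, 7} \<union> {B + 1..<B + N} \<union> {B + N + i}) R' R'' \<and> R'' (B + N + i) = max 0 (x i) \<and>
        tree_ok R'' B N 0"
      then obtain I'' R'' where s': "s' = (I'', R'')"
        and ag': "agree_off {11, 13, 15} I' I''"
          "agree_off ({0, 2, 7} \<union> {B + 1..<B + N} \<union> {B + N + i}) R' R''"
        and v: "I'' 11 = int (i + 1)" "R'' (B + N + i) = max 0 (x i)" "tree_ok R'' B N 0"
        by (cases s') blast
      have lf': "R'' (B + N + j) = (if j < i + 1 then max 0 (x j) else 0)" if "j < N" for j
        using lf[OF that] v(2) agree_offD[OF ag'(2), of "B + N + j"] B8 by (cases "j = i") auto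
      show "L (k - 1) s'"
        unfolding L_def s' prod.case
      proof (intro conjI exI[of _ "i + 1"] allI impI)
        show "agree_off {11, 13, 14, 15} I I''"
          using ag(1) ag'(1) by (auto simp: agree_off_def)
        show "agree_off ({0, 2, 7} \<union> {B..}) R R''"
          using ag(2) ag'(2) by (auto simp: agree_off_def)
        show "i + 1 + (k - 1) = N" using iN i by simp
      qed (use v lf' in auto)
    qed simp
    then show "0 < k \<and> tc LEAF s (12 * b + 12) (L (k - 1))" using iN i by (simp add: s)
  next
    fix k s assume a: "L k s" "fst s 16 \<le> fst s 11"
    have "fst s 16 = int N" using a(1) I by (auto simp: L_def agree_off_def)
    then show "L 0 s" using a by (auto simp: L_def)
  next
    fix s assume a: "L 0 s"
    obtain I' R' where s: "s = (I', R')" by (cases s)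
    have "S N (effs [IConst 11 0] s)"
      using a by (auto simp: s L_def S_def agree_off_def)
    then show "tc (Block [IConst 11 0] ;; While 16 11 SELECT) s (N * (20 * b + 15) + 2) ?Q"
      by (intro tc_Block_Seq[OF sel]) auto
  qed auto
  show ?thesis unfolding SORT_def
  proof (rule tc_Seq[OF tc_CLEAR[OF I(1-3) B8]])
    fix s assume "case s of (I', R') \<Rightarrow> agree_off {11, 13, 14} I I' \<and>
      agree_off ({7} \<union> {B..<B + 2 * N}) R R' \<and> (\<forall>t < 2 * N. R' (B + t) = 0)"
    then have "L N (effs [IConst 11 0] s)"
      by (cases s) (auto simp: L_def agree_off_def add.assoc intro: tree_ok_zero)
    then show "tc (Block [IConst 11 0] ;; While 16 11 LEAF ;; Block [IConst 11 0] ;; While 16 11 SELECT)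
      s (N * (12 * b + 14) + N * (20 * b + 15) + 4) ?Q"
      by (intro tc_Block_Seq[OF leaf]) auto
  qed (simp add: algebra_simps)
qed

section \<open>Instances, sorted instances and their memory layout\<close>

locale dwp =
  fixes m n :: nat and v d l :: "nat \<Rightarrow> real"
  assumes m1: "1 \<le> m" and n1: "1 \<le> n"
    and v_pos: "\<And>j. j < m \<Longrightarrow> 0 < v j" and l_pos: "\<And>i. i < n \<Longrightarrow> 0 < l i"
    and universal_drone: "\<exists>j<m. \<forall>i<n. l i \<le> d j"
begin

text \<open>Replaces the sets of a schedule by the unique drone of each parcel. The load bound is
  stated for every set \<open>X\<close> of parcels, because leaving out parcels only lowers a load,
  and the arguments below look at prefixes of the sorted order.\<close>

lemma valid_scheduleE:
  assumes g: "valid_schedule m n l d g"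
  obtains f where "\<And>x. x < n \<Longrightarrow> f x < m" "\<And>x. x < n \<Longrightarrow> l x \<le> d (f x)"
    "\<And>j X. j < m \<Longrightarrow> X \<subseteq> {..<n} \<Longrightarrow> (\<Sum>x | x \<in> X \<and> f x = j. l x) \<le> delivery_time m l v g * v j"
proof -
  have "\<exists>f. \<forall>x<n. f x < m \<and> x \<in> g (f x)"
    using g unfolding valid_schedule_def by (meson ex1_implies_ex)
  then obtain f where f: "\<And>x. x < n \<Longrightarrow> f x < m \<and> x \<in> g (f x)" by blast
  have sub: "g j \<subseteq> {..<n}" if "j < m" for j using g that by (auto simp: valid_schedule_def)
  show ?thesis
  proof (rule that[of f])
    fix x assume "x < n"
    then show "f x < m" "l x \<le> d (f x)" using f g by (auto simp: valid_schedule_def)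
  next
    fix j X assume j: "j < m" and X: "X \<subseteq> {..<n}"
    have fin: "finite (g j)" using sub[OF j] finite_subset by blast
    have "0 \<le> l x" if "x \<in> g j" for x using that sub[OF j] l_pos[of x] by auto
    then have "(\<Sum>x | x \<in> X \<and> f x = j. l x) \<le> (\<Sum>x\<in>g j. l x)"
      using X f sub[OF j] fin by (intro sum_mono2) auto
    also have "\<dots> = (\<Sum>x\<in>g j. l x / v j) * v j"
      using v_pos[OF j] by (simp add: sum_divide_distrib[symmetric])
    also have "\<dots> \<le> delivery_time m l v g * v j"
      unfolding delivery_time_def
      using v_pos[OF j] j by (intro mult_right_mono Max_ge) auto
    finally show "(\<Sum>x | x \<in> X \<and> f x = j. l x) \<le> delivery_time m l v g * v j" .
  qed
qed

lemma schedule_of_assignment: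
  assumes f: "\<And>x. x < n \<Longrightarrow> f x < m" "\<And>x. x < n \<Longrightarrow> l x \<le> d (f x)"
    and load: "\<And>j. j < m \<Longrightarrow> (\<Sum>x | x < n \<and> f x = j. l x) \<le> T * v j"
  shows "valid_schedule m n l d (\<lambda>j. {x. x < n \<and> f x = j})"
    "delivery_time m l v (\<lambda>j. {x. x < n \<and> f x = j}) \<le> T"
proof -
  show "valid_schedule m n l d (\<lambda>j. {x. x < n \<and> f x = j})"
    using f unfolding valid_schedule_def by auto
  have "(\<Sum>x | x < n \<and> f x = j. l x / v j) \<le> T" if "j < m" for j
    using load[OF that] v_pos[OF that] by (simp add: sum_divide_distrib[symmetric] divide_le_eq)
  moreover have "{..<m} \<noteq> {}" using m1 by (simp add: lessThan_empty_iff)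
  ultimately show "delivery_time m l v (\<lambda>j. {x. x < n \<and> f x = j}) \<le> T"
    unfolding delivery_time_def by (intro Max.boundedI) auto
qed

end

text \<open>Batteries are ordered only after clamping at 0, which makes no difference to parcels of
  positive length.\<close>

locale sorted_dwp = dwp +
  fixes \<sigma> \<tau> :: "nat \<Rightarrow> nat"
  assumes \<sigma>: "bij_betw \<sigma> {..<m} {..<m}" and \<tau>: "bij_betw \<tau> {..<n} {..<n}"
    and \<sigma>_sorted: "\<And>a b. b < m \<Longrightarrow> a \<le> b \<Longrightarrow> max 0 (d (\<sigma> b)) \<le> max 0 (d (\<sigma> a))"
    and \<tau>_sorted: "\<And>i k. k < n \<Longrightarrow> i \<le> k \<Longrightarrow> l (\<tau> k) \<le> l (\<tau> i)"
begin

lemma \<sigma>_less: "a < m \<Longrightarrow> \<sigma> a < m" using \<sigma> by (auto simp: bij_betw_def)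
lemma \<tau>_less: "i < n \<Longrightarrow> \<tau> i < n" using \<tau> by (auto simp: bij_betw_def)

lemma \<sigma>_new: "a < m \<Longrightarrow> \<sigma> a \<notin> \<sigma> ` {..<a}"
proof
  assume "a < m" "\<sigma> a \<in> \<sigma> ` {..<a}"
  then obtain b where "b < a" "\<sigma> a = \<sigma> b" by auto
  then show False using inj_onD[OF bij_betw_imp_inj_on[OF \<sigma>], of a b] \<open>a < m\<close> by auto
qed

lemma \<tau>_new: "i < n \<Longrightarrow> \<tau> i \<notin> \<tau> ` {..<i}"
proof
  assume "i < n" "\<tau> i \<in> \<tau> ` {..<i}"
  then obtain b where "b < i" "\<tau> i = \<tau> b" by auto
  then show False using inj_onD[OF bij_betw_imp_inj_on[OF \<tau>], of i b] \<open>i < n\<close> by auto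
qed

text \<open>If drone \<open>\<sigma> a\<close> is too weak for the parcel, so are all later ones:
  their clamped batteries are no larger and the length is positive. A single pointer
  \<open>a\<close> thus captures all eligible drones.\<close>

lemma eligible_active:
  assumes "a = m \<or> d (\<sigma> a) < l (\<tau> i)" "i < n" "a \<le> m" "j < m" "l (\<tau> i) \<le> d j"
  shows "j \<in> \<sigma> ` {..<a}"
proof -
  have "j \<in> \<sigma> ` {..<m}" using \<sigma> assms(4) by (auto simp: bij_betw_def)
  then obtain b where b: "b < m" "j = \<sigma> b" by auto
  have "b < a"
  proof (rule ccontr)
    assume "\<not> b < a"
    then have ba: "a \<le> b" by simp
    have "0 < l (\<tau> i)" using l_pos[OF \<tau>_less[OF assms(2)]] .
    then show False using \<sigma>_sorted[OF b(1) ba] assms b ba by auto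
  qed
  then show ?thesis using b by auto
qed

definition load :: "(nat \<Rightarrow> nat) \<Rightarrow> nat \<Rightarrow> nat \<Rightarrow> real" where
  "load f i j = (\<Sum>x | x \<in> \<tau> ` {..<i} \<and> f x = j. l x)"

lemma load_0 [simp]: "load f 0 j = 0" by (simp add: load_def)

lemma load_n: "load f n j = (\<Sum>x | x < n \<and> f x = j. l x)"
  using \<tau> by (simp add: load_def bij_betw_def)

lemma load_Suc:
  assumes "i < n"
  shows "load (f(\<tau> i := j)) (Suc i) j' = load f i j' + (if j' = j then l (\<tau> i) else 0)"
proof -
  have *: "(f(\<tau> i := j)) x = f x" if "x \<in> \<tau> ` {..<i}" for x
    using that \<tau>_new[OF assms] by (metis fun_upd_other)
  have "{x. x \<in> \<tau> ` {..<Suc i} \<and> (f(\<tau> i := j)) x = j'} =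
    {x. x \<in> \<tau> ` {..<i} \<and> f x = j'} \<union> (if j' = j then {\<tau> i} else {})"
    using * by (auto simp: lessThan_Suc simp del: fun_upd_apply) auto
  then show ?thesis using \<tau>_new[OF assms] by (auto simp: load_def)
qed

lemma load_le: "i \<le> n \<Longrightarrow> load f i j \<le> (\<Sum>i'<i. l (\<tau> i'))"
proof -
  assume i: "i \<le> n"
  have inj: "inj_on \<tau> {..<i}" using \<tau> i by (auto simp: bij_betw_def intro: inj_on_subset)
  have "0 \<le> l (\<tau> k)" if "k < i" for k using l_pos[OF \<tau>_less[of k]] that i by simp
  then have "load f i j \<le> (\<Sum>x\<in>\<tau> ` {..<i}. l x)"
    unfolding load_def by (intro sum_mono2) auto
  then show ?thesis by (simp add: sum.reindex[OF inj])
qed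

text \<open>In every valid schedule the \<open>i + 1\<close> longest parcels are carried by drones that can
  deliver parcel \<open>\<tau> i\<close>.\<close>

lemma prefix_volume:
  assumes g: "valid_schedule m n l d g" and i: "i < n" and w: "\<And>j. j < m \<Longrightarrow> l (\<tau> i) \<le> d j \<Longrightarrow> v j \<le> w"
    and "0 \<le> w"
  shows "(\<Sum>i'<Suc i. l (\<tau> i')) \<le> m * (delivery_time m l v g * w)"
proof -
  obtain f where f: "\<And>x. x < n \<Longrightarrow> f x < m" "\<And>x. x < n \<Longrightarrow> l x \<le> d (f x)"
    "\<And>j X. j < m \<Longrightarrow> X \<subseteq> {..<n} \<Longrightarrow> (\<Sum>x | x \<in> X \<and> f x = j. l x) \<le> delivery_time m l v g * v j"
    using valid_scheduleE[OF g] by blast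
  let ?T = "delivery_time m l v g" and ?X = "\<tau> ` {..<Suc i}"
  have X: "?X \<subseteq> {..<n}" using i \<tau>_less by auto
  have T0: "0 \<le> ?T"
  proof -
    have "0 \<le> (\<Sum>x | x \<in> {} \<and> f x = 0. l x)" by simp
    also have "\<dots> \<le> ?T * v 0" using m1 by (intro f(3)) auto
    finally show ?thesis using v_pos[of 0] m1 by (simp add: zero_le_mult_iff)
  qed
  have inj: "inj_on \<tau> {..<Suc i}" using \<tau> i by (auto simp: bij_betw_def intro: inj_on_subset)
  have "(\<Sum>i'<Suc i. l (\<tau> i')) = (\<Sum>x\<in>?X. l x)" using sum.reindex[OF inj, of l] by simp
  also have "\<dots> = (\<Sum>j<m. \<Sum>x | x \<in> ?X \<and> f x = j. l x)"
    using X f(1) by (intro sum.group[symmetric]) auto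
  also have "\<dots> \<le> (\<Sum>j<m. ?T * w)"
  proof (rule sum_mono)
    fix j assume j: "j \<in> {..<m}"
    show "(\<Sum>x | x \<in> ?X \<and> f x = j. l x) \<le> ?T * w"
    proof (cases "{x. x \<in> ?X \<and> f x = j} = {}")
      case True
      then show ?thesis unfolding True using T0 assms(4) by simp
    next
      case False
      then obtain i' where i': "i' \<le> i" "f (\<tau> i') = j" by (auto simp: less_Suc_eq_le)
      then have "l (\<tau> i) \<le> l (\<tau> i')" "l (\<tau> i') \<le> d j"
        using \<tau>_sorted[OF i i'(1)] f(2)[OF \<tau>_less[of i']] i by auto
      then have "v j \<le> w" using w[of j] j by auto
      then have "?T * v j \<le> ?T * w" using T0 by (intro mult_left_mono)
      then show ?thesis using f(3)[of j ?X] j X by auto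
    qed
  qed
  finally show ?thesis by simp
qed

text \<open>Failure of any-fit without reference to a run: \<open>f\<close> is an arbitrary
  assignment of the first \<open>i\<close> parcels, so the notion does not depend on which drone the
  tree search happens to pick.\<close>

definition stuck :: "real \<Rightarrow> bool" where
  "stuck cap \<longleftrightarrow> (\<exists>i<n. \<exists>f. \<forall>j<m. l (\<tau> i) \<le> d j \<longrightarrow> cap * v j < load f i j + l (\<tau> i))"

text \<open>The parcels \<tau> 0 to \<tau> i are all at least as long as \<tau> i, so every valid
  schedule gives them to drones that are eligible for \<tau> i. On this set \<open>J\<close> of
  drones the weight argument applies, with \<tau> i as the failing parcel.\<close>

lemma stuck_lower_bound:
  assumes "stuck ((golden_ratio - \<epsilon>) * T)" and eps: "0 \<le> \<epsilon>" "8 * (\<epsilon> * m) \<le> 1" "\<epsilon> \<le> 1 / 8"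
    and g: "valid_schedule m n l d g"
  shows "T < delivery_time m l v g"
proof (rule ccontr)
  assume T: "\<not> T < delivery_time m l v g"
  obtain i f where i: "i < n" and
    full: "\<And>j. j < m \<Longrightarrow> l (\<tau> i) \<le> d j \<Longrightarrow> (golden_ratio - \<epsilon>) * T * v j < load f i j + l (\<tau> i)"
    using assms(1) unfolding stuck_def by blast
  obtain h where h: "\<And>x. x < n \<Longrightarrow> h x < m" "\<And>x. x < n \<Longrightarrow> l x \<le> d (h x)"
    "\<And>j X. j < m \<Longrightarrow> X \<subseteq> {..<n} \<Longrightarrow> (\<Sum>x | x \<in> X \<and> h x = j. l x) \<le> delivery_time m l v g * v j"
    using valid_scheduleE[OF g] by blast
  define J where "J = {j. j < m \<and> l (\<tau> i) \<le> d j}"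
  have less: "l (\<tau> i) \<le> l x" "x < n" if "x \<in> insert (\<tau> i) (\<tau> ` {..<i})" for x
    using that i \<tau>_sorted[OF i] \<tau>_less by auto
  show False
  proof (rule any_fit_failure[where J = J and m = m and X = "\<tau> ` {..<i}" and e = "\<tau> i" and l = l
        and Opt = h and T = T and v = v and \<epsilon> = \<epsilon> and A = f])
    show "card J \<le> m" using card_mono[of "{..<m}" J] by (auto simp: J_def)
    show "h x \<in> J" if "x \<in> insert (\<tau> i) (\<tau> ` {..<i})" for x
      using less[OF that] h(1,2)[of x] by (auto simp: J_def)
    show "(\<Sum>x | x \<in> insert (\<tau> i) (\<tau> ` {..<i}) \<and> h x = j. l x) \<le> T * v j" if "j \<in> J" for j
    proof -
      have "(\<Sum>x | x \<in> insert (\<tau> i) (\<tau> ` {..<i}) \<and> h x = j. l x) \<le> delivery_time m l v g * v j"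
        using that less(2) by (intro h(3)) (auto simp: J_def)
      also have "\<dots> \<le> T * v j" using T that v_pos[of j] by (intro mult_right_mono) (auto simp: J_def)
      finally show ?thesis .
    qed
    show "(golden_ratio - \<epsilon>) * T * v j < (\<Sum>x | x \<in> \<tau> ` {..<i} \<and> f x = j. l x) + l (\<tau> i)"
      if "j \<in> J" for j using full[of j] that by (auto simp: J_def load_def)
  qed (use less l_pos \<tau>_less i \<tau>_new eps in \<open>auto simp: J_def\<close>)
qed

text \<open>Some eligible drone has room for the whole prefix up to \<tau> i, however the prefix was
  distributed.\<close>

lemma not_stuck:
  assumes U: "\<And>i. i < n \<Longrightarrow> \<exists>j<m. l (\<tau> i) \<le> d j \<and> (\<Sum>i'<Suc i. l (\<tau> i')) \<le> U * v j" and "U \<le> cap"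
  shows "\<not> stuck cap"
proof
  assume "stuck cap"
  then obtain i f where i: "i < n" and
    full: "\<And>j. j < m \<Longrightarrow> l (\<tau> i) \<le> d j \<Longrightarrow> cap * v j < load f i j + l (\<tau> i)"
    unfolding stuck_def by blast
  obtain j where j: "j < m" "l (\<tau> i) \<le> d j" "(\<Sum>i'<Suc i. l (\<tau> i')) \<le> U * v j" using U[OF i] by blast
  have "U * v j \<le> cap * v j" using assms(2) v_pos[OF j(1)] by (intro mult_right_mono) auto
  then show False using full[OF j(1,2)] j(3) load_le[of i f j] i by simp
qed

end

locale dwp_memory = sorted_dwp +
  fixes VB DB LB TB SB UB RB OB :: nat
  assumes VB: "8 \<le> VB" "VB + m \<le> DB" "DB + m \<le> LB" "LB + n \<le> TB"
    and SB: "24 \<le> SB" "SB + m \<le> UB" "UB + n \<le> RB" "RB + n \<le> OB"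
begin

text \<open>
  Integer registers: 0 and 22 hold \<open>m\<close> and \<open>n\<close>, 2 and 23 the constants 1 and 0, and 3 to 10 the bases of
  the speeds, batteries, parcel lengths and tournament tree (real memory) and of \<open>\<sigma>\<close>, \<open>\<tau>\<close>, the
  tentative assignment and the best assignment (integer memory). Registers 11 to 21 are temporaries; of
  these, 20 counts the remaining bisection rounds. Real registers: 3 is the capacity factor \<open>\<rho> T\<close>,
  4 the step, 5 the upper end of the bisection interval, and 6 holds \<open>\<rho>\<close>.
\<close>

lemma TB8: "8 \<le> TB" using VB by simp

definition env :: "(nat \<Rightarrow> int) \<Rightarrow> (nat \<Rightarrow> real) \<Rightarrow> bool" where
  "env I R \<longleftrightarrow> I 0 = int m \<and> I 2 = 1 \<and> I 3 = int VB \<and> I 4 = int DB \<and> I 5 = int LB \<and> I 6 = int TB \<and>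
    I 7 = int SB \<and> I 8 = int UB \<and> I 9 = int RB \<and> I 10 = int OB \<and> I 22 = int n \<and> I 23 = 0 \<and>
    (\<forall>j<m. R (VB + j) = v j) \<and> (\<forall>j<m. R (DB + j) = d j) \<and> (\<forall>i<n. R (LB + i) = l i) \<and>
    (\<forall>a<m. I (SB + a) = int (\<sigma> a)) \<and> (\<forall>i<n. I (UB + i) = int (\<tau> i))"

text \<open>The common frame rule of bound, any-fit and bisection: these write only to temporaries,
  real registers, the tree and the two assignment areas.\<close>

lemma env_agree:
  assumes "env I R" "agree_off ({11..21} \<union> {RB..}) I I'" "agree_off ({..<8} \<union> {TB..}) R R'"
  shows "env I' R'"
proof -
  have I': "I' a = I a" if "a < 11 \<or> 22 \<le> a \<and> a < RB" for a
    using agree_offD[OF assms(2), of a] SB that by auto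
  have R': "R' a = R a" if "8 \<le> a" "a < TB" for a using agree_offD[OF assms(3)] that by auto
  show ?thesis using assms(1) VB SB by (auto simp: env_def I' R')
qed

end

text \<open>Control of a merge of two sorted lists: register 18 becomes 1 if the next drone in
  battery order can carry the current parcel and should be activated first, and 0 if the parcel is
  to be processed now. Each round advances one of the two pointers, so a sweep has at most n + m
  rounds.\<close>

definition DECIDE :: com where
  "DECIDE = Block [IAdd 13 8 11, ILoad 14 13, IAdd 13 5 14, RLoad 0 13, IConst 18 0] ;;
     IfI 0 12 (Block []) (
       Block [IAdd 13 7 12, ILoad 15 13, IAdd 13 4 15, RLoad 7 13] ;;
       IfR 0 7 (Block [IConst 18 1]) (Block []))"

context dwp_memory
begin

lemma tc_DECIDE:
  assumes env: "env I R" and i: "I 11 = int i" "i < n" and a: "I 12 = int a" "a \<le> m"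
  shows "tc DECIDE (I, R) 14 (\<lambda>(I', R'). agree_off {13, 14, 15, 18} I I' \<and> agree_off {0, 7} R R' \<and>
    R' 0 = l (\<tau> i) \<and> I' 14 = int (\<tau> i) \<and>
    (I' 18 = 1 \<and> a < m \<and> l (\<tau> i) \<le> d (\<sigma> a) \<and> I' 15 = int (\<sigma> a) \<or>
     I' 18 = 0 \<and> (a = m \<or> d (\<sigma> a) < l (\<tau> i))))"
    (is "tc _ _ _ ?Q")
  unfolding DECIDE_def
proof (rule tc_Block_Seq[where t' = 9])
  note env = env[unfolded env_def]
  define I1 where "I1 = I(13 := int (LB + \<tau> i), 14 := int (\<tau> i), 18 := 0)"
  define R1 where "R1 = R(0 := l (\<tau> i))"
  have e1: "effs [IAdd 13 8 11, ILoad 14 13, IAdd 13 5 14, RLoad 0 13, IConst 18 0] (I, R) = (I1, R1)"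
    using env i SB \<tau>_less by (simp add: I1_def R1_def int_fold fun_upd_twist del: int_unfold)
  show "tc (IfI 0 12 (Block []) (Block [IAdd 13 7 12, ILoad 15 13, IAdd 13 4 15, RLoad 7 13] ;;
       IfR 0 7 (Block [IConst 18 1]) (Block [])))
       (effs [IAdd 13 8 11, ILoad 14 13, IAdd 13 5 14, RLoad 0 13, IConst 18 0] (I, R)) 9 ?Q"
    unfolding e1
  proof (rule tc_IfI[where t' = 7])
    assume "fst (I1, R1) 0 \<le> fst (I1, R1) 12"
    then have "a = m" using env a by (simp add: I1_def)
    then show "tc (Block []) (I1, R1) 7 ?Q"
      by (intro tc_Block) (auto simp: I1_def R1_def agree_off_def)
  next
    assume "\<not> fst (I1, R1) 0 \<le> fst (I1, R1) 12"
    then have am: "a < m" using env a by (simp add: I1_def)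
    have e2: "effs [IAdd 13 7 12, ILoad 15 13, IAdd 13 4 15, RLoad 7 13] (I1, R1)
      = (I1(13 := int (DB + \<sigma> a), 15 := int (\<sigma> a)), R1(7 := d (\<sigma> a)))"
      using env a am SB VB \<sigma>_less[OF am]
      by (simp add: I1_def R1_def int_fold fun_upd_twist del: int_unfold)
    show "tc (Block [IAdd 13 7 12, ILoad 15 13, IAdd 13 4 15, RLoad 7 13] ;;
       IfR 0 7 (Block [IConst 18 1]) (Block [])) (I1, R1) 7 ?Q"
      by (rule tc_Block_Seq[where t' = 3], unfold e2, intro tc_IfR[where t' = 1] tc_Block)
        (use am in \<open>auto simp: I1_def R1_def agree_off_def\<close>)
  qed simp
qed simp

end

section \<open>The crude bound\<close>

definition BOUND_ACT :: com where
  "BOUND_ACT = Block [IAdd 13 3 15, RLoad 7 13, IAdd 12 12 2] ;; IfR 7 5 (Block []) (Block [RLoad 5 13])"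

text \<open>A real register is copied by adding a register that holds 0; for integers, register 23
  serves the same purpose throughout.\<close>

definition BOUND_JOB :: com where
  "BOUND_JOB = Block [RAdd 3 3 0, RDiv 7 3 5, IAdd 11 11 2] ;;
     IfR 7 4 (Block []) (Block [RConst 2 0, RAdd 4 7 2])"

definition BOUND :: com where
  "BOUND = Block [IConst 11 0, IConst 12 0, RConst 3 0, RConst 4 0, RConst 5 0] ;;
     While 22 11 (DECIDE ;; IfI 2 18 BOUND_ACT BOUND_JOB)"

context dwp_memory
begin

definition crude_bound :: "real \<Rightarrow> bool" where
  "crude_bound U \<longleftrightarrow> (\<forall>i<n. \<exists>j<m. l (\<tau> i) \<le> d j \<and> (\<Sum>i'<Suc i. l (\<tau> i')) \<le> U * v j) \<and>
     (\<forall>g. valid_schedule m n l d g \<longrightarrow> U \<le> m * delivery_time m l v g)"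

definition bound_inv :: "nat \<Rightarrow> nat \<Rightarrow> real \<Rightarrow> real \<Rightarrow> real \<Rightarrow> bool" where
  "bound_inv i a S U w \<longleftrightarrow> i \<le> n \<and> a \<le> m \<and> S = (\<Sum>i'<i. l (\<tau> i')) \<and> 0 \<le> U \<and>
     (\<forall>a'<a. v (\<sigma> a') \<le> w) \<and> (a = 0 \<and> w = 0 \<or> (\<exists>a'<a. w = v (\<sigma> a'))) \<and>
     (\<forall>a'<a. \<forall>k<n. i \<le> k \<longrightarrow> l (\<tau> k) \<le> d (\<sigma> a')) \<and>
     (\<forall>k<i. \<exists>j<m. l (\<tau> k) \<le> d j \<and> (\<Sum>i'<Suc k. l (\<tau> i')) \<le> U * v j) \<and>
     (\<forall>g. valid_schedule m n l d g \<longrightarrow> U \<le> m * delivery_time m l v g)"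

lemma delivery_time_nonneg:
  assumes "valid_schedule m n l d g"
  shows "0 \<le> delivery_time m l v g"
proof -
  obtain f where "\<And>x. x < n \<Longrightarrow> f x < m" "\<And>x. x < n \<Longrightarrow> l x \<le> d (f x)" and
    f: "\<And>j X. j < m \<Longrightarrow> X \<subseteq> {..<n} \<Longrightarrow> (\<Sum>x | x \<in> X \<and> f x = j. l x) \<le> delivery_time m l v g * v j"
    using valid_scheduleE[OF assms] by blast
  from f[of 0 "{}"] show ?thesis using v_pos[of 0] m1 by (simp add: zero_le_mult_iff)
qed

lemma bound_inv_0: "bound_inv 0 0 0 0 0"
  by (simp add: bound_inv_def delivery_time_nonneg)

lemma bound_inv_act:
  assumes inv: "bound_inv i a S U w" and a: "a < m" "l (\<tau> i) \<le> d (\<sigma> a)" and i: "i < n"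
  shows "bound_inv i (a + 1) S U (max w (v (\<sigma> a)))"
proof -
  have elig: "l (\<tau> k) \<le> d (\<sigma> a')" if "a' < a + 1" "k < n" "i \<le> k" for a' k
  proof (cases "a' = a")
    case True
    then show ?thesis using \<tau>_sorted[OF that(2,3)] a by simp
  next
    case False
    then show ?thesis using inv that by (auto simp: bound_inv_def)
  qed
  have "v (\<sigma> a') \<le> max w (v (\<sigma> a))" if "a' < a + 1" for a'
    using that inv by (cases "a' = a") (simp_all add: bound_inv_def le_max_iff_disj)
  moreover have "\<exists>a'<a + 1. max w (v (\<sigma> a)) = v (\<sigma> a')"
  proof (cases "w \<le> v (\<sigma> a)")
    case True
    then show ?thesis by (intro exI[of _ a]) auto
  next
    case False
    then have "a \<noteq> 0 \<or> w \<noteq> 0" using v_pos[OF \<sigma>_less[OF a(1)]] by auto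
    then obtain a' where "a' < a" "w = v (\<sigma> a')" using inv by (auto simp: bound_inv_def)
    then show ?thesis using False by (intro exI[of _ a']) auto
  qed
  ultimately show ?thesis using inv a elig unfolding bound_inv_def by simp
qed

text \<open>At this moment the active drones are exactly those eligible for \<tau> i, so
  \<open>w\<close> is the top speed among them. The new quotient therefore lets the fastest eligible
  drone carry the whole prefix, and by \<open>prefix_volume\<close> it is at most m times any
  delivery time.\<close>

lemma bound_inv_job:
  assumes inv: "bound_inv i a S U w" and a: "a = m \<or> d (\<sigma> a) < l (\<tau> i)" and i: "i < n"
  shows "bound_inv (i + 1) a (S + l (\<tau> i)) (max U ((S + l (\<tau> i)) / w)) w"
proof -
  have am: "a \<le> m" using inv by (simp add: bound_inv_def)
  have act: "j \<in> \<sigma> ` {..<a}" if "j < m" "l (\<tau> i) \<le> d j" for j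
    using eligible_active[OF a i am that] .
  \<comment> \<open>The drone that can deliver everything is already active, so \<open>w\<close> is
    a genuine speed and the division is by a positive number.\<close>
  obtain j0 where j0: "j0 < m" "\<forall>i<n. l i \<le> d j0" using universal_drone by blast
  then have "j0 \<in> \<sigma> ` {..<a}" using \<tau>_less[OF i] by (intro act) auto
  then have "a \<noteq> 0" by auto
  then obtain a' where a': "a' < a" "w = v (\<sigma> a')" using inv by (auto simp: bound_inv_def)
  have w0: "0 < w" using a' am v_pos[OF \<sigma>_less[of a']] by simp
  have S: "S + l (\<tau> i) = (\<Sum>i'<Suc i. l (\<tau> i'))" using inv by (simp add: bound_inv_def)
  let ?U = "max U ((S + l (\<tau> i)) / w)"
  have ex: "\<exists>j<m. l (\<tau> k) \<le> d j \<and> (\<Sum>i'<Suc k. l (\<tau> i')) \<le> ?U * v j" if k: "k < i + 1" for k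
  proof (cases "k = i")
    case True
    have "(\<Sum>i'<Suc k. l (\<tau> i')) = (S + l (\<tau> i)) / w * w" using w0 S True by simp
    also have "\<dots> \<le> ?U * w" using w0 by (intro mult_right_mono) auto
    finally show ?thesis using a' am \<sigma>_less[of a'] inv i True
      by (intro exI[of _ "\<sigma> a'"]) (auto simp: bound_inv_def)
  next
    case False
    then obtain j where j: "j < m" "l (\<tau> k) \<le> d j" "(\<Sum>i'<Suc k. l (\<tau> i')) \<le> U * v j"
      using k inv unfolding bound_inv_def by (metis Suc_eq_plus1 less_Suc_eq)
    have "U * v j \<le> ?U * v j" using v_pos[OF j(1)] by (intro mult_right_mono) auto
    then show ?thesis using j by (intro exI[of _ j]) auto
  qed
  have up: "?U \<le> m * delivery_time m l v g" if g: "valid_schedule m n l d g" for g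
  proof -
    have "v j \<le> w" if "j < m" "l (\<tau> i) \<le> d j" for j
      using act[OF that] inv by (auto simp: bound_inv_def)
    then have "S + l (\<tau> i) \<le> m * (delivery_time m l v g * w)"
      using prefix_volume[OF g i, of w] w0 by (simp only: S)
    then have "(S + l (\<tau> i)) / w \<le> m * delivery_time m l v g" using w0 by (simp add: divide_le_eq)
    then show ?thesis using inv g by (auto simp: bound_inv_def)
  qed
  show ?thesis using inv i ex up S unfolding bound_inv_def by auto
qed

lemma tc_BOUND:
  assumes env: "env I R"
  shows "tc BOUND (I, R) ((n + m) * 25 + 6) (\<lambda>(I', R'). env I' R' \<and> crude_bound (R' 4))"
proof -
  define Inv where "Inv k s = (case s of (I', R') \<Rightarrow> env I' R' \<and> (\<exists>i a. I' 11 = int i \<and> I' 12 = int a \<and>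
    k = (n - i) + (m - a) \<and> bound_inv i a (R' 3) (R' 4) (R' 5)))" for k :: nat and s
  have InvI: "Inv k (I', R')" if "env I' R'" "I' 11 = int i" "I' 12 = int a"
    "k = (n - i) + (m - a)" "bound_inv i a (R' 3) (R' 4) (R' 5)" for I' R' k i a
    using that by (auto simp: Inv_def)
  show ?thesis unfolding BOUND_def
  proof (rule tc_Block_Seq, rule tc_While[where Inv = Inv and N = "n + m" and tb = 23])
    have "env (I(11 := 0, 12 := 0)) (R(3 := 0, 4 := 0, 5 := 0))"
      by (rule env_agree[OF env]) (auto simp: agree_off_def)
    then show "Inv (n + m) (effs [IConst 11 0, IConst 12 0, RConst 3 0, RConst 4 0, RConst 5 0] (I, R))"
      using bound_inv_0 by (simp add: Inv_def)
  next
    fix k s assume A: "Inv k s" "fst s 11 < fst s 22"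
    obtain I' R' where s: "s = (I', R')" by (cases s)
    obtain i a where env': "env I' R'" and i: "I' 11 = int i" and a: "I' 12 = int a"
      and k: "k = (n - i) + (m - a)" and inv: "bound_inv i a (R' 3) (R' 4) (R' 5)"
      using A(1) by (auto simp: Inv_def s)
    have iN: "i < n" using A(2) env' i by (simp add: s env_def)
    have am: "a \<le> m" using inv by (simp add: bound_inv_def)
    have "tc (DECIDE ;; IfI 2 18 BOUND_ACT BOUND_JOB) (I', R') 23 (Inv (k - 1))"
    proof (rule tc_Seq[OF tc_DECIDE[OF env' i iN a am], where ?t2.0 = 9])
      fix s2 assume "case s2 of (I2, R2) \<Rightarrow> agree_off {13, 14, 15, 18} I' I2 \<and> agree_off {0, 7} R' R2 \<and>
        R2 0 = l (\<tau> i) \<and> I2 14 = int (\<tau> i) \<and>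
        (I2 18 = 1 \<and> a < m \<and> l (\<tau> i) \<le> d (\<sigma> a) \<and> I2 15 = int (\<sigma> a) \<or>
         I2 18 = 0 \<and> (a = m \<or> d (\<sigma> a) < l (\<tau> i)))"
      then obtain I2 R2 where s2: "s2 = (I2, R2)" and ag: "agree_off {13, 14, 15, 18} I' I2" "agree_off {0, 7} R' R2"
        and r: "R2 0 = l (\<tau> i)" and
        cs: "I2 18 = 1 \<and> a < m \<and> l (\<tau> i) \<le> d (\<sigma> a) \<and> I2 15 = int (\<sigma> a) \<or>
         I2 18 = 0 \<and> (a = m \<or> d (\<sigma> a) < l (\<tau> i))" by (cases s2) auto
      have env2: "env I2 R2" by (rule env_agree[OF env']) (use ag in \<open>auto simp: agree_off_def\<close>)
      have R2: "R2 3 = R' 3" "R2 4 = R' 4" "R2 5 = R' 5" using ag(2) by (auto simp: agree_off_def)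
      have I2: "I2 11 = int i" "I2 12 = int a" "I2 2 = 1" "I2 3 = int VB"
        using ag(1) i a env' by (auto simp: agree_off_def env_def)
      note inv2 = inv[folded R2]
      show "tc (IfI 2 18 BOUND_ACT BOUND_JOB) s2 9 (Inv (k - 1))"
        unfolding s2
      proof (rule tc_IfI[where t' = 7])
        assume "fst (I2, R2) 2 \<le> fst (I2, R2) 18"
        then have c: "a < m" "l (\<tau> i) \<le> d (\<sigma> a)" "I2 15 = int (\<sigma> a)" using cs I2 by auto
        have vs: "R2 (VB + \<sigma> a) = v (\<sigma> a)" using env2 \<sigma>_less[OF c(1)] by (simp add: env_def)
        have e: "effs [IAdd 13 3 15, RLoad 7 13, IAdd 12 12 2] (I2, R2) =
          (I2(13 := int (VB + \<sigma> a), 12 := int (a + 1)), R2(7 := v (\<sigma> a)))"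
          using I2 c vs by (simp add: int_fold del: int_unfold)
        have env3: "env (I2(13 := int (VB + \<sigma> a), 12 := int (a + 1))) (R2(7 := v (\<sigma> a), 5 := w))"
          "env (I2(13 := int (VB + \<sigma> a), 12 := int (a + 1))) (R2(7 := v (\<sigma> a)))" for w
          by (rule env_agree[OF env2]; auto simp: agree_off_def)+
        have VB5: "VB + \<sigma> a \<noteq> 5" "VB + \<sigma> a \<noteq> 7" using VB by auto
        show "tc BOUND_ACT (I2, R2) 7 (Inv (k - 1))"
          unfolding BOUND_ACT_def
        proof (rule tc_Block_Seq[where t' = 3], unfold e, intro tc_IfR[where t' = 1] tc_Block)
          assume "snd (I2(13 := int (VB + \<sigma> a), 12 := int (a + 1)), R2(7 := v (\<sigma> a))) 7
            \<le> snd (I2(13 := int (VB + \<sigma> a), 12 := int (a + 1)), R2(7 := v (\<sigma> a))) 5"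
          then show "Inv (k - 1) (effs [] (I2(13 := int (VB + \<sigma> a), 12 := int (a + 1)), R2(7 := v (\<sigma> a))))"
            using env3(2) bound_inv_act[OF inv2 c(1,2) iN] I2 c k
            by (auto simp: Inv_def max_def intro!: exI[of _ i] exI[of _ "a + 1"])
        next
          assume "\<not> snd (I2(13 := int (VB + \<sigma> a), 12 := int (a + 1)), R2(7 := v (\<sigma> a))) 7
            \<le> snd (I2(13 := int (VB + \<sigma> a), 12 := int (a + 1)), R2(7 := v (\<sigma> a))) 5"
          then show "Inv (k - 1) (effs [RLoad 5 13] (I2(13 := int (VB + \<sigma> a), 12 := int (a + 1)), R2(7 := v (\<sigma> a))))"
            using env3(1)[of "v (\<sigma> a)"] bound_inv_act[OF inv2 c(1,2) iN] I2 c k vs VB5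
            by (auto simp: Inv_def max_def int_fold simp del: int_unfold intro!: exI[of _ i] exI[of _ "a + 1"])
        qed auto
      next
        assume "\<not> fst (I2, R2) 2 \<le> fst (I2, R2) 18"
        then have c: "a = m \<or> d (\<sigma> a) < l (\<tau> i)" using cs I2 by auto
        let ?S = "R2 3 + l (\<tau> i)"
        have e: "effs [RAdd 3 3 0, RDiv 7 3 5, IAdd 11 11 2] (I2, R2) =
          (I2(11 := int (i + 1)), R2(3 := ?S, 7 := ?S / R2 5))"
          using I2 r by (simp add: int_fold del: int_unfold)
        have env3: "env (I2(11 := int (i + 1))) (R2(3 := ?S, 7 := ?S / R2 5))"
          "env (I2(11 := int (i + 1))) (R2(3 := ?S, 7 := ?S / R2 5, 2 := 0, 4 := ?S / R2 5))"
          by (rule env_agree[OF env2]; auto simp: agree_off_def)+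
        note inv3 = bound_inv_job[OF inv2 c iN]
        show "tc BOUND_JOB (I2, R2) 7 (Inv (k - 1))"
          unfolding BOUND_JOB_def
        proof (rule tc_Block_Seq[where t' = 4], unfold e, rule tc_IfR[where t' = 2]; (rule tc_Block)?)
          assume "snd (I2(11 := int (i + 1)), R2(3 := ?S, 7 := ?S / R2 5)) 7
            \<le> snd (I2(11 := int (i + 1)), R2(3 := ?S, 7 := ?S / R2 5)) 4"
          then show "Inv (k - 1) (effs [] (I2(11 := int (i + 1)), R2(3 := ?S, 7 := ?S / R2 5)))"
            unfolding effs.simps
            by (intro InvI[of _ _ "i + 1" a] env3) (use inv3 I2 k iN in \<open>auto simp: max_def\<close>)
        next
          assume "\<not> snd (I2(11 := int (i + 1)), R2(3 := ?S, 7 := ?S / R2 5)) 7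
            \<le> snd (I2(11 := int (i + 1)), R2(3 := ?S, 7 := ?S / R2 5)) 4"
          moreover have e4: "effs [RConst 2 0, RAdd 4 7 2] (I2(11 := int (i + 1)), R2(3 := ?S, 7 := ?S / R2 5))
            = (I2(11 := int (i + 1)), R2(3 := ?S, 7 := ?S / R2 5, 2 := 0, 4 := ?S / R2 5))" by simp
          ultimately show "Inv (k - 1) (effs [RConst 2 0, RAdd 4 7 2]
              (I2(11 := int (i + 1)), R2(3 := ?S, 7 := ?S / R2 5)))"
            unfolding e4
            by (intro InvI[of _ _ "i + 1" a] env3) (use inv3 I2 k iN in \<open>auto simp: max_def\<close>)
        qed auto
      qed simp
    qed simp
    then show "0 < k \<and> tc (DECIDE ;; IfI 2 18 BOUND_ACT BOUND_JOB) s 23 (Inv (k - 1))"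
      using k iN by (simp add: s)
  next
    fix k s assume A: "Inv k s" "fst s 22 \<le> fst s 11"
    obtain I' R' where s: "s = (I', R')" by (cases s)
    obtain i a where env': "env I' R'" and i: "I' 11 = int i"
      and inv: "bound_inv i a (R' 3) (R' 4) (R' 5)"
      using A(1) by (auto simp: Inv_def s)
    have "i = n" using A(2) env' i inv by (simp add: s env_def bound_inv_def)
    then show "case s of (I', R') \<Rightarrow> env I' R' \<and> crude_bound (R' 4)"
      using env' inv by (simp add: s crude_bound_def bound_inv_def)
  qed auto
qed

end

section \<open>Any-fit assignment\<close>

context sorted_dwp
begin

text \<open>Inactive drones keep residual capacity 0. Lengths are positive, so a search for a leaf
  of at least \<open>l (\<tau> i)\<close> never returns one of them, and one tree over all
  \<open>m\<close> drones can be used without deletions or rebuilding.\<close>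

definition fit_inv :: "real \<Rightarrow> nat \<Rightarrow> nat \<Rightarrow> (nat \<Rightarrow> nat) \<Rightarrow> (nat \<Rightarrow> real) \<Rightarrow> bool" where
  "fit_inv cap i a f rem \<longleftrightarrow> i \<le> n \<and> a \<le> m \<and>
     (\<forall>x\<in>\<tau> ` {..<i}. f x \<in> \<sigma> ` {..<a} \<and> l x \<le> d (f x)) \<and>
     (\<forall>j<m. rem j = (if j \<in> \<sigma> ` {..<a} then cap * v j - load f i j else 0) \<and> 0 \<le> rem j) \<and>
     (\<forall>a'<a. \<forall>k<n. i \<le> k \<longrightarrow> l (\<tau> k) \<le> d (\<sigma> a'))"

definition assignment :: "(nat \<Rightarrow> nat) \<Rightarrow> real \<Rightarrow> bool" where
  "assignment f cap \<longleftrightarrow> (\<forall>x<n. f x < m \<and> l x \<le> d (f x)) \<and>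
     (\<forall>j<m. (\<Sum>x | x < n \<and> f x = j. l x) \<le> cap * v j)"

lemma fit_inv_0: "fit_inv cap 0 0 f (\<lambda>_. 0)"
  by (simp add: fit_inv_def)

lemma fit_invD:
  assumes "fit_inv cap i a f rem"
  shows "i \<le> n" "a \<le> m" "x \<in> \<tau> ` {..<i} \<Longrightarrow> f x \<in> \<sigma> ` {..<a} \<and> l x \<le> d (f x)"
    "j < m \<Longrightarrow> rem j = (if j \<in> \<sigma> ` {..<a} then cap * v j - load f i j else 0)" "j < m \<Longrightarrow> 0 \<le> rem j"
    "a' < a \<Longrightarrow> k < n \<Longrightarrow> i \<le> k \<Longrightarrow> l (\<tau> k) \<le> d (\<sigma> a')"
  using assms unfolding fit_inv_def by blast+

lemma fit_invI:
  assumes "i \<le> n" "a \<le> m" "\<And>x. x \<in> \<tau> ` {..<i} \<Longrightarrow> f x \<in> \<sigma> ` {..<a} \<and> l x \<le> d (f x)"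
    "\<And>j. j < m \<Longrightarrow> rem j = (if j \<in> \<sigma> ` {..<a} then cap * v j - load f i j else 0)"
    "\<And>j. j < m \<Longrightarrow> 0 \<le> rem j" "\<And>a' k. a' < a \<Longrightarrow> k < n \<Longrightarrow> i \<le> k \<Longrightarrow> l (\<tau> k) \<le> d (\<sigma> a')"
  shows "fit_inv cap i a f rem"
  using assms unfolding fit_inv_def by blast

lemma fit_inv_cong:
  assumes "fit_inv cap i a f rem" "\<And>j. j < m \<Longrightarrow> rem' j = rem j"
  shows "fit_inv cap i a f rem'"
  using fit_invD[OF assms(1)] by (intro fit_invI) (simp_all only: assms(2))

lemma fit_inv_act:
  assumes inv: "fit_inv cap i a f rem" and a: "a < m" "l (\<tau> i) \<le> d (\<sigma> a)" and i: "i < n" and "0 \<le> cap"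
  shows "fit_inv cap i (a + 1) f (rem(\<sigma> a := cap * v (\<sigma> a)))"
proof -
  \<comment> \<open>All parcels placed so far went to drones activated earlier, so the new drone
    starts with load 0.\<close>
  have "f x \<noteq> \<sigma> a" if "x \<in> \<tau> ` {..<i}" for x
    using fit_invD(3)[OF inv that] \<sigma>_new[OF a(1)] by metis
  then have "{x. x \<in> \<tau> ` {..<i} \<and> f x = \<sigma> a} = {}" by blast
  then have ld: "load f i (\<sigma> a) = 0" unfolding load_def by (simp only: sum.empty)
  have im: "\<sigma> ` {..<a + 1} = insert (\<sigma> a) (\<sigma> ` {..<a})" by (simp add: lessThan_Suc)
  have elig: "l (\<tau> k) \<le> d (\<sigma> a')" if "a' < a + 1" "k < n" "i \<le> k" for a' k
  proof (cases "a' = a")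
    case True
    then show ?thesis using \<tau>_sorted[OF that(2,3)] a by simp
  next
    case False
    then show ?thesis using fit_invD(6)[OF inv] that by simp
  qed
  have c0: "0 \<le> cap * v (\<sigma> a)" using assms(5) v_pos[OF \<sigma>_less[OF a(1)]] by simp
  show ?thesis
  proof (rule fit_invI)
    fix j assume j: "j < m"
    show "(rem(\<sigma> a := cap * v (\<sigma> a))) j = (if j \<in> \<sigma> ` {..<a + 1} then cap * v j - load f i j else 0)"
      unfolding im using fit_invD(4)[OF inv j] ld by (cases "j = \<sigma> a") simp_all
    show "0 \<le> (rem(\<sigma> a := cap * v (\<sigma> a))) j" using fit_invD(5)[OF inv j] c0 by simp
  qed (use fit_invD[OF inv] a elig im in auto)
qed

lemma fit_inv_place:
  assumes inv: "fit_inv cap i a f rem" and i: "i < n" and j: "j < m" "l (\<tau> i) \<le> rem j"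
  shows "fit_inv cap (i + 1) a (f(\<tau> i := j)) (rem(j := rem j - l (\<tau> i)))"
proof -
  have "rem j \<noteq> 0" using j l_pos[OF \<tau>_less[OF i]] by simp
  then have ja: "j \<in> \<sigma> ` {..<a}" using fit_invD(4)[OF inv j(1)] by (simp split: if_splits)
  then have jd: "l (\<tau> i) \<le> d j" using fit_invD(6)[OF inv _ i] by auto
  have f: "(f(\<tau> i := j)) x \<in> \<sigma> ` {..<a} \<and> l x \<le> d ((f(\<tau> i := j)) x)" if "x \<in> \<tau> ` {..<i + 1}" for x
  proof (cases "x = \<tau> i")
    case True
    then show ?thesis using ja jd by simp
  next
    case False
    then have "x \<in> \<tau> ` {..<i}" using that by (auto simp: less_Suc_eq)
    then show ?thesis using fit_invD(3)[OF inv] False by simp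
  qed
  show ?thesis
  proof (rule fit_invI)
    fix j' assume j': "j' < m"
    show "(rem(j := rem j - l (\<tau> i))) j' = (if j' \<in> \<sigma> ` {..<a}
        then cap * v j' - load (f(\<tau> i := j)) (i + 1) j' else 0)"
      using fit_invD(4)[OF inv j'] fit_invD(4)[OF inv j(1)] ja load_Suc[OF i, of f j j'] by simp
    show "0 \<le> (rem(j := rem j - l (\<tau> i))) j'"
      using fit_invD(5)[OF inv j'] j by simp
  qed (use fit_invD[OF inv] i f in auto)
qed

lemma fit_inv_stuck:
  assumes inv: "fit_inv cap i a f rem" and i: "i < n" and a: "a = m \<or> d (\<sigma> a) < l (\<tau> i)"
    and full: "\<And>j. j < m \<Longrightarrow> rem j < l (\<tau> i)"
  shows "stuck cap"
  unfolding stuck_def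
proof (intro exI[of _ i] exI[of _ f] conjI allI impI i)
  fix j assume j: "j < m" "l (\<tau> i) \<le> d j"
  then have "j \<in> \<sigma> ` {..<a}" using fit_invD(2)[OF inv] by (intro eligible_active[OF a i])
  then show "cap * v j < load f i j + l (\<tau> i)"
    using fit_invD(4)[OF inv j(1)] full[OF j(1)] by simp
qed

lemma fit_inv_done:
  assumes inv: "fit_inv cap n a f rem" and cap: "0 \<le> cap"
  shows "assignment f cap"
  unfolding assignment_def
proof (intro conjI allI impI)
  have \<tau>n: "\<tau> ` {..<n} = {..<n}" using \<tau> by (simp add: bij_betw_def)
  have f: "f x \<in> \<sigma> ` {..<a}" "l x \<le> d (f x)" if "x < n" for x
    using fit_invD(3)[OF inv] that unfolding \<tau>n by auto
  have am: "a \<le> m" using fit_invD(2)[OF inv] .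
  show "f x < m" "l x \<le> d (f x)" if "x < n" for x using f[OF that] am \<sigma>_less by auto
  fix j assume j: "j < m"
  show "(\<Sum>x | x < n \<and> f x = j. l x) \<le> cap * v j"
  proof (cases "j \<in> \<sigma> ` {..<a}")
    case True
    then show ?thesis using fit_invD(4,5)[OF inv j] by (simp add: load_n)
  next
    case False
    then have "{x. x < n \<and> f x = j} = {}" using f(1) by blast
    then show ?thesis using cap v_pos[OF j] by (simp only: sum.empty) simp
  qed
qed

end

definition ACT :: com where
  "ACT = Block [IAdd 13 3 15, RLoad 7 13, RMul 7 3 7, IAdd 15 0 15, IAdd 13 6 15, RStore 13 7, IAdd 12 12 2] ;;
     UPDATE"

definition PLACE :: com where
  "PLACE = WALK ;;
     Block [ISub 17 15 16, IAdd 13 9 14, IStore 13 17, IAdd 13 6 15, RLoad 7 13, RSub 7 7 0, RStore 13 7,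
       IAdd 11 11 2] ;;
     UPDATE"

text \<open>If even the root is smaller than the parcel, no drone has room: the success flag in
  register 19 is cleared, and setting the parcel counter to n ends the loop.\<close>

definition JOB :: com where
  "JOB = Block [IAdd 13 6 2, RLoad 7 13] ;; IfR 0 7 PLACE (Block [IConst 19 0, IAdd 11 22 23])"

definition ANYFIT :: com where
  "ANYFIT = Block [IAdd 16 0 23] ;; CLEAR ;; Block [IConst 11 0, IConst 12 0, IConst 19 1] ;;
     While 22 11 (DECIDE ;; IfI 2 18 ACT JOB)"

context dwp_memory
begin

definition fit_state :: "real \<Rightarrow> nat \<Rightarrow> nat \<Rightarrow> (nat \<Rightarrow> nat) \<Rightarrow> (nat \<Rightarrow> int) \<Rightarrow> (nat \<Rightarrow> real) \<Rightarrow> bool" where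
  "fit_state cap i a f I R \<longleftrightarrow> env I R \<and> I 16 = int m \<and> R 3 = cap \<and> tree_ok R TB m 0 \<and>
     I 11 = int i \<and> I 12 = int a \<and> (\<forall>x \<in> \<tau> ` {..<i}. I (RB + x) = int (f x)) \<and>
     fit_inv cap i a f (\<lambda>j. R (TB + m + j))"

lemma tc_ACT:
  assumes st: "fit_state cap i a f I R" and a: "a < m" "l (\<tau> i) \<le> d (\<sigma> a)" "I 15 = int (\<sigma> a)"
    and i: "i < n" and cap: "0 \<le> cap" and b: "m \<le> 2 ^ b"
  shows "tc ACT (I, R) (12 * b + 9) (\<lambda>(I', R'). agree_off {12, 13, 15} I I' \<and>
    agree_off ({2, 7} \<union> {TB..}) R R' \<and> fit_state cap i (a + 1) f I' R')"
  unfolding ACT_def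
proof (rule tc_Block_Seq[where t' = "12 * b + 2"])
  have env: "env I R" and c: "R 3 = cap" "I 12 = int a" "I 16 = int m" "I 11 = int i" and tree: "tree_ok R TB m 0"
    and inv: "fit_inv cap i a f (\<lambda>j. R (TB + m + j))"
    and res: "\<And>x. x \<in> \<tau> ` {..<i} \<Longrightarrow> I (RB + x) = int (f x)"
    using st by (auto simp: fit_state_def)
  note e' = env[unfolded env_def]
  let ?j = "\<sigma> a"
  have jm: "?j < m" using \<sigma>_less[OF a(1)] .
  define I1 where "I1 = I(15 := int (m + ?j), 13 := int (TB + m + ?j), 12 := int (a + 1))"
  define R1 where "R1 = R(7 := cap * v ?j, TB + m + ?j := cap * v ?j)"
  have e: "effs [IAdd 13 3 15, RLoad 7 13, RMul 7 3 7, IAdd 15 0 15, IAdd 13 6 15, RStore 13 7, IAdd 12 12 2] (I, R)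
    = (I1, R1)"
    using e' a c jm by (simp add: I1_def R1_def int_fold fun_upd_twist add.assoc del: int_unfold)
  have env1: "env I1 R1" by (rule env_agree[OF env]) (auto simp: I1_def R1_def agree_off_def)
  have "tc UPDATE (I1, R1) (12 * b + 2) (\<lambda>(I', R'). agree_off {13, 15} I1 I' \<and>
    agree_off ({2, 7} \<union> {TB + 1..<TB + m}) R1 R' \<and> tree_ok R' TB m 0)"
  proof (rule tc_UPDATE)
    show "tree_ok R1 TB m ((m + ?j) div 2)"
      by (rule tree_ok_store[OF tree]) (use TB8 in \<open>auto simp: R1_def\<close>)
  qed (use env1 jm b TB8 in \<open>auto simp: env_def, auto simp: I1_def\<close>)
  then show "tc UPDATE (effs [IAdd 13 3 15, RLoad 7 13, RMul 7 3 7, IAdd 15 0 15, IAdd 13 6 15, RStore 13 7,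
      IAdd 12 12 2] (I, R)) (12 * b + 2) (\<lambda>(I', R'). agree_off {12, 13, 15} I I' \<and>
    agree_off ({2, 7} \<union> {TB..}) R R' \<and> fit_state cap i (a + 1) f I' R')"
    unfolding e
  proof (rule tc_conseq)
    fix s assume "case s of (I', R') \<Rightarrow> agree_off {13, 15} I1 I' \<and>
      agree_off ({2, 7} \<union> {TB + 1..<TB + m}) R1 R' \<and> tree_ok R' TB m 0"
    then obtain I2 R2 where s: "s = (I2, R2)" and ag: "agree_off {13, 15} I1 I2"
      "agree_off ({2, 7} \<union> {TB + 1..<TB + m}) R1 R2" and t2: "tree_ok R2 TB m 0" by (cases s) auto
    have agI: "agree_off {12, 13, 15} I I2" using ag(1) by (auto simp: agree_off_def I1_def)
    have agR: "agree_off ({2, 7} \<union> {TB..}) R R2" using ag(2) by (auto simp: agree_off_def R1_def)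
    have env2: "env I2 R2" by (rule env_agree[OF env]) (use agI agR in \<open>auto simp: agree_off_def\<close>)
    have lf: "R2 (TB + m + j) = ((\<lambda>j. R (TB + m + j))(?j := cap * v ?j)) j" if "j < m" for j
      using agree_offD[OF ag(2), of "TB + m + j"] TB8 by (auto simp: R1_def)
    have "fit_inv cap i (a + 1) f (\<lambda>j. R2 (TB + m + j))"
      using fit_inv_cong[OF fit_inv_act[OF inv a(1,2) i cap] lf] .
    moreover have "I2 (RB + x) = int (f x)" if "x \<in> \<tau> ` {..<i}" for x
      using agree_offD[OF agI, of "RB + x"] SB res[OF that] by auto
    moreover have "I2 16 = int m" "I2 11 = int i" "I2 12 = int (a + 1)"
      using c agree_offD[OF agI, of 16] agree_offD[OF agI, of 11] agree_offD[OF ag(1), of 12] by (auto simp: I1_def)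
    moreover have "R2 3 = cap" using c agree_offD[OF agR, of 3] TB8 by auto
    ultimately show "case s of (I', R') \<Rightarrow> agree_off {12, 13, 15} I I' \<and>
      agree_off ({2, 7} \<union> {TB..}) R R' \<and> fit_state cap i (a + 1) f I' R'"
      using agI agR env2 t2 by (simp add: s fit_state_def)
  qed simp
qed simp

lemma tc_PLACE:
  assumes st: "fit_state cap i a f I R" and x: "R 0 = l (\<tau> i)" "I 14 = int (\<tau> i)"
    and i: "i < n" and b: "m \<le> 2 ^ b" and root: "R 0 \<le> R (TB + 1)"
  shows "tc PLACE (I, R) (20 * b + 12) (\<lambda>(I', R'). agree_off ({11, 13, 15, 17} \<union> {RB..<RB + n}) I I' \<and>
    agree_off ({2, 7} \<union> {TB..}) R R' \<and> (\<exists>f. fit_state cap (i + 1) a f I' R'))"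
    (is "tc _ _ _ ?Q")
proof -
  have env: "env I R" and c: "R 3 = cap" "I 12 = int a" "I 16 = int m" "I 11 = int i" and tree: "tree_ok R TB m 0"
    and inv: "fit_inv cap i a f (\<lambda>j. R (TB + m + j))"
    and res: "\<And>x. x \<in> \<tau> ` {..<i} \<Longrightarrow> I (RB + x) = int (f x)"
    using st by (auto simp: fit_state_def)
  note e' = env[unfolded env_def]
  have walk: "tc WALK (I, R) (8 * b + 2) (\<lambda>(I', R'). agree_off {13, 15} I I' \<and>
    agree_off {7} R R' \<and> (\<exists>p. I' 15 = int p \<and> m \<le> p \<and> p < 2 * m \<and> R 0 \<le> R (TB + p)))"
    by (rule tc_WALK) (use e' c m1 b tree root TB8 in auto)
  show ?thesis unfolding PLACE_def
  proof (rule tc_Seq[OF walk, where ?t2.0 = "12 * b + 10"])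
    fix s assume "case s of (I', R') \<Rightarrow> agree_off {13, 15} I I' \<and>
      agree_off {7} R R' \<and> (\<exists>p. I' 15 = int p \<and> m \<le> p \<and> p < 2 * m \<and> R 0 \<le> R (TB + p))"
    then obtain I1 R1 p where s: "s = (I1, R1)" and ag1: "agree_off {13, 15} I I1" "agree_off {7} R R1"
      and p: "I1 15 = int p" "m \<le> p" "p < 2 * m" "R 0 \<le> R (TB + p)" by (cases s) auto
    define j where "j = p - m"
    have pj: "p = m + j" "j < m" using p by (auto simp: j_def)
    have I1: "I1 6 = int TB" "I1 2 = 1" "I1 16 = int m" "I1 9 = int RB" "I1 11 = int i" "I1 14 = int (\<tau> i)"
      using agree_offD[OF ag1(1)] e' c x by auto
    have R1: "R1 a = R a" if "a \<noteq> 7" for a using agree_offD[OF ag1(2)] that by auto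
    define r where "r = R (TB + m + j) - l (\<tau> i)"
    define I2 where "I2 = I1(17 := int j, RB + \<tau> i := int j, 13 := int (TB + m + j), 11 := int (i + 1))"
    define R2 where "R2 = R1(7 := r, TB + m + j := r)"
    have ne: "RB + \<tau> i \<noteq> k" if "k \<le> 23" for k using SB that by auto
    have TBp: "TB + (m + j) \<noteq> 7" using TB8 by auto
    have "effs [ISub 17 15 16, IAdd 13 9 14, IStore 13 17, IAdd 13 6 15, RLoad 7 13, RSub 7 7 0, RStore 13 7,
       IAdd 11 11 2] s = (I1(17 := int j, 13 := int (RB + \<tau> i), RB + \<tau> i := int j, 13 := int (TB + (m + j)),
         11 := int (i + 1)), R2)"
      using I1 p(1) ne R1[of "TB + (m + j)"] R1[of 0] TBp x(1)
      by (simp add: s pj(1) R2_def r_def int_fold add.assoc del: int_unfold) simp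
    also have "I1(17 := int j, 13 := int (RB + \<tau> i), RB + \<tau> i := int j, 13 := int (TB + (m + j)),
         11 := int (i + 1)) = I2"
      using ne[of 13] by (auto simp: I2_def add.assoc)
    finally have e2: "effs [ISub 17 15 16, IAdd 13 9 14, IStore 13 17, IAdd 13 6 15, RLoad 7 13, RSub 7 7 0,
       RStore 13 7, IAdd 11 11 2] s = (I2, R2)" .
    have env2: "env I2 R2"
      by (rule env_agree[OF env]) (use ag1 in \<open>auto simp: I2_def R2_def agree_off_def\<close>)
    have "tc UPDATE (I2, R2) (12 * b + 2) (\<lambda>(I', R'). agree_off {13, 15} I2 I' \<and>
      agree_off ({2, 7} \<union> {TB + 1..<TB + m}) R2 R' \<and> tree_ok R' TB m 0)"
    proof (rule tc_UPDATE)
      show "tree_ok R2 TB m ((m + j) div 2)"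
        by (rule tree_ok_store[OF tree]) (use TB8 R1 in \<open>auto simp: R2_def\<close>)
      show "I2 15 = int (m + j)" using ne[of 15] p(1) pj(1) by (simp add: I2_def)
    qed (use env2 pj b TB8 in \<open>auto simp: env_def\<close>)
    then have "tc UPDATE (I2, R2) (12 * b + 2) ?Q"
    proof (rule tc_conseq)
      fix s assume "case s of (I', R') \<Rightarrow> agree_off {13, 15} I2 I' \<and>
        agree_off ({2, 7} \<union> {TB + 1..<TB + m}) R2 R' \<and> tree_ok R' TB m 0"
      then obtain I3 R3 where s: "s = (I3, R3)" and ag: "agree_off {13, 15} I2 I3"
        "agree_off ({2, 7} \<union> {TB + 1..<TB + m}) R2 R3" and t3: "tree_ok R3 TB m 0" by (cases s) auto
      have agI': "agree_off {11, 13, 15, 17, RB + \<tau> i} I I3"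
        using ag(1) ag1(1) by (auto simp: agree_off_def I2_def)
      then have agI: "agree_off ({11, 13, 15, 17} \<union> {RB..<RB + n}) I I3"
        by (rule agree_off_mono) (use \<tau>_less[OF i] in auto)
      have agR: "agree_off ({2, 7} \<union> {TB..}) R R3" using ag(2) ag1(2) by (auto simp: agree_off_def R2_def)
      have env3: "env I3 R3" by (rule env_agree[OF env]) (use agI agR in \<open>auto simp: agree_off_def\<close>)
      have lf: "R3 (TB + m + j') = ((\<lambda>j. R (TB + m + j))(j := R (TB + m + j) - l (\<tau> i))) j'" if "j' < m" for j'
        using agree_offD[OF ag(2), of "TB + m + j'"] TB8 R1 by (auto simp: R2_def r_def)
      have jl: "l (\<tau> i) \<le> R (TB + m + j)" using p x pj by (simp add: add.assoc)
      have "fit_inv cap (i + 1) a (f(\<tau> i := j)) (\<lambda>j. R3 (TB + m + j))"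
        using fit_inv_cong[OF fit_inv_place[OF inv i pj(2) jl] lf] .
      moreover have "I3 (RB + x) = int ((f(\<tau> i := j)) x)" if "x \<in> \<tau> ` {..<i + 1}" for x
      proof (cases "x = \<tau> i")
        case True
        then show ?thesis using agree_offD[OF ag(1), of "RB + \<tau> i"] ne by (auto simp: I2_def)
      next
        case False
        then have "x \<in> \<tau> ` {..<i}" using that by (auto simp: less_Suc_eq)
        then show ?thesis using agree_offD[OF agI', of "RB + x"] SB res[of x] False by auto
      qed
      moreover have "I3 16 = int m" "I3 11 = int (i + 1)" "I3 12 = int a"
        using c agree_offD[OF agI', of 16] agree_offD[OF agI', of 12] agree_offD[OF ag(1), of 11] ne
        by (auto simp: I2_def)
      moreover have "R3 3 = cap" using c agree_offD[OF agR, of 3] TB8 by auto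
      ultimately show "?Q s"
        using agI agR env3 t3 by (auto simp add: s fit_state_def intro!: exI[of _ "f(\<tau> i := j)"])
    qed simp
    then show "tc (Block [ISub 17 15 16, IAdd 13 9 14, IStore 13 17, IAdd 13 6 15, RLoad 7 13, RSub 7 7 0,
       RStore 13 7, IAdd 11 11 2] ;; UPDATE) s (12 * b + 10) ?Q"
      unfolding e2[symmetric] by (rule tc_Block_Seq) simp
  qed simp
qed

end

section \<open>Programs for the bisection\<close>

definition COPY :: com where
  "COPY = Block [IConst 11 0] ;; While 22 11 (
     Block [IAdd 13 9 11, ILoad 14 13, IAdd 13 10 11, IStore 13 14, IAdd 11 11 2])"

definition BISECT :: com where
  "BISECT = Block [RSub 7 5 4, RMul 3 6 7] ;; ANYFIT ;;
     IfI 2 19 (Block [RSub 5 5 4] ;; COPY) (Block []) ;;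
     Block [RConst 7 2, RDiv 4 4 7, ISub 20 20 2]"

text \<open>No instruction turns \<open>m\<close> into a real number. Instead an integer copy of
  \<open>m\<close> and the real 1/8 are halved in lockstep until the integer vanishes. With p the
  bit length of \<open>m\<close> this leaves \<epsilon> = 1/(8 * 2^p), while register 20 counts up
  to 5 + 2 p, the number of bisection rounds.\<close>

definition PRECISION :: com where
  "PRECISION = Block [RConst 6 (1 / 8), RConst 7 2, IAdd 14 0 23, IConst 20 5, IConst 13 2] ;;
     While 14 23 (Block [IHalf 14 14, RDiv 6 6 7, IAdd 20 20 13]) ;;
     Block [RConst 7 golden_ratio, RSub 6 7 6, RAdd 5 4 4]"

context dwp_memory
begin

lemma fit_state_agree:
  assumes st: "fit_state cap i a f I R" and ag: "agree_off {13, 14, 15, 17, 18, 19} I I'" "agree_off {0, 2, 7} R R'"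
  shows "fit_state cap i a f I' R'"
proof -
  have I': "I' b = I b" if "b \<notin> {13, 14, 15, 17, 18, 19}" for b using agree_offD[OF ag(1) that] .
  have R': "R' b = R b" if "8 \<le> b \<or> b = 3" for b using agree_offD[OF ag(2), of b] that by auto
  have "env I' R'"
    by (rule env_agree[of I R]) (use st ag in \<open>auto simp: fit_state_def agree_off_def\<close>)
  moreover have "tree_ok R' TB m 0" using st TB8 by (simp add: fit_state_def tree_ok_def R')
  moreover have "fit_inv cap i a f (\<lambda>j. R' (TB + m + j))"
    using st TB8 by (simp add: fit_state_def R')
  moreover have "I' (RB + x) = I (RB + x)" for x using SB by (intro I') auto
  ultimately show ?thesis using st by (simp add: fit_state_def I' R')
qed

lemma tc_JOB:
  assumes st: "fit_state cap i a f I R" and x: "R 0 = l (\<tau> i)" "I 14 = int (\<tau> i)"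
    and i: "i < n" and b: "m \<le> 2 ^ b" and a: "a = m \<or> d (\<sigma> a) < l (\<tau> i)"
  shows "tc JOB (I, R) (20 * b + 16) (\<lambda>(I', R'). agree_off ({11, 13, 15, 17, 19} \<union> {RB..<RB + n}) I I' \<and>
    agree_off ({2, 7} \<union> {TB..}) R R' \<and>
    (I' 19 = I 19 \<and> (\<exists>f. fit_state cap (i + 1) a f I' R') \<or> I' 19 = 0 \<and> stuck cap \<and> I' 11 = int n))"
    (is "tc _ _ _ ?Q")
  unfolding JOB_def
proof (rule tc_Block_Seq[where t' = "20 * b + 14"])
  have env: "env I R" and inv: "fit_inv cap i a f (\<lambda>j. R (TB + m + j))" and tree: "tree_ok R TB m 0"
    using st by (auto simp: fit_state_def)
  define I1 where "I1 = I(13 := int (TB + 1))"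
  define R1 where "R1 = R(7 := R (TB + 1))"
  have e: "effs [IAdd 13 6 2, RLoad 7 13] (I, R) = (I1, R1)"
    using env by (simp add: env_def I1_def R1_def int_fold del: int_unfold)
  have st1: "fit_state cap i a f I1 R1"
    by (rule fit_state_agree[OF st]) (auto simp: agree_off_def I1_def R1_def)
  have SB19: "19 < RB" using SB by auto
  show "tc (IfR 0 7 PLACE (Block [IConst 19 0, IAdd 11 22 23])) (effs [IAdd 13 6 2, RLoad 7 13] (I, R))
      (20 * b + 14) ?Q"
    unfolding e
  proof (rule tc_IfR[where t' = "20 * b + 12"])
    assume "snd (I1, R1) 0 \<le> snd (I1, R1) 7"
    then have root: "R1 0 \<le> R1 (TB + 1)" using TB8 by (simp add: R1_def)
    have x1: "R1 0 = l (\<tau> i)" "I1 14 = int (\<tau> i)" using x by (auto simp: R1_def I1_def)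
    show "tc PLACE (I1, R1) (20 * b + 12) ?Q"
    proof (rule tc_conseq[OF tc_PLACE[OF st1 x1 i b root]])
      fix s assume "case s of (I', R') \<Rightarrow> agree_off ({11, 13, 15, 17} \<union> {RB..<RB + n}) I1 I' \<and>
        agree_off ({2, 7} \<union> {TB..}) R1 R' \<and> (\<exists>f. fit_state cap (i + 1) a f I' R')"
      then obtain I2 R2 where s: "s = (I2, R2)" and ag: "agree_off ({11, 13, 15, 17} \<union> {RB..<RB + n}) I1 I2"
        "agree_off ({2, 7} \<union> {TB..}) R1 R2" and f: "\<exists>f. fit_state cap (i + 1) a f I2 R2" by (cases s) auto
      have "I2 19 = I 19" using agree_offD[OF ag(1), of 19] SB19 by (auto simp: I1_def)
      moreover have "agree_off ({11, 13, 15, 17, 19} \<union> {RB..<RB + n}) I I2"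
        using ag(1) by (simp add: agree_off_def I1_def)
      moreover have "agree_off ({2, 7} \<union> {TB..}) R R2"
        using ag(2) by (simp add: agree_off_def R1_def)
      ultimately show "?Q s" using f by (simp add: s)
    qed simp
  next
    assume "\<not> snd (I1, R1) 0 \<le> snd (I1, R1) 7"
    then have root: "R (TB + 1) < l (\<tau> i)" using x by (simp add: R1_def)
    have "stuck cap"
    proof (rule fit_inv_stuck[OF inv i a])
      fix j assume "j < m"
      then have "R (TB + (m + j)) \<le> R (TB + 1)" using m1 by (intro tree_ok_root[OF tree]) auto
      then show "R (TB + m + j) < l (\<tau> i)" using root by (simp add: add.assoc)
    qed
    then show "tc (Block [IConst 19 0, IAdd 11 22 23]) (I1, R1) (20 * b + 12) ?Q"
      using env by (intro tc_Block) (auto simp: agree_off_def I1_def R1_def env_def)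
  qed simp
qed simp

lemma tc_ANYFIT:
  assumes env: "env I R" and cap: "R 3 = cap" "0 \<le> cap" and b: "m \<le> 2 ^ b"
  shows "tc ANYFIT (I, R) ((n + m) * (20 * b + 34) + 10 * m + 9) (\<lambda>(I', R').
    agree_off ({11..19} \<union> {RB..<RB + n}) I I' \<and> agree_off ({0, 2, 7} \<union> {TB..}) R R' \<and>
    (I' 19 = 1 \<and> (\<exists>f. (\<forall>x<n. I' (RB + x) = int (f x)) \<and> assignment f cap) \<or> I' 19 = 0 \<and> stuck cap))"
    (is "tc _ _ _ ?Q")
proof -
  \<comment> \<open>While no parcel has failed, (n - i) + (m - a) bounds the rounds. After a failure
    the counter equals n and the loop exits, so \<open>k\<close> is left unconstrained.\<close>
  define Inv where "Inv k s = (case s of (I', R') \<Rightarrow>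
    agree_off ({11..19} \<union> {RB..<RB + n}) I I' \<and> agree_off ({0, 2, 7} \<union> {TB..}) R R' \<and>
    (I' 19 = 1 \<and> (\<exists>i a f. fit_state cap i a f I' R' \<and> k = (n - i) + (m - a)) \<or>
     I' 19 = 0 \<and> stuck cap \<and> I' 11 = int n))" for k :: nat and s
  have I22: "I 22 = int n" "I 0 = int m" "I 23 = 0" "I 6 = int TB" "I 2 = 1" using env by (auto simp: env_def)
  have RB22: "24 \<le> RB" using SB by simp
  have loop: "tc (While 22 11 (DECIDE ;; IfI 2 18 ACT JOB)) s ((n + m) * (20 * b + 34) + 1) ?Q"
    if "Inv (n + m) s" for s
  proof (rule tc_While[where Inv = Inv and N = "n + m" and tb = "20 * b + 32", OF that])
    fix k s assume A: "Inv k s" "fst s 11 < fst s 22"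
    obtain I' R' where s: "s = (I', R')" by (cases s)
    have ag: "agree_off ({11..19} \<union> {RB..<RB + n}) I I'" "agree_off ({0, 2, 7} \<union> {TB..}) R R'"
      using A(1) by (auto simp: Inv_def s)
    have "I' 22 = int n" using agree_offD[OF ag(1), of 22] RB22 I22 by auto
    then have "I' 19 = 1 \<and> (\<exists>i a f. fit_state cap i a f I' R' \<and> k = (n - i) + (m - a))"
      using A by (auto simp: Inv_def s)
    then obtain i a f where st: "fit_state cap i a f I' R'" and k: "k = (n - i) + (m - a)"
      and ok: "I' 19 = 1" by blast
    have env': "env I' R'" and i: "I' 11 = int i" and a: "I' 12 = int a" and c: "R' 3 = cap"
      and inv: "fit_inv cap i a f (\<lambda>j. R' (TB + m + j))"
      using st by (auto simp: fit_state_def)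
    have iN: "i < n" using A(2) env' i by (simp add: s env_def)
    have am: "a \<le> m" using fit_invD(2)[OF inv] .
    have "tc (DECIDE ;; IfI 2 18 ACT JOB) (I', R') (20 * b + 32) (Inv (k - 1))"
    proof (rule tc_Seq[OF tc_DECIDE[OF env' i iN a am], where ?t2.0 = "20 * b + 18"])
      fix s2 assume "case s2 of (I2, R2) \<Rightarrow> agree_off {13, 14, 15, 18} I' I2 \<and> agree_off {0, 7} R' R2 \<and>
        R2 0 = l (\<tau> i) \<and> I2 14 = int (\<tau> i) \<and>
        (I2 18 = 1 \<and> a < m \<and> l (\<tau> i) \<le> d (\<sigma> a) \<and> I2 15 = int (\<sigma> a) \<or>
         I2 18 = 0 \<and> (a = m \<or> d (\<sigma> a) < l (\<tau> i)))"
      then obtain I2 R2 where s2: "s2 = (I2, R2)" and ag2: "agree_off {13, 14, 15, 18} I' I2" "agree_off {0, 7} R' R2"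
        and r: "R2 0 = l (\<tau> i)" "I2 14 = int (\<tau> i)" and
        cs: "I2 18 = 1 \<and> a < m \<and> l (\<tau> i) \<le> d (\<sigma> a) \<and> I2 15 = int (\<sigma> a) \<or>
         I2 18 = 0 \<and> (a = m \<or> d (\<sigma> a) < l (\<tau> i))" by (cases s2) auto
      have st2: "fit_state cap i a f I2 R2"
        by (rule fit_state_agree[OF st]; rule agree_off_mono[OF ag2(1)] agree_off_mono[OF ag2(2)]) auto
      have I2: "I2 2 = 1" "I2 19 = 1"
        using agree_offD[OF ag2(1), of 19] st2 ok by (auto simp: fit_state_def env_def)
      have agI: "agree_off ({11..19} \<union> {RB..<RB + n}) I I2"
        by (rule agree_off_trans[OF ag(1) ag2(1)]) auto
      have agR: "agree_off ({0, 2, 7} \<union> {TB..}) R R2" by (rule agree_off_trans[OF ag(2) ag2(2)]) auto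
      show "tc (IfI 2 18 ACT JOB) s2 (20 * b + 18) (Inv (k - 1))"
        unfolding s2
      proof (rule tc_IfI[where t' = "20 * b + 16"])
        assume "fst (I2, R2) 2 \<le> fst (I2, R2) 18"
        then have cc: "a < m" "l (\<tau> i) \<le> d (\<sigma> a)" "I2 15 = int (\<sigma> a)" using cs I2 by auto
        show "tc ACT (I2, R2) (20 * b + 16) (Inv (k - 1))"
        proof (rule tc_conseq[OF tc_ACT[OF st2 cc iN cap(2) b]])
          fix s3 assume "case s3 of (I3, R3) \<Rightarrow> agree_off {12, 13, 15} I2 I3 \<and>
            agree_off ({2, 7} \<union> {TB..}) R2 R3 \<and> fit_state cap i (a + 1) f I3 R3"
          then obtain I3 R3 where s3: "s3 = (I3, R3)" and ag3: "agree_off {12, 13, 15} I2 I3"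
            "agree_off ({2, 7} \<union> {TB..}) R2 R3" and st3: "fit_state cap i (a + 1) f I3 R3" by (cases s3) auto
          have "I3 19 = 1" using agree_offD[OF ag3(1), of 19] I2 by simp
          moreover have "agree_off ({11..19} \<union> {RB..<RB + n}) I I3"
            by (rule agree_off_trans[OF agI ag3(1)]) auto
          moreover have "agree_off ({0, 2, 7} \<union> {TB..}) R R3" by (rule agree_off_trans[OF agR ag3(2)]) auto
          moreover have "k - 1 = n - i + (m - (a + 1))" using k cc(1) by simp
          ultimately show "Inv (k - 1) s3" unfolding Inv_def s3 prod.case using st3 by blast
        qed simp
      next
        assume "\<not> fst (I2, R2) 2 \<le> fst (I2, R2) 18"
        then have cc: "a = m \<or> d (\<sigma> a) < l (\<tau> i)" using cs I2 by auto
        show "tc JOB (I2, R2) (20 * b + 16) (Inv (k - 1))"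
        proof (rule tc_conseq[OF tc_JOB[OF st2 r iN b cc]])
          fix s3 assume "case s3 of (I3, R3) \<Rightarrow> agree_off ({11, 13, 15, 17, 19} \<union> {RB..<RB + n}) I2 I3 \<and>
            agree_off ({2, 7} \<union> {TB..}) R2 R3 \<and>
            (I3 19 = I2 19 \<and> (\<exists>f. fit_state cap (i + 1) a f I3 R3) \<or> I3 19 = 0 \<and> stuck cap \<and> I3 11 = int n)"
          then obtain I3 R3 where s3: "s3 = (I3, R3)" and
            ag3: "agree_off ({11, 13, 15, 17, 19} \<union> {RB..<RB + n}) I2 I3" "agree_off ({2, 7} \<union> {TB..}) R2 R3" and
            st3: "I3 19 = I2 19 \<and> (\<exists>f. fit_state cap (i + 1) a f I3 R3) \<or> I3 19 = 0 \<and> stuck cap \<and> I3 11 = int n"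
            by (cases s3) auto
          have "agree_off ({11..19} \<union> {RB..<RB + n}) I I3"
            by (rule agree_off_trans[OF agI ag3(1)]) auto
          moreover have "agree_off ({0, 2, 7} \<union> {TB..}) R R3" by (rule agree_off_trans[OF agR ag3(2)]) auto
          moreover have "k - 1 = n - (i + 1) + (m - a)" using k iN by simp
          ultimately show "Inv (k - 1) s3" unfolding Inv_def s3 prod.case using st3 I2(2) by metis
        qed simp
      qed simp
    qed simp
    then show "0 < k \<and> tc (DECIDE ;; IfI 2 18 ACT JOB) s (20 * b + 32) (Inv (k - 1))"
      using k iN by (simp add: s)
  next
    fix k s assume A: "Inv k s" "fst s 22 \<le> fst s 11"
    obtain I' R' where s: "s = (I', R')" by (cases s)
    have ag: "agree_off ({11..19} \<union> {RB..<RB + n}) I I'" "agree_off ({0, 2, 7} \<union> {TB..}) R R'"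
      using A(1) by (auto simp: Inv_def s)
    have I22': "I' 22 = int n" using agree_offD[OF ag(1), of 22] RB22 I22 by auto
    have "\<exists>f. (\<forall>x<n. I' (RB + x) = int (f x)) \<and> assignment f cap" if st: "fit_state cap i a f I' R'" for i a f
    proof -
      have inv: "fit_inv cap i a f (\<lambda>j. R' (TB + m + j))" using st by (simp add: fit_state_def)
      have "i = n" using A(2) I22' st fit_invD(1)[OF inv] by (simp add: s fit_state_def)
      moreover have "\<tau> ` {..<n} = {..<n}" using \<tau> by (simp add: bij_betw_def)
      ultimately show ?thesis using st fit_inv_done[OF _ cap(2), of a f] inv
        by (intro exI[of _ f]) (auto simp: fit_state_def)
    qed
    then show "?Q s" using A(1) by (auto simp: Inv_def s)
  qed auto
  show ?thesis unfolding ANYFIT_def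
  proof (rule tc_Block_Seq[where t' = "(10 * m + 4) + ((n + m) * (20 * b + 34) + 4)"],
      rule tc_Seq[where ?t1.0 = "10 * m + 4" and ?t2.0 = "(n + m) * (20 * b + 34) + 4"])
    have e: "effs [IAdd 16 0 23] (I, R) = (I(16 := int m), R)" using I22 by simp
    show "tc CLEAR (effs [IAdd 16 0 23] (I, R)) (10 * m + 4) (\<lambda>(I', R'). agree_off {11, 13, 14} (I(16 := int m)) I' \<and>
      agree_off ({7} \<union> {TB..<TB + 2 * m}) R R' \<and> (\<forall>t < 2 * m. R' (TB + t) = 0))"
      unfolding e by (rule tc_CLEAR) (use I22 TB8 in auto)
  next
    fix s assume "case s of (I', R') \<Rightarrow> agree_off {11, 13, 14} (I(16 := int m)) I' \<and>
      agree_off ({7} \<union> {TB..<TB + 2 * m}) R R' \<and> (\<forall>t < 2 * m. R' (TB + t) = 0)"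
    then obtain I2 R2 where s: "s = (I2, R2)" and ag: "agree_off {11, 13, 14} (I(16 := int m)) I2"
      "agree_off ({7} \<union> {TB..<TB + 2 * m}) R R2" and z: "\<forall>t < 2 * m. R2 (TB + t) = 0" by (cases s) auto
    let ?I = "I2(11 := 0, 12 := 0, 19 := 1)"
    have "agree_off {16} I (I(16 := int m))" "agree_off {11, 12, 13, 14, 19} (I(16 := int m)) ?I"
      using ag(1) by (simp_all add: agree_off_def)
    then have agI: "agree_off ({11..19} \<union> {RB..<RB + n}) I ?I" by (rule agree_off_trans) auto
    have agR: "agree_off ({0, 2, 7} \<union> {TB..}) R R2" by (rule agree_off_mono[OF ag(2)]) auto
    have env2: "env ?I R2"
      by (rule env_agree[OF env]; rule agree_off_mono[OF agI] agree_off_mono[OF agR]) (use TB8 in auto)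
    have zj: "R2 (TB + m + j) = 0" if "j < m" for j using z that by (simp add: add.assoc)
    have "fit_inv cap 0 0 f (\<lambda>j. R2 (TB + m + j))" for f
      by (rule fit_inv_cong[OF fit_inv_0]) (use zj in auto)
    moreover have "R2 3 = cap" using agree_offD[OF agR, of 3] TB8 cap by auto
    moreover have "?I 16 = int m" using agree_offD[OF ag(1), of 16] by simp
    ultimately have "fit_state cap 0 0 f ?I R2" for f
      using env2 tree_ok_zero[OF z] by (simp add: fit_state_def)
    then have "Inv (n + m) (?I, R2)"
      unfolding Inv_def prod.case using agI agR by fastforce
    then show "tc (Block [IConst 11 0, IConst 12 0, IConst 19 1] ;; While 22 11 (DECIDE ;; IfI 2 18 ACT JOB)) s
      ((n + m) * (20 * b + 34) + 4) ?Q"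
      by (intro tc_Block_Seq[where t' = "(n + m) * (20 * b + 34) + 1"] loop) (auto simp: s)
  qed auto
qed

end

section \<open>Bisection\<close>

context dwp_memory
begin

lemma tc_COPY:
  assumes I: "I 2 = 1" "I 9 = int RB" "I 10 = int OB" "I 22 = int n"
  shows "tc COPY (I, R) (n * 7 + 2) (\<lambda>(I', R'). R' = R \<and> agree_off ({11, 13, 14} \<union> {OB..<OB + n}) I I' \<and>
    (\<forall>x<n. I' (OB + x) = I (RB + x)))"
proof -
  define Inv where "Inv k s = (case s of (I', R') \<Rightarrow> R' = R \<and> agree_off ({11, 13, 14} \<union> {OB..<OB + n}) I I' \<and>
    (\<exists>i. I' 11 = int i \<and> i + k = n \<and> (\<forall>x<i. I' (OB + x) = I (RB + x))))" for k :: nat and s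
  let ?b = "[IAdd 13 9 11, ILoad 14 13, IAdd 13 10 11, IStore 13 14, IAdd 11 11 2]"
  show ?thesis unfolding COPY_def
  proof (rule tc_Block_Seq, rule tc_While[where Inv = Inv and N = n and tb = 5])
    show "Inv n (effs [IConst 11 0] (I, R))" by (simp add: Inv_def agree_off_def)
  next
    fix k s assume A: "Inv k s" "fst s 11 < fst s 22"
    obtain I' R' where s: "s = (I', R')" by (cases s)
    obtain i where R': "R' = R" and ag: "agree_off ({11, 13, 14} \<union> {OB..<OB + n}) I I'"
      and i: "I' 11 = int i" "i + k = n" and c: "\<And>x. x < i \<Longrightarrow> I' (OB + x) = I (RB + x)"
      using A(1) unfolding Inv_def s prod.case by blast
    have I': "I' 2 = 1" "I' 9 = int RB" "I' 10 = int OB" "I' 22 = int n"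
      using agree_offD[OF ag] I SB by auto
    have iN: "i < n" using A(2) I' i by (simp add: s)
    have rb: "I' (RB + i) = I (RB + i)" using SB iN by (intro agree_offD[OF ag]) auto
    define I2 where "I2 = I'(13 := int (OB + i), 14 := I (RB + i), OB + i := I (RB + i), 11 := int (i + 1))"
    have ne: "OB + i \<noteq> a" if "a \<le> 23" for a using SB that by auto
    have e: "effs ?b s = (I2, R')"
      using I' i(1) rb ne SB by (simp add: s I2_def int_fold fun_upd_twist del: int_unfold)
    have "agree_off ({11, 13, 14} \<union> {OB..<OB + n}) I' I2"
      using iN by (auto simp: agree_off_def I2_def)
    then have ag2: "agree_off ({11, 13, 14} \<union> {OB..<OB + n}) I I2"
      by (intro agree_off_trans[OF ag]) auto
    have "I2 (OB + x) = I (RB + x)" if "x < i + 1" for x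
      using that c[of x] ne[of 11] SB by (cases "x = i") (auto simp: I2_def)
    moreover have "I2 11 = int (i + 1)" by (simp add: I2_def)
    moreover have "i + 1 + (k - 1) = n" using i iN by simp
    ultimately have "Inv (k - 1) (I2, R')"
      unfolding Inv_def prod.case using R' ag2 by blast
    then show "0 < k \<and> tc (Block ?b) s 5 (Inv (k - 1))"
      using i iN by (auto intro!: tc_Block simp only: e) auto
  next
    fix k s assume A: "Inv k s" "fst s 22 \<le> fst s 11"
    obtain I' R' where s: "s = (I', R')" by (cases s)
    have "agree_off ({11, 13, 14} \<union> {OB..<OB + n}) I I'" using A(1) by (simp add: Inv_def s)
    then have "I' 22 = int n" using I SB by (auto dest: agree_offD[of _ _ _ 22])
    then show "case s of (I', R') \<Rightarrow> R' = R \<and> agree_off ({11, 13, 14} \<union> {OB..<OB + n}) I I' \<and>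
      (\<forall>x<n. I' (OB + x) = I (RB + x))"
      using A by (auto simp: Inv_def s)
  qed auto
qed

text \<open>The optimum is confined to an interval with upper end \<open>R 5\<close> and half-length
  \<open>R 4\<close>; the midpoint is tested next. The lower end is below every delivery time and
  nonnegative, and the upper end is backed by the stored assignment. Initially no assignment exists;
  the interval is then [0, 2 U], so that the first midpoint is \<open>U\<close>.\<close>

definition bisect_inv :: "real \<Rightarrow> real \<Rightarrow> nat \<Rightarrow> nat \<Rightarrow> (nat \<Rightarrow> int) \<Rightarrow> (nat \<Rightarrow> real) \<Rightarrow> bool" where
  "bisect_inv U \<epsilon> K k I R \<longleftrightarrow> env I R \<and> R 6 = golden_ratio - \<epsilon> \<and> I 20 = int k \<and> k \<le> K \<and>
     R 4 = U / 2 ^ (K - k) \<and> 2 * R 4 \<le> R 5 \<and>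
     (\<forall>g. valid_schedule m n l d g \<longrightarrow> R 5 - 2 * R 4 \<le> delivery_time m l v g) \<and>
     (k = K \<and> R 5 = 2 * U \<or>
      (\<exists>f. (\<forall>x<n. I (OB + x) = int (f x)) \<and> assignment f ((golden_ratio - \<epsilon>) * R 5)))"

lemma tc_BISECT:
  assumes inv: "bisect_inv U \<epsilon> K k I R" and k: "0 < k" and U: "crude_bound U" "0 \<le> U" and b: "m \<le> 2 ^ b"
    and eps: "0 \<le> \<epsilon>" "8 * (\<epsilon> * m) \<le> 1" "\<epsilon> \<le> 1 / 8"
  shows "tc BISECT (I, R) ((n + m) * (20 * b + 51) + 19) (\<lambda>(I', R'). bisect_inv U \<epsilon> K (k - 1) I' R')"
    (is "tc _ _ _ ?Q")
proof -
  let ?\<rho> = "golden_ratio - \<epsilon>"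
  have env: "env I R" and R6: "R 6 = ?\<rho>" and I20: "I 20 = int k" "k \<le> K" and R4: "R 4 = U / 2 ^ (K - k)"
    and hs: "2 * R 4 \<le> R 5"
    and lo: "\<And>g. valid_schedule m n l d g \<Longrightarrow> R 5 - 2 * R 4 \<le> delivery_time m l v g"
    and sol: "k = K \<and> R 5 = 2 * U \<or> (\<exists>f. (\<forall>x<n. I (OB + x) = int (f x)) \<and> assignment f (?\<rho> * R 5))"
    using inv unfolding bisect_inv_def by blast+
  define T where "T = R 5 - R 4"
  define cap where "cap = ?\<rho> * T"
  have rho: "1 \<le> ?\<rho>" using golden_ratio_bounds eps by simp
  have R40: "0 \<le> R 4" using R4 U(2) by simp
  then have T0: "0 \<le> T" using hs by (simp add: T_def)
  have cap0: "0 \<le> cap" using rho T0 by (simp add: cap_def)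
  have half: "R 4 / 2 = U / 2 ^ (K - (k - 1))"
  proof -
    have "K - (k - 1) = Suc (K - k)" using k I20(2) by simp
    then show ?thesis using R4 by (simp add: field_simps)
  qed
  define R1 where "R1 = R(7 := T, 3 := cap)"
  have e1: "effs [RSub 7 5 4, RMul 3 6 7] (I, R) = (I, R1)"
    by (simp add: R1_def T_def cap_def R6)
  have env1: "env I R1" by (rule env_agree[OF env]) (auto simp: agree_off_def R1_def)
  have R13: "R1 3 = cap" by (simp add: R1_def)
  have last: "tc (Block [RConst 7 2, RDiv 4 4 7, ISub 20 20 2]) (I', R') 3 ?Q"
    if env': "env I' R'" and r: "R' 6 = ?\<rho>" "R' 4 = R 4" "I' 20 = int k" "R 4 \<le> R' 5"
      and lo': "\<And>g. valid_schedule m n l d g \<Longrightarrow> R' 5 - R 4 \<le> delivery_time m l v g"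
      and sol': "\<exists>f. (\<forall>x<n. I' (OB + x) = int (f x)) \<and> assignment f (?\<rho> * R' 5)" for I' R'
  proof (rule tc_Block)
    have I2: "I' 2 = 1" using env' by (simp add: env_def)
    have e: "effs [RConst 7 2, RDiv 4 4 7, ISub 20 20 2] (I', R')
      = (I'(20 := int (k - 1)), R'(7 := 2, 4 := R 4 / 2))" using r I2 k by (simp add: of_nat_diff)
    have "env (I'(20 := int (k - 1))) (R'(7 := 2, 4 := R 4 / 2))"
      by (rule env_agree[OF env']) (auto simp: agree_off_def)
    moreover have "(I'(20 := int (k - 1))) (OB + x) = I' (OB + x)" for x using SB by simp
    ultimately show "?Q (effs [RConst 7 2, RDiv 4 4 7, ISub 20 20 2] (I', R'))"
      unfolding e prod.case bisect_inv_def using r(1,4) lo' sol' I20(2)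
      by (intro conjI; (simp only: half[symmetric])?; simp)
  qed simp
  show ?thesis unfolding BISECT_def
  proof (rule tc_Block_Seq[where t' = "((n + m) * (20 * b + 34) + 10 * m + 9) + (n * 7 + 8)"], unfold e1,
      rule tc_Seq[OF tc_ANYFIT[OF env1 R13 cap0 b], where ?t2.0 = "n * 7 + 8"])
    fix s assume "case s of (I', R') \<Rightarrow>
      agree_off ({11..19} \<union> {RB..<RB + n}) I I' \<and> agree_off ({0, 2, 7} \<union> {TB..}) R1 R' \<and>
      (I' 19 = 1 \<and> (\<exists>f. (\<forall>x<n. I' (RB + x) = int (f x)) \<and> assignment f cap) \<or> I' 19 = 0 \<and> stuck cap)"
    then obtain I2 R2 where s: "s = (I2, R2)" and ag: "agree_off ({11..19} \<union> {RB..<RB + n}) I I2"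
      "agree_off ({0, 2, 7} \<union> {TB..}) R1 R2" and
      res: "I2 19 = 1 \<and> (\<exists>f. (\<forall>x<n. I2 (RB + x) = int (f x)) \<and> assignment f cap) \<or> I2 19 = 0 \<and> stuck cap"
      by (cases s) auto
    have env2: "env I2 R2"
      by (rule env_agree[OF env1]; rule agree_off_mono[OF ag(1)] agree_off_mono[OF ag(2)]) (use TB8 in auto)
    have R2: "R2 6 = ?\<rho>" "R2 4 = R 4" "R2 5 = R 5" "I2 20 = int k" "I2 2 = 1"
      using agree_offD[OF ag(2)] agree_offD[OF ag(1), of 20] TB8 SB R6 I20 env2
      by (auto simp: R1_def env_def)
    have OBs: "I2 (OB + x) = I (OB + x)" if "x < n" for x
      using SB that by (intro agree_offD[OF ag(1)]) auto
    let ?P = "\<lambda>(I', R'). env I' R' \<and> R' 6 = ?\<rho> \<and> R' 4 = R 4 \<and> I' 20 = int k \<and> R 4 \<le> R' 5 \<and>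
      (\<forall>g. valid_schedule m n l d g \<longrightarrow> R' 5 - R 4 \<le> delivery_time m l v g) \<and>
      (\<exists>f. (\<forall>x<n. I' (OB + x) = int (f x)) \<and> assignment f (?\<rho> * R' 5))"
    have "tc (IfI 2 19 (Block [RSub 5 5 4] ;; COPY) (Block [])) (I2, R2) (n * 7 + 5) ?P"
    proof (rule tc_IfI[where t' = "n * 7 + 3"])
      assume "fst (I2, R2) 2 \<le> fst (I2, R2) 19"
      then obtain f where f: "\<And>x. x < n \<Longrightarrow> I2 (RB + x) = int (f x)" "assignment f cap"
        using res R2 by auto
      have e2: "effs [RSub 5 5 4] (I2, R2) = (I2, R2(5 := T))" using R2 by (simp add: T_def)
      have I2: "I2 2 = 1" "I2 9 = int RB" "I2 10 = int OB" "I2 22 = int n" using env2 by (auto simp: env_def)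
      show "tc (Block [RSub 5 5 4] ;; COPY) (I2, R2) (n * 7 + 3) ?P"
      proof (rule tc_Block_Seq[where t' = "n * 7 + 2"], unfold e2, rule tc_conseq[OF tc_COPY[OF I2]])
        fix s3 assume "case s3 of (I', R') \<Rightarrow> R' = R2(5 := T) \<and> agree_off ({11, 13, 14} \<union> {OB..<OB + n}) I2 I' \<and>
          (\<forall>x<n. I' (OB + x) = I2 (RB + x))"
        then obtain I3 where s3: "s3 = (I3, R2(5 := T))" and ag3: "agree_off ({11, 13, 14} \<union> {OB..<OB + n}) I2 I3"
          and c3: "\<And>x. x < n \<Longrightarrow> I3 (OB + x) = I2 (RB + x)" by (cases s3) auto
        have env3: "env I3 (R2(5 := T))"
        proof (rule env_agree[OF env2])
          show "agree_off ({11..21} \<union> {RB..}) I2 I3" by (rule agree_off_mono[OF ag3]) (use SB in auto)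
        qed (auto simp: agree_off_def)
        have "I3 20 = int k" using agree_offD[OF ag3, of 20] SB R2 by auto
        moreover have "\<exists>f. (\<forall>x<n. I3 (OB + x) = int (f x)) \<and> assignment f (?\<rho> * T)"
          using c3 f by (intro exI[of _ f]) (auto simp: cap_def)
        moreover have "T - R 4 \<le> delivery_time m l v g" if "valid_schedule m n l d g" for g
          using lo[OF that] by (simp add: T_def)
        ultimately show "?P s3" using env3 R2 hs by (simp add: s3 T_def)
      qed simp_all
    next
      assume "\<not> fst (I2, R2) 2 \<le> fst (I2, R2) 19"
      then have st: "stuck cap" using res R2 by auto
      have lo': "T \<le> delivery_time m l v g" if "valid_schedule m n l d g" for g
        using stuck_lower_bound[OF st[unfolded cap_def] eps that] by simp
      \<comment> \<open>The first guess is \<open>U\<close>, where any-fit cannot fail. So whenever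
        a guess fails, an earlier round has already stored an assignment for the upper end.\<close>
      have "\<not> (k = K \<and> R 5 = 2 * U)"
      proof
        assume "k = K \<and> R 5 = 2 * U"
        then have "T = U" using R4 by (simp add: T_def)
        then have "U \<le> cap" using rho U(2) mult_right_mono[of 1 ?\<rho> U] by (simp add: cap_def)
        then show False using not_stuck[of U cap] st U(1) by (auto simp: crude_bound_def)
      qed
      then have "\<exists>f. (\<forall>x<n. I (OB + x) = int (f x)) \<and> assignment f (?\<rho> * R 5)" using sol by blast
      then have "?P (I2, R2)" using env2 R2 hs R40 lo' OBs by (simp add: T_def)
      then show "tc (Block []) (I2, R2) (n * 7 + 3) ?P" by (intro tc_Block) simp_all
    qed simp
    then show "tc (IfI 2 19 (Block [RSub 5 5 4] ;; COPY) (Block []) ;;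
      Block [RConst 7 2, RDiv 4 4 7, ISub 20 20 2]) s (n * 7 + 8) ?Q"
      unfolding s
    proof (rule tc_Seq[where ?t2.0 = 3])
      fix s' assume P: "?P s'"
      obtain I' R' where s': "s' = (I', R')" by (cases s')
      show "tc (Block [RConst 7 2, RDiv 4 4 7, ISub 20 20 2]) s' 3 ?Q"
        unfolding s' by (rule last) (use P in \<open>auto simp: s'\<close>)
    qed simp
  qed (simp_all add: algebra_simps)
qed

lemma crude_bound_pos:
  assumes "crude_bound U"
  shows "0 < U"
proof -
  have n0: "0 < n" using n1 by simp
  obtain j where j: "j < m" "(\<Sum>i'<Suc 0. l (\<tau> i')) \<le> U * v j"
    using assms n0 unfolding crude_bound_def by blast
  then have "0 < U * v j" using l_pos[OF \<tau>_less[OF n0]] by simp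
  then show ?thesis using v_pos[OF j(1)] by (simp add: zero_less_mult_iff)
qed

lemma tc_PRECISION:
  assumes env: "env I R" and p: "m < 2 ^ p" "2 ^ p \<le> 2 * m"
  shows "tc PRECISION (I, R) (5 * p + 9) (\<lambda>(I', R').
    bisect_inv (R 4) (1 / (8 * 2 ^ p)) (5 + 2 * p) (5 + 2 * p) I' R')"
proof -
  define Inv where "Inv k s = (case s of (I', R') \<Rightarrow> agree_off {13, 14, 20} I I' \<and> agree_off {6, 7} R R' \<and>
    R' 7 = 2 \<and> I' 13 = 2 \<and> (\<exists>q. q + k = p \<and> I' 14 = int (m div 2 ^ q) \<and> R' 6 = 1 / (8 * 2 ^ q) \<and> I' 20 = int (5 + 2 * q)))"
    for k :: nat and s
  have I: "I 0 = int m" "I 23 = 0" using env by (auto simp: env_def)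
  let ?P = "\<lambda>(I', R'). agree_off {13, 14, 20} I I' \<and> agree_off {6, 7} R R' \<and>
    R' 6 = 1 / (8 * 2 ^ p) \<and> I' 20 = int (5 + 2 * p)"
  let ?Q = "\<lambda>(I', R'). bisect_inv (R 4) (1 / (8 * 2 ^ p)) (5 + 2 * p) (5 + 2 * p) I' R'"
  show ?thesis
    unfolding PRECISION_def
  proof (rule tc_Block_Seq[where t' = "5 * p + 4"], rule tc_Seq[where ?t1.0 = "p * (3 + 2) + 1" and ?t2.0 = 3 and P = ?P],
      rule tc_While[where Inv = Inv and N = p and tb = 3])
    show "Inv p (effs [RConst 6 (1 / 8), RConst 7 2, IAdd 14 0 23, IConst 20 5, IConst 13 2] (I, R))"
      using I by (auto simp: Inv_def agree_off_def)
  next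
    fix k s assume A: "Inv k s" "fst s 23 < fst s 14"
    obtain I' R' where s: "s = (I', R')" by (cases s)
    obtain q where ag: "agree_off {13, 14, 20} I I'" "agree_off {6, 7} R R'" and r: "R' 7 = 2" "I' 13 = 2"
      and q: "q + k = p" "I' 14 = int (m div 2 ^ q)" "R' 6 = 1 / (8 * 2 ^ q)" "I' 20 = int (5 + 2 * q)"
      using A(1) unfolding Inv_def s prod.case by blast
    have "I' 23 = 0" using agree_offD[OF ag(1), of 23] I by auto
    then have "0 < m div 2 ^ q" using A(2) q(2) by (simp add: s)
    then have "2 ^ q \<le> m" by (simp add: div_greater_zero_iff)
    then have "q < p" using p(1) by (metis le_less_trans nat_power_less_imp_less zero_less_numeral)
    then have k: "0 < k" using q by simp
    have "m div 2 ^ q div 2 = m div 2 ^ (q + 1)" by (simp add: div_mult2_eq mult.commute[of 2])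
    then have h: "int (m div 2 ^ q) div 2 = int (m div 2 ^ (q + 1))" by (metis of_nat_numeral zdiv_int)
    have e: "effs [IHalf 14 14, RDiv 6 6 7, IAdd 20 20 13] s =
      (I'(14 := int (m div 2 ^ (q + 1)), 20 := int (5 + 2 * (q + 1))), R'(6 := 1 / (8 * 2 ^ (q + 1))))"
      using q r h by (simp add: s fun_upd_twist)
    have "Inv (k - 1) (effs [IHalf 14 14, RDiv 6 6 7, IAdd 20 20 13] s)"
      unfolding e Inv_def prod.case using ag r q k
      by (intro conjI exI[of _ "q + 1"]) (simp_all add: agree_off_def)
    then show "0 < k \<and> tc (Block [IHalf 14 14, RDiv 6 6 7, IAdd 20 20 13]) s 3 (Inv (k - 1))"
      using k by (auto intro!: tc_Block)
  next
    fix k s assume A: "Inv k s" "fst s 14 \<le> fst s 23"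
    obtain I' R' where s: "s = (I', R')" by (cases s)
    obtain q where ag: "agree_off {13, 14, 20} I I'" "agree_off {6, 7} R R'" and r: "R' 7 = 2" "I' 13 = 2"
      and q: "q + k = p" "I' 14 = int (m div 2 ^ q)" "R' 6 = 1 / (8 * 2 ^ q)" "I' 20 = int (5 + 2 * q)"
      using A(1) unfolding Inv_def s prod.case by blast
    have "I' 23 = 0" using agree_offD[OF ag(1), of 23] I by auto
    then have "m div 2 ^ q = 0" using A(2) q(2) by (simp add: s)
    then have "m < 2 ^ q" by (simp add: div_eq_0_iff)
    \<comment> \<open>The two bounds on \<open>2 ^ p\<close> leave only one exponent, so the loop
      cannot stop before p rounds.\<close>
    moreover have "2 * m < 2 ^ p" if "q < p"
    proof -
      have "2 * 2 ^ q \<le> (2 :: nat) ^ p" using that power_increasing[of "Suc q" p "2 :: nat"] by simp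
      then show ?thesis using \<open>m < 2 ^ q\<close> by linarith
    qed
    ultimately have "q = p" using p(2) q(1) by fastforce
    then show "?P s" using ag q by (simp add: s)
  next
    fix s assume A: "?P s"
    obtain I' R' where s: "s = (I', R')" by (cases s)
    have ag: "agree_off {13, 14, 20} I I'" "agree_off {6, 7} R R'" and
      r: "R' 6 = 1 / (8 * 2 ^ p)" "I' 20 = int (5 + 2 * p)" using A by (auto simp: s)
    define R2 where "R2 = R'(7 := golden_ratio, 6 := golden_ratio - 1 / (8 * 2 ^ p), 5 := 2 * R 4)"
    have R4: "R' 4 = R 4" using agree_offD[OF ag(2), of 4] by simp
    have e: "effs [RConst 7 golden_ratio, RSub 6 7 6, RAdd 5 4 4] s = (I', R2)"
      using r R4 by (simp add: s R2_def)
    have "env I' R2"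
      by (rule env_agree[OF env]; (rule agree_off_mono[OF ag(1)])?)
        (use agree_off_mono[OF ag(2), of "{..<8} \<union> {TB..}"] in \<open>auto simp: agree_off_def R2_def\<close>)
    then have "bisect_inv (R 4) (1 / (8 * 2 ^ p)) (5 + 2 * p) (5 + 2 * p) I' R2"
      unfolding bisect_inv_def using r R4 delivery_time_nonneg by (simp add: R2_def)
    then show "tc (Block [RConst 7 golden_ratio, RSub 6 7 6, RAdd 5 4 4]) s 3 ?Q"
      by (intro tc_Block) (simp_all add: e del: effs.simps)
  qed auto
qed

text \<open>Write Q = 2^p and D for the delivery time. After 5 + 2 p halvings the interval has
  length 2 U / (32 Q^2). Since U \<le> m D \<le> Q D, this is at most D / (16 Q) = (e/2) D with e =
  1/(8 Q), and (\<phi> - e)(1 + e/2) \<le> \<phi>.\<close>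

lemma final_ratio:
  assumes p: "m < 2 ^ p" and inv: "bisect_inv U (1 / (8 * 2 ^ p)) (5 + 2 * p) 0 I R" and U: "crude_bound U"
    and g: "valid_schedule m n l d g"
  shows "(golden_ratio - 1 / (8 * 2 ^ p)) * R 5 \<le> golden_ratio * delivery_time m l v g"
proof -
  let ?D = "delivery_time m l v g"
  define Q :: real where "Q = 2 ^ p"
  define e where "e = 1 / (8 * Q)"
  have "real m < Q" unfolding Q_def using p by (metis of_nat_less_iff of_nat_numeral of_nat_power)
  then have Q: "0 < Q" "real m \<le> Q" "1 \<le> Q" by (auto simp: Q_def)
  have "e \<le> 1 / 8" using Q by (simp add: e_def field_simps)
  have e0: "0 < e" using Q by (simp add: e_def)
  have D0: "0 \<le> ?D" using delivery_time_nonneg[OF g] .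
  have "U \<le> m * ?D" using U g by (auto simp: crude_bound_def)
  also have "\<dots> \<le> Q * ?D" using Q D0 by (intro mult_right_mono)
  finally have UQ: "U \<le> Q * ?D" .
  have "R 5 - 2 * R 4 \<le> ?D" "R 4 = U / 2 ^ (5 + 2 * p)" using inv g by (auto simp: bisect_inv_def)
  moreover have "(2 :: real) ^ (5 + 2 * p) = 32 * (Q * Q)"
  proof -
    have "(2 :: real) ^ (5 + 2 * p) = 2 ^ 5 * (2 ^ p) ^ 2" by (metis power_add power_mult mult.commute)
    then show ?thesis by (simp add: Q_def power2_eq_square)
  qed
  ultimately have "R 5 \<le> ?D + U / (16 * (Q * Q))" by simp
  also have "U / (16 * (Q * Q)) \<le> Q * ?D / (16 * (Q * Q))" using UQ Q by (intro divide_right_mono) auto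
  also have "\<dots> = e / 2 * ?D" using Q by (simp add: e_def field_simps)
  finally have "R 5 \<le> (1 + e / 2) * ?D" by (simp add: algebra_simps)
  then have "(golden_ratio - e) * R 5 \<le> (golden_ratio - e) * ((1 + e / 2) * ?D)"
    using golden_ratio_bounds \<open>e \<le> 1 / 8\<close> by (intro mult_left_mono) auto
  also have "\<dots> = ((golden_ratio - e) * (1 + e / 2)) * ?D" by simp
  also have "\<dots> \<le> golden_ratio * ?D"
  proof (intro mult_right_mono D0)
    have "golden_ratio * e \<le> 2 * e" using golden_ratio_bounds e0 by (intro mult_right_mono) auto
    moreover have "(golden_ratio - e) * (1 + e / 2) = golden_ratio + golden_ratio * e / 2 - e - e * e / 2"
      by (simp add: field_simps)
    moreover have "0 \<le> e * e" by simp
    ultimately show "(golden_ratio - e) * (1 + e / 2) \<le> golden_ratio" by linarith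
  qed
  finally show ?thesis by (simp add: e_def Q_def)
qed

end

section \<open>Input, output and the complete program\<close>

definition reloc :: "nat \<Rightarrow> instr list" where
  "reloc c = concat (map (\<lambda>k. [RStore 13 k, IAdd 13 13 2]) [0..<c])"

text \<open>Addresses 0 and 1 lie below the output area, so they can hold the pointer and the
  increment while registers 2 to 23 are overwritten.\<close>

definition final_loads :: "nat \<Rightarrow> instr list" where
  "final_loads c = concat (map (\<lambda>k. [ILoad (k + 2) 0, IAdd 0 0 1]) [0..<c])"

text \<open>The input occupies the low real addresses and the output the low integer addresses. Hence the
  input is first moved away, starting with the addresses that serve as real registers, and the
  integer registers 2 to 23 are overwritten only by the straight-line code at the very end.\<close>

definition SETUP :: com where
  "SETUP = Block [IConst 2 1, IAdd 22 1 23, IAdd 14 0 0, IAdd 14 14 22, IConst 11 8, IAdd 3 14 11,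
       IAdd 4 3 0, IAdd 5 4 0, IAdd 6 5 22, IConst 7 24, IAdd 8 7 0, IAdd 9 8 22, IAdd 10 9 22, IAdd 13 3 23] ;;
     Block (reloc 8) ;;
     While 14 11 (Block [RLoad 0 11, RStore 13 0, IAdd 13 13 2, IAdd 11 11 2])"

text \<open>Parcels 0 to 21 have the output addresses 2 to 23, which are still in use as registers;
  hence the loop starts with parcel 22 at address 24. If there are fewer parcels, the surplus final
  loads fill only cells that \<open>dwp_output\<close> does not read.\<close>

definition OUTPUT :: com where
  "OUTPUT = Block [IConst 11 22, IConst 12 24] ;;
     While 22 11 (Block [IAdd 13 10 11, ILoad 14 13, IStore 12 14, IAdd 11 11 2, IAdd 12 12 2]) ;;
     Block [IAdd 0 10 23, IConst 1 1] ;; Block (final_loads 22)"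

definition MAIN :: com where
  "MAIN = SETUP ;;
     Block [IAdd 16 0 23, IAdd 20 4 23, IAdd 21 7 23] ;; SORT ;;
     Block [IAdd 16 22 23, IAdd 20 5 23, IAdd 21 8 23] ;; SORT ;;
     BOUND ;; PRECISION ;; While 20 23 BISECT ;; OUTPUT"

lemma well_formed_MAIN: "well_formed MAIN"
proof -
  have "list_all plain (reloc c)" "list_all plain (final_loads c)" for c
    by (auto simp: reloc_def final_loads_def list_all_iff)
  then show ?thesis
    by (simp add: MAIN_def SETUP_def OUTPUT_def SORT_def CLEAR_def LEAF_def SELECT_def UPDATE_def WALK_def
        BOUND_def BOUND_ACT_def BOUND_JOB_def DECIDE_def PRECISION_def BISECT_def ANYFIT_def COPY_def
        ACT_def JOB_def PLACE_def)
qed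

lemma effs_reloc:
  assumes "I 13 = int B" "I 2 = 1" "c \<le> B"
  shows "effs (reloc c) (I, R) = (I(13 := int (B + c)), \<lambda>a. if B \<le> a \<and> a < B + c then R (a - B) else R a)"
  using assms(3)
proof (induction c)
  case 0
  then show ?case using assms(1) by (auto simp: reloc_def)
next
  case (Suc c)
  have "reloc (Suc c) = reloc c @ [RStore 13 c, IAdd 13 13 2]" by (simp add: reloc_def)
  then show ?case using Suc assms(2)
    by (auto simp: effs_append fun_eq_iff int_fold simp del: int_unfold)
qed

lemma effs_final_loads:
  assumes "I 0 = int B" "I (Suc 0) = 1" "c + 2 \<le> B"
  shows "\<exists>I'. effs (final_loads c) (I, R) = (I', R) \<and> I' 0 = int (B + c) \<and> I' (Suc 0) = 1 \<and>
    (\<forall>k<c. I' (k + 2) = I (B + k)) \<and> (\<forall>a\<ge>c + 2. I' a = I a)"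
  using assms(3)
proof (induction c)
  case 0
  then show ?case using assms by (simp add: final_loads_def)
next
  case (Suc c)
  then obtain I' where I': "effs (final_loads c) (I, R) = (I', R)" "I' 0 = int (B + c)" "I' (Suc 0) = 1"
    "\<And>k. k < c \<Longrightarrow> I' (k + 2) = I (B + k)" "\<And>a. a \<ge> c + 2 \<Longrightarrow> I' a = I a" by auto
  define I2 where "I2 = I'(c + 2 := I (B + c), 0 := int (B + Suc c))"
  have "final_loads (Suc c) = final_loads c @ [ILoad (c + 2) 0, IAdd 0 0 1]" by (simp add: final_loads_def)
  then have "effs (final_loads (Suc c)) (I, R) = (I2, R)"
    using I'(1-3) I'(5)[of "B + c"] Suc.prems by (simp add: effs_append I2_def int_fold del: int_unfold)
  moreover have "I2 (k + 2) = I (B + k)" if "k < Suc c" for k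
    using that I'(4)[of k] by (cases "k = c") (auto simp: I2_def)
  moreover have "I2 a = I a" if "a \<ge> Suc c + 2" for a using that I'(5)[of a] by (auto simp: I2_def)
  moreover have "I2 0 = int (B + Suc c)" "I2 (Suc 0) = 1" using I' by (auto simp: I2_def)
  ultimately show ?case by blast
qed

text \<open>\<open>n + 24 \<le> B\<close> separates the stored assignment from the output addresses,
  so nothing is overwritten before it is read.\<close>

lemma tc_OUTPUT:
  assumes I: "I 2 = 1" "I 10 = int B" "I 22 = int n" "I 23 = 0" and B: "n + 24 \<le> B"
  shows "tc OUTPUT (I, R) (n * 7 + 49) (\<lambda>(I', R'). \<forall>x<n. I' (2 + x) = I (B + x))"
proof -
  define Inv where "Inv k s = (case s of (I', R') \<Rightarrow> agree_off ({11, 12, 13, 14} \<union> {24..<n + 2}) I I' \<and>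
    (\<exists>i. I' 11 = int i \<and> I' 12 = int (i + 2) \<and> 22 \<le> i \<and> n - i = k \<and> (\<forall>x<i. 22 \<le> x \<longrightarrow> I' (2 + x) = I (B + x))))"
    for k :: nat and s :: state
  let ?P = "\<lambda>(I', R' :: nat \<Rightarrow> real). agree_off ({11, 12, 13, 14} \<union> {24..<n + 2}) I I' \<and>
    (\<forall>x<n. 22 \<le> x \<longrightarrow> I' (2 + x) = I (B + x))"
  let ?b = "[IAdd 13 10 11, ILoad 14 13, IStore 12 14, IAdd 11 11 2, IAdd 12 12 2]"
  show ?thesis unfolding OUTPUT_def
  proof (rule tc_Block_Seq[where t' = "n * 7 + 47"], rule tc_Seq[where ?t1.0 = "n * 7 + 1" and ?t2.0 = 46 and P = ?P],
      rule tc_While[where Inv = Inv and N = "n - 22" and tb = 5])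
    show "Inv (n - 22) (effs [IConst 11 22, IConst 12 24] (I, R))"
      by (auto simp: Inv_def agree_off_def intro!: exI[of _ "22 :: nat"])
  next
    fix k s assume A: "Inv k s" "fst s 11 < fst s 22"
    obtain I' R' where s: "s = (I', R')" by (cases s)
    obtain i where ag: "agree_off ({11, 12, 13, 14} \<union> {24..<n + 2}) I I'"
      and i: "I' 11 = int i" "I' 12 = int (i + 2)" "22 \<le> i" "n - i = k"
      and c: "\<And>x. x < i \<Longrightarrow> 22 \<le> x \<Longrightarrow> I' (2 + x) = I (B + x)"
      using A(1) unfolding Inv_def s prod.case by blast
    have I': "I' 2 = 1" "I' 10 = int B" "I' 22 = int n" using agree_offD[OF ag] I by auto
    have iN: "i < n" using A(2) I' i by (simp add: s)
    have Bi: "I' (B + i) = I (B + i)" using B by (intro agree_offD[OF ag]) auto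
    define I2 where "I2 = I'(13 := int (B + i), 14 := I (B + i), 11 := int (i + 1), i + 2 := I (B + i), 12 := int (i + 2 + 1))"
    have e: "effs ?b s = (I2, R')"
      using I' i(1-3) Bi B by (simp add: s I2_def int_fold fun_upd_twist del: int_unfold)
    have "agree_off ({11, 12, 13, 14} \<union> {24..<n + 2}) I' I2"
      using i(3) iN by (auto simp: agree_off_def I2_def)
    then have ag2: "agree_off ({11, 12, 13, 14} \<union> {24..<n + 2}) I I2"
      by (intro agree_off_trans[OF ag]) auto
    have "I2 (2 + x) = I (B + x)" if "x < i + 1" "22 \<le> x" for x
      using that c[of x] i(3) by (cases "x = i") (auto simp: I2_def)
    moreover have "I2 11 = int (i + 1)" "I2 12 = int (i + 1 + 2)" using i(3) by (auto simp: I2_def)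
    moreover have "22 \<le> i + 1" "n - (i + 1) = k - 1" using i by auto
    ultimately have "Inv (k - 1) (I2, R')" unfolding Inv_def prod.case using ag2 by blast
    then show "0 < k \<and> tc (Block ?b) s 5 (Inv (k - 1))"
      using i iN by (auto intro!: tc_Block simp only: e) auto
  next
    fix k s assume A: "Inv k s" "fst s 22 \<le> fst s 11"
    obtain I' R' where s: "s = (I', R')" by (cases s)
    have "agree_off ({11, 12, 13, 14} \<union> {24..<n + 2}) I I'" using A(1) by (simp add: Inv_def s)
    then have "I' 22 = int n" using I agree_offD[of _ I I' 22] by auto
    then show "?P s" using A by (auto simp: Inv_def s)
  next
    fix s :: state assume P: "?P s"
    obtain I' R' where s: "s = (I', R')" by (cases s)
    have ag: "agree_off ({11, 12, 13, 14} \<union> {24..<n + 2}) I I'"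
      and c: "\<And>x. x < n \<Longrightarrow> 22 \<le> x \<Longrightarrow> I' (2 + x) = I (B + x)" using P by (auto simp: s)
    define I2 where "I2 = I'(0 := int B, Suc 0 := 1)"
    have e: "effs [IAdd 0 10 23, IConst 1 1] s = (I2, R')"
      using agree_offD[OF ag, of 10] agree_offD[OF ag, of 23] I by (simp add: s I2_def)
    obtain I3 where I3: "effs (final_loads 22) (I2, R') = (I3, R')"
      "\<And>k. k < 22 \<Longrightarrow> I3 (k + 2) = I2 (B + k)" "\<And>a. 24 \<le> a \<Longrightarrow> I3 a = I2 a"
      using effs_final_loads[of I2 B 22 R'] B by (auto simp: I2_def)
    have B2: "I2 (B + x) = I (B + x)" for x
      using agree_offD[OF ag, of "B + x"] B by (auto simp: I2_def)
    have "I3 (2 + x) = I (B + x)" if "x < n" for x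
    proof (cases "x < 22")
      case True
      then show ?thesis using I3(2)[of x] B2[of x] by (simp add: add.commute)
    next
      case False
      then have "I3 (2 + x) = I' (2 + x)" using I3(3)[of "2 + x"] by (simp add: I2_def)
      then show ?thesis using c[of x] that False by simp
    qed
    moreover have "length (final_loads 22) = 44" by (simp add: final_loads_def length_concat sum_list_triv o_def)
    ultimately show "tc (Block [IAdd 0 10 23, IConst 1 1] ;; Block (final_loads 22)) s 46
      (\<lambda>(I', R'). \<forall>x<n. I' (2 + x) = I (B + x))"
      by (intro tc_Block_Seq[where t' = 44] tc_Block) (simp_all only: e I3(1) prod.case, simp_all)
  qed auto
qed

text \<open>The target begins 8 cells behind the input of size 2 m + n, so no input cell is
  overwritten before it is copied and the target avoids the real registers. For an input of fewer
  than 8 cells the surplus copies land at or above the tree base.\<close>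

lemma tc_SETUP:
  fixes m n :: nat
  assumes I: "I 0 = int m" "I (Suc 0) = int n" "\<And>a. 2 \<le> a \<Longrightarrow> I a = 0"
  shows "tc SETUP (I, R) ((2 * m + n) * 6 + 31) (\<lambda>(I', R').
    I' 0 = int m \<and> I' 2 = 1 \<and> I' 3 = int (2 * m + n + 8) \<and> I' 4 = int (2 * m + n + 8 + m) \<and>
    I' 5 = int (2 * m + n + 8 + 2 * m) \<and> I' 6 = int (2 * m + n + 8 + 2 * m + n) \<and>
    I' 7 = int 24 \<and> I' 8 = int (24 + m) \<and> I' 9 = int (24 + m + n) \<and> I' 10 = int (24 + m + 2 * n) \<and>
    I' 22 = int n \<and> I' 23 = 0 \<and> (\<forall>k < 2 * m + n. R' (2 * m + n + 8 + k) = R k))"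
    (is "tc _ _ _ ?Q")
proof -
  define W where "W = 2 * m + n"
  define B where "B = W + 8"
  let ?init = "[IConst 2 1, IAdd 22 1 23, IAdd 14 0 0, IAdd 14 14 22, IConst 11 8, IAdd 3 14 11,
       IAdd 4 3 0, IAdd 5 4 0, IAdd 6 5 22, IConst 7 24, IAdd 8 7 0, IAdd 9 8 22, IAdd 10 9 22, IAdd 13 3 23]"
  define I1 where "I1 = fst (effs ?init (I, R))"
  have e1: "effs ?init (I, R) = (I1, R)" by (simp add: I1_def)
  have I1: "I1 0 = int m" "I1 2 = 1" "I1 3 = int B" "I1 4 = int (B + m)" "I1 5 = int (B + 2 * m)"
    "I1 6 = int (B + 2 * m + n)" "I1 7 = int 24" "I1 8 = int (24 + m)" "I1 9 = int (24 + m + n)"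
    "I1 10 = int (24 + m + 2 * n)" "I1 22 = int n" "I1 23 = 0" "I1 11 = int 8" "I1 13 = int B" "I1 14 = int W"
    using I by (simp_all add: I1_def B_def W_def)
  define R2 where "R2 = (\<lambda>a. if B \<le> a \<and> a < B + 8 then R (a - B) else R a)"
  have e2: "effs (reloc 8) (I1, R) = (I1(13 := int (B + 8)), R2)"
    using effs_reloc[of I1 B 8 R] I1 by (simp add: R2_def B_def)
  define Inv where "Inv k s = (case s of (I', R') \<Rightarrow> agree_off {11, 13} I1 I' \<and>
    (\<forall>a. 8 \<le> a \<and> a < B \<longrightarrow> R' a = R a) \<and> (\<exists>i. 8 \<le> i \<and> W - i = k \<and> I' 11 = int i \<and> I' 13 = int (B + i) \<and>
      (\<forall>k<i. R' (B + k) = R k)))" for k :: nat and s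
  have len: "length (reloc 8) = 16" by (simp add: reloc_def length_concat sum_list_triv o_def)
  let ?b = "[RLoad 0 11, RStore 13 0, IAdd 13 13 2, IAdd 11 11 2]"
  have loop: "tc (While 14 11 (Block ?b)) (I1(13 := int (B + 8)), R2) (W * 6 + 1) ?Q"
  proof (rule tc_While[where Inv = Inv and N = "W - 8" and tb = 4])
    show "Inv (W - 8) (I1(13 := int (B + 8)), R2)"
      using I1 by (auto simp: Inv_def agree_off_def R2_def intro!: exI[of _ "8 :: nat"])
  next
    fix k s assume A: "Inv k s" "fst s 11 < fst s 14"
    obtain I' R' where s: "s = (I', R')" by (cases s)
    obtain i where ag: "agree_off {11, 13} I1 I'" and lo: "\<And>a. 8 \<le> a \<Longrightarrow> a < B \<Longrightarrow> R' a = R a"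
      and i: "8 \<le> i" "W - i = k" "I' 11 = int i" "I' 13 = int (B + i)" and c: "\<And>k. k < i \<Longrightarrow> R' (B + k) = R k"
      using A(1) unfolding Inv_def s prod.case by blast
    have I': "I' 2 = 1" "I' 14 = int W" using agree_offD[OF ag] I1 by auto
    have iW: "i < W" using A(2) I' i by (simp add: s)
    have Ri: "R' i = R i" using i iW by (intro lo) (auto simp: B_def)
    define R3 where "R3 = R'(0 := R i, B + i := R i)"
    have e: "effs ?b s = (I'(13 := int (B + (i + 1)), 11 := int (i + 1)), R3)"
      using I' i Ri by (simp add: s R3_def int_fold del: int_unfold)
    have B8: "8 \<le> B" by (simp add: B_def)
    have "R3 (B + k) = R k" if "k < i + 1" for k
      using that c[of k] B8 by (cases "k = i") (auto simp: R3_def)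
    moreover have "\<forall>a. 8 \<le> a \<and> a < B \<longrightarrow> R3 a = R a" using lo by (simp add: R3_def)
    moreover have "agree_off {11, 13} I1 (I'(13 := int (B + (i + 1)), 11 := int (i + 1)))"
      using ag by (simp add: agree_off_def)
    ultimately have "Inv (k - 1) (I'(13 := int (B + (i + 1)), 11 := int (i + 1)), R3)"
      unfolding Inv_def prod.case using i by (intro conjI exI[of _ "i + 1"]) simp_all
    then show "0 < k \<and> tc (Block ?b) s 4 (Inv (k - 1))"
      using i iW by (auto intro!: tc_Block simp only: e) auto
  next
    fix k s assume A: "Inv k s" "fst s 14 \<le> fst s 11"
    obtain I' R' where s: "s = (I', R')" by (cases s)
    obtain i where ag: "agree_off {11, 13} I1 I'" and i: "I' 11 = int i" and c: "\<And>k. k < i \<Longrightarrow> R' (B + k) = R k"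
      using A(1) unfolding Inv_def s prod.case by blast
    have I': "I' a = I1 a" if "a \<notin> {11, 13}" for a using agree_offD[OF ag that] .
    have "W \<le> i" using A(2) I1 i I'[of 14] by (simp add: s)
    then have "R' (B + k) = R k" if "k < W" for k using c that by simp
    then show "?Q s" using I1 I' by (simp add: s B_def W_def)
  qed simp
  show ?thesis unfolding SETUP_def
    by (rule tc_Block_Seq[where t' = "(2 * m + n) * 6 + 17"], unfold e1,
        rule tc_Block_Seq[where t' = "(2 * m + n) * 6 + 1"], unfold e2)
      (use loop len in \<open>simp_all add: W_def\<close>)
qed

section \<open>The assembled program on a given instance\<close>

context dwp
begin

text \<open>Speaks about the instance and the output cells only: \<sigma>, \<tau> and the memory
  layout come into being during the run and must not occur in the final postcondition.\<close>

definition solved :: "state \<Rightarrow> bool" where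
  "solved s \<longleftrightarrow> (\<exists>f cap. (\<forall>x<n. fst s (2 + x) = int (f x)) \<and> (\<forall>x<n. f x < m \<and> l x \<le> d (f x)) \<and>
     (\<forall>j<m. (\<Sum>x | x < n \<and> f x = j. l x) \<le> cap * v j) \<and>
     (\<forall>g. valid_schedule m n l d g \<longrightarrow> cap \<le> golden_ratio * delivery_time m l v g))"

end

context dwp_memory
begin

lemma tc_bisection:
  assumes env: "env I R" and p: "m < 2 ^ p" "2 ^ p \<le> 2 * m" and OB: "n + 24 \<le> OB"
  shows "tc (BOUND ;; PRECISION ;; While 20 23 BISECT ;; OUTPUT) (I, R)
    ((n + m) * 25 + 5 * p + (5 + 2 * p) * ((n + m) * (20 * p + 51) + 21) + n * 7 + 65) solved"
proof (rule tc_Seq[OF tc_BOUND[OF env],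
      where ?t2.0 = "5 * p + 9 + ((5 + 2 * p) * ((n + m) * (20 * p + 51) + 21) + 1 + (n * 7 + 49))"])
  fix s assume "case s of (I', R') \<Rightarrow> env I' R' \<and> crude_bound (R' 4)"
  then obtain I1 R1 where s: "s = (I1, R1)" and env1: "env I1 R1" and U: "crude_bound (R1 4)" by (cases s) auto
  define U where "U = R1 4"
  note U = U[folded U_def]
  let ?e = "1 / (8 * 2 ^ p) :: real" and ?K = "5 + 2 * p"
  have mp: "real m < 2 ^ p" using p(1) by (metis of_nat_less_iff of_nat_numeral of_nat_power)
  have eps: "0 \<le> ?e" "8 * (?e * m) \<le> 1" "?e \<le> 1 / 8" using mp by (auto simp: field_simps)
  show "tc (PRECISION ;; While 20 23 BISECT ;; OUTPUT) s
    (5 * p + 9 + ((5 + 2 * p) * ((n + m) * (20 * p + 51) + 21) + 1 + (n * 7 + 49))) solved"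
    unfolding s
  proof (rule tc_Seq[OF tc_PRECISION[OF env1 p],
        where ?t2.0 = "(5 + 2 * p) * ((n + m) * (20 * p + 51) + 21) + 1 + (n * 7 + 49)"])
    fix s :: state assume "case s of (I', R') \<Rightarrow> bisect_inv (R1 4) ?e ?K ?K I' R'"
    then have init: "case s of (I', R') \<Rightarrow> bisect_inv U ?e ?K ?K I' R'" by (simp add: U_def)
    define Inv where "Inv k s = (case s of (I', R') \<Rightarrow> bisect_inv U ?e ?K k I' R')" for k and s :: state
    show "tc (While 20 23 BISECT ;; OUTPUT) s
      ((5 + 2 * p) * ((n + m) * (20 * p + 51) + 21) + 1 + (n * 7 + 49)) solved"
    proof (rule tc_Seq[where P = "Inv 0" and ?t1.0 = "(5 + 2 * p) * ((n + m) * (20 * p + 51) + 21) + 1"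
          and ?t2.0 = "n * 7 + 49"],
        rule tc_While[where Inv = Inv and N = ?K and tb = "(n + m) * (20 * p + 51) + 19"])
      show "Inv ?K s" using init by (simp add: Inv_def)
    next
      fix k s assume A: "Inv k s" "fst s 23 < fst s 20"
      obtain I' R' where s: "s = (I', R')" by (cases s)
      have inv: "bisect_inv U ?e ?K k I' R'" using A(1) by (simp add: Inv_def s)
      then have k: "0 < k" using A(2) by (auto simp: s bisect_inv_def env_def)
      have mp': "m \<le> 2 ^ p" using p(1) by simp
      show "0 < k \<and> tc BISECT s ((n + m) * (20 * p + 51) + 19) (Inv (k - 1))"
        using tc_BISECT[OF inv k U less_imp_le[OF crude_bound_pos[OF U]] mp' eps] k
        unfolding s Inv_def[abs_def] by blast
    next
      fix k s assume A: "Inv k s" "fst s 20 \<le> fst s 23"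
      obtain I' R' where s: "s = (I', R')" by (cases s)
      have inv: "bisect_inv U ?e ?K k I' R'" using A(1) by (simp add: Inv_def s)
      then have "k = 0" using A(2) by (auto simp: s bisect_inv_def env_def)
      then show "Inv 0 s" using A by simp
    next
      fix s assume A: "Inv 0 s"
      obtain I' R' where s: "s = (I', R')" by (cases s)
      have inv: "bisect_inv U ?e ?K 0 I' R'" using A by (simp add: Inv_def s)
      then have env': "env I' R'" and "\<exists>f. (\<forall>x<n. I' (OB + x) = int (f x)) \<and> assignment f ((golden_ratio - ?e) * R' 5)"
        by (auto simp: bisect_inv_def)
      then obtain f where f: "\<And>x. x < n \<Longrightarrow> I' (OB + x) = int (f x)" "assignment f ((golden_ratio - ?e) * R' 5)"
        by blast
      have I': "I' 2 = 1" "I' 10 = int OB" "I' 22 = int n" "I' 23 = 0" using env' by (auto simp: env_def)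
      show "tc OUTPUT s (n * 7 + 49) solved"
        unfolding s
      proof (rule tc_conseq[OF tc_OUTPUT[OF I' OB]])
        fix s' :: state assume "case s' of (I'', R'') \<Rightarrow> \<forall>x<n. I'' (2 + x) = I' (OB + x)"
        then have "\<forall>x<n. fst s' (2 + x) = int (f x)" using f(1) by (cases s') simp
        moreover have "\<forall>g. valid_schedule m n l d g \<longrightarrow>
            (golden_ratio - ?e) * R' 5 \<le> golden_ratio * delivery_time m l v g"
          using final_ratio[OF p(1) inv U] by blast
        ultimately show "solved s'" using f(2) unfolding solved_def assignment_def by blast
      qed simp
    qed simp_all
  qed simp
qed simp

end

context dwp
begin

lemma tc_MAIN:
  assumes p: "m < 2 ^ p" "2 ^ p \<le> 2 * m" and q: "n \<le> 2 ^ q"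
  shows "tc MAIN (snd (dwp_input m n v d l))
    ((2 * m + n) * 6 + m * (32 * p + 39) + n * (32 * q + 39) +
     ((n + m) * 25 + 5 * p + (5 + 2 * p) * ((n + m) * (20 * p + 51) + 21) + n * 7 + 118)) solved"
proof -
  define VB where "VB = 2 * m + n + 8"
  define TB where "TB = VB + 2 * m + n"
  define I0 where "I0 = fst (snd (dwp_input m n v d l))"
  define R0 where "R0 = snd (snd (dwp_input m n v d l))"
  have s0: "snd (dwp_input m n v d l) = (I0, R0)" by (simp add: I0_def R0_def)
  have I0: "I0 0 = int m" "I0 (Suc 0) = int n" "\<And>a. 2 \<le> a \<Longrightarrow> I0 a = 0"
    by (auto simp: I0_def dwp_input_def)
  have R0: "R0 j = v j" "R0 (m + j) = d j" if "j < m" for j using that by (auto simp: R0_def dwp_input_def)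
  have R0': "R0 (2 * m + i) = l i" if "i < n" for i using that by (auto simp: R0_def dwp_input_def)
  define ti where "ti = ((n + m) * 25 + 5 * p + (5 + 2 * p) * ((n + m) * (20 * p + 51) + 21) + n * 7 + 65)"
  have "tc MAIN (I0, R0) ((2 * m + n) * 6 + 31 + (3 + (m * (32 * p + 39) + 8 + (3 + (n * (32 * q + 39) + 8 + ti))))) solved"
    unfolding MAIN_def
  proof (rule tc_Seq[OF tc_SETUP[OF I0, of R0, folded VB_def, folded TB_def],
        where ?t2.0 = "3 + (m * (32 * p + 39) + 8 + (3 + (n * (32 * q + 39) + 8 + ti)))"])
    fix s :: state assume "case s of (I', R') \<Rightarrow>
      I' 0 = int m \<and> I' 2 = 1 \<and> I' 3 = int VB \<and> I' 4 = int (VB + m) \<and>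
      I' 5 = int (VB + 2 * m) \<and> I' 6 = int TB \<and>
      I' 7 = int 24 \<and> I' 8 = int (24 + m) \<and> I' 9 = int (24 + m + n) \<and> I' 10 = int (24 + m + 2 * n) \<and>
      I' 22 = int n \<and> I' 23 = 0 \<and> (\<forall>k < 2 * m + n. R' (VB + k) = R0 k)"
    then obtain I1 R1 where s: "s = (I1, R1)" and I1: "I1 0 = int m" "I1 2 = 1" "I1 3 = int VB"
      "I1 4 = int (VB + m)" "I1 5 = int (VB + 2 * m)" "I1 6 = int TB" "I1 7 = int 24" "I1 8 = int (24 + m)"
      "I1 9 = int (24 + m + n)" "I1 10 = int (24 + m + 2 * n)" "I1 22 = int n" "I1 23 = 0"
      and R1: "\<And>k. k < 2 * m + n \<Longrightarrow> R1 (VB + k) = R0 k" by (cases s) auto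
    have VB8: "8 \<le> VB" by (simp add: VB_def)
    have TBd: "VB + m + m \<le> TB" "VB + 2 * m + n \<le> TB" by (simp_all add: TB_def)
    have R1v: "R1 (VB + j) = v j" "R1 (VB + m + j) = d j" if "j < m" for j
      using R0[OF that] R1[of j] R1[of "m + j"] that by (simp_all add: add.assoc)
    have R1l: "R1 (VB + 2 * m + i) = l i" if "i < n" for i
      using R0'[OF that] R1[of "2 * m + i"] that by (simp add: add.assoc)
    define I2 where "I2 = I1(16 := int m, 20 := int (VB + m), 21 := int 24)"
    have e1: "effs [IAdd 16 0 23, IAdd 20 4 23, IAdd 21 7 23] s = (I2, R1)"
      using I1 by (simp add: s I2_def)
    have sort1: "tc SORT (I2, R1) (m * (32 * p + 39) + 8) (\<lambda>(I', R').
      agree_off ({11, 13, 14, 15} \<union> {24..<24 + m}) I2 I' \<and> agree_off ({0, 2, 7} \<union> {TB..}) R1 R' \<and>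
      (\<exists>y. (\<forall>i < m. I' (24 + i) = int (y i)) \<and> bij_betw y {..<m} {..<m} \<and>
        (\<forall>k < m. \<forall>i \<le> k. max 0 (d (y k)) \<le> max 0 (d (y i)))))"
      by (rule tc_SORT[where XB = "VB + m"])
        (use I1 VB8 TBd p R1v(2) in \<open>auto simp: I2_def\<close>)
    show "tc (Block [IAdd 16 0 23, IAdd 20 4 23, IAdd 21 7 23] ;; SORT ;;
      Block [IAdd 16 22 23, IAdd 20 5 23, IAdd 21 8 23] ;; SORT ;;
      BOUND ;; PRECISION ;; While 20 23 BISECT ;; OUTPUT) s
      (3 + (m * (32 * p + 39) + 8 + (3 + (n * (32 * q + 39) + 8 + ti)))) solved"
    proof (rule tc_Block_Seq[where t' = "m * (32 * p + 39) + 8 + (3 + (n * (32 * q + 39) + 8 + ti))"], unfold e1,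
        rule tc_Seq[OF sort1, where ?t2.0 = "3 + (n * (32 * q + 39) + 8 + ti)"])
      fix s :: state assume "case s of (I', R') \<Rightarrow>
        agree_off ({11, 13, 14, 15} \<union> {24..<24 + m}) I2 I' \<and> agree_off ({0, 2, 7} \<union> {TB..}) R1 R' \<and>
        (\<exists>y. (\<forall>i < m. I' (24 + i) = int (y i)) \<and> bij_betw y {..<m} {..<m} \<and>
          (\<forall>k < m. \<forall>i \<le> k. max 0 (d (y k)) \<le> max 0 (d (y i))))"
      then obtain I3 R3 \<sigma> where s: "s = (I3, R3)" and
        ag3: "agree_off ({11, 13, 14, 15} \<union> {24..<24 + m}) I2 I3" "agree_off ({0, 2, 7} \<union> {TB..}) R1 R3" and
        \<sigma>: "\<And>i. i < m \<Longrightarrow> I3 (24 + i) = int (\<sigma> i)" "bij_betw \<sigma> {..<m} {..<m}"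
          "\<And>k i. k < m \<Longrightarrow> i \<le> k \<Longrightarrow> max 0 (d (\<sigma> k)) \<le> max 0 (d (\<sigma> i))"
        by (cases s) blast
      have I3: "I3 a = I1 a" if "a < 11 \<or> a = 22 \<or> a = 23" for a
        using agree_offD[OF ag3(1), of a] that by (auto simp: I2_def)
      have R3: "R3 a = R1 a" if "8 \<le> a" "a < TB" for a using agree_offD[OF ag3(2), of a] that by auto
      define I4 where "I4 = I3(16 := int n, 20 := int (VB + 2 * m), 21 := int (24 + m))"
      have e2: "effs [IAdd 16 22 23, IAdd 20 5 23, IAdd 21 8 23] s = (I4, R3)"
        using I1 by (simp add: s I4_def I3)
      have sort2: "tc SORT (I4, R3) (n * (32 * q + 39) + 8) (\<lambda>(I', R').
        agree_off ({11, 13, 14, 15} \<union> {24 + m..<24 + m + n}) I4 I' \<and> agree_off ({0, 2, 7} \<union> {TB..}) R3 R' \<and>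
        (\<exists>y. (\<forall>i < n. I' (24 + m + i) = int (y i)) \<and> bij_betw y {..<n} {..<n} \<and>
          (\<forall>k < n. \<forall>i \<le> k. max 0 (l (y k)) \<le> max 0 (l (y i)))))"
        by (rule tc_SORT[where XB = "VB + 2 * m"])
          (use I1 VB8 TBd q R1l in \<open>auto simp: I4_def I3 R3\<close>)
      show "tc (Block [IAdd 16 22 23, IAdd 20 5 23, IAdd 21 8 23] ;; SORT ;;
        BOUND ;; PRECISION ;; While 20 23 BISECT ;; OUTPUT) s (3 + (n * (32 * q + 39) + 8 + ti)) solved"
      proof (rule tc_Block_Seq[where t' = "n * (32 * q + 39) + 8 + ti"], unfold e2,
          rule tc_Seq[OF sort2, where ?t2.0 = ti])
        fix s :: state assume "case s of (I', R') \<Rightarrow>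
          agree_off ({11, 13, 14, 15} \<union> {24 + m..<24 + m + n}) I4 I' \<and> agree_off ({0, 2, 7} \<union> {TB..}) R3 R' \<and>
          (\<exists>y. (\<forall>i < n. I' (24 + m + i) = int (y i)) \<and> bij_betw y {..<n} {..<n} \<and>
            (\<forall>k < n. \<forall>i \<le> k. max 0 (l (y k)) \<le> max 0 (l (y i))))"
        then obtain I5 R5 \<tau> where s: "s = (I5, R5)" and
          ag5: "agree_off ({11, 13, 14, 15} \<union> {24 + m..<24 + m + n}) I4 I5" "agree_off ({0, 2, 7} \<union> {TB..}) R3 R5" and
          \<tau>: "\<And>i. i < n \<Longrightarrow> I5 (24 + m + i) = int (\<tau> i)" "bij_betw \<tau> {..<n} {..<n}"
            "\<And>k i. k < n \<Longrightarrow> i \<le> k \<Longrightarrow> max 0 (l (\<tau> k)) \<le> max 0 (l (\<tau> i))"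
          by (cases s) blast
        have \<tau>n: "\<tau> i < n" if "i < n" for i using \<tau>(2) that by (auto simp: bij_betw_def)
        have I5: "I5 a = I1 a" if "a < 11 \<or> a = 22 \<or> a = 23" for a
          using agree_offD[OF ag5(1), of a] I3[OF that] that by (auto simp: I4_def)
        have I5\<sigma>: "I5 (24 + i) = int (\<sigma> i)" if "i < m" for i
          using agree_offD[OF ag5(1), of "24 + i"] \<sigma>(1)[OF that] that by (auto simp: I4_def)
        have R5: "R5 a = R1 a" if "8 \<le> a" "a < TB" for a using agree_offD[OF ag5(2), of a] R3[OF that] that by auto
        \<comment> \<open>\<sigma> and \<tau> are the permutations left behind by the two sorting
          runs, so the memory locale can be instantiated only at this point. Clamping disappears for
          the parcels, whose lengths are positive.\<close>
        interpret M: dwp_memory m n v d l \<sigma> \<tau> VB "VB + m" "VB + 2 * m" TB 24 "24 + m" "24 + m + n" "24 + m + 2 * n"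
        proof unfold_locales
          show "l (\<tau> k) \<le> l (\<tau> i)" if "k < n" "i \<le> k" for i k
            using \<tau>(3)[OF that] l_pos[OF \<tau>n[of k]] l_pos[OF \<tau>n[of i]] that by simp
        qed (use \<sigma> \<tau>(2) VB8 TBd in auto)
        have env: "M.env I5 R5"
          unfolding M.env_def using I1 I5\<sigma> \<tau>(1) R1v R1l VB8 TBd by (simp add: I5 R5)
        show "tc (BOUND ;; PRECISION ;; While 20 23 BISECT ;; OUTPUT) s ti solved"
          unfolding s ti_def by (rule M.tc_bisection[OF env p]) simp
      qed simp_all
    qed simp_all
  qed simp_all
  then show ?thesis unfolding s0 by (rule tc_conseq) (simp_all add: ti_def)
qed

lemma solved_output:
  assumes "solved s"
  shows "valid_schedule m n l d (dwp_output n (pc, s))"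
    "valid_schedule m n l d g \<Longrightarrow> delivery_time m l v (dwp_output n (pc, s)) \<le> golden_ratio * delivery_time m l v g"
proof -
  obtain f cap where f: "\<And>x. x < n \<Longrightarrow> fst s (2 + x) = int (f x)"
    "\<And>x. x < n \<Longrightarrow> f x < m" "\<And>x. x < n \<Longrightarrow> l x \<le> d (f x)"
    "\<And>j. j < m \<Longrightarrow> (\<Sum>x | x < n \<and> f x = j. l x) \<le> cap * v j"
    "\<And>g. valid_schedule m n l d g \<Longrightarrow> cap \<le> golden_ratio * delivery_time m l v g"
    using assms unfolding solved_def by blast
  have out: "dwp_output n (pc, s) = (\<lambda>j. {x. x < n \<and> f x = j})"
    using f(1) by (auto simp: dwp_output_def fun_eq_iff)
  show "valid_schedule m n l d (dwp_output n (pc, s))"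
    unfolding out by (rule schedule_of_assignment(1)[OF f(2-4)])
  show "delivery_time m l v (dwp_output n (pc, s)) \<le> golden_ratio * delivery_time m l v g"
    if "valid_schedule m n l d g"
    unfolding out using schedule_of_assignment(2)[OF f(2-4)] f(5)[OF that] by (rule order_trans)
qed

end

section \<open>Arithmetic of the running time\<close>

lemma ex_power_two:
  assumes "1 \<le> (m :: nat)"
  obtains p where "m < 2 ^ p" "2 ^ p \<le> 2 * m"
proof -
  define p where "p = (LEAST p. m < 2 ^ p)"
  have 1: "m < 2 ^ p" unfolding p_def by (rule LeastI[of _ m]) (rule less_exp)
  then have "p \<noteq> 0" using assms by (cases p) auto
  then obtain q where q: "p = Suc q" by (cases p) auto
  have "\<not> m < 2 ^ q" using not_less_Least[of q "\<lambda>p. m < 2 ^ p"] q by (simp add: p_def)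
  then show ?thesis using 1 q by (intro that[of p]) auto
qed

text \<open>Since p, q \<ge> 1, the product W = (n + m)(p^2 + q) dominates each of the monomials
  that occur, and the coefficients are simply added up.\<close>

lemma time_bound_nat:
  fixes m n p q :: nat
  assumes "1 \<le> m" "1 \<le> n" "1 \<le> p" "1 \<le> q"
  shows "(2 * m + n) * 6 + m * (32 * p + 39) + n * (32 * q + 39) +
     ((n + m) * 25 + 5 * p + (5 + 2 * p) * ((n + m) * (20 * p + 51) + 21) + n * 7 + 118)
     \<le> 2000 * ((n + m) * (p * p + q))"
proof -
  define N where "N = n + m"
  define W where "W = N * (p * p + q)"
  have mn: "m \<le> N" "n \<le> N" "1 \<le> N" using assms by (auto simp: N_def)
  have pp: "p \<le> p * p" using assms by simp
  have 1: "N * (p * p) \<le> W" "N * q \<le> W" by (simp_all add: W_def algebra_simps)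
  have "N * p \<le> N * (p * p)" using pp by (rule mult_le_mono2)
  then have 2: "N * p \<le> W" using 1(1) by (rule order_trans)
  have "N * 1 \<le> N * q" using assms by (intro mult_le_mono2)
  then have 3: "N \<le> W" using 1(2) by linarith
  have "m * p \<le> N * p" "n * q \<le> N * q" "1 * p \<le> N * p" using mn by (intro mult_le_mono1, simp)+
  then have 4: "m * p \<le> W" "n * q \<le> W" "p \<le> W" using 1(2) 2 by linarith+
  have 5: "m \<le> W" "n \<le> W" "1 \<le> W" using mn 3 by simp_all
  have "(5 + 2 * p) * (N * (20 * p + 51) + 21) = 40 * (N * (p * p)) + 202 * (N * p) + 255 * N + 42 * p + 105"
    by (simp add: algebra_simps)
  then have "(5 + 2 * p) * (N * (20 * p + 51) + 21) \<le> 700 * W" using 1(1) 2 3 4(3) 5(3) by simp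
  moreover have "m * (32 * p + 39) \<le> 100 * W" using 4(1) 5(1) by (simp add: algebra_simps)
  moreover have "n * (32 * q + 39) \<le> 100 * W" using 4(2) 5(2) by (simp add: algebra_simps)
  ultimately show ?thesis
    using 3 4(3) 5 unfolding N_def[symmetric] W_def[symmetric] by simp
qed

text \<open>p and q exceed the binary logarithms of m and n by at most 1. For m = n = 1 both
  logarithms vanish and the additive 1 carries the bound, with 6 = 2 * 3. In all other cases one
  logarithm is at least 1, and constants are absorbed.\<close>

lemma time_bound_real:
  fixes m n p q :: nat
  assumes m: "1 \<le> m" "2 ^ p \<le> 2 * m" and n: "1 \<le> n" "2 ^ q \<le> 2 * n"
  shows "real ((n + m) * (p * p + q)) \<le> 6 * (real (n + m) * ((log 2 (real m))\<^sup>2 + log 2 (real n)) + 1)"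
proof -
  define x where "x = log 2 (real m)"
  define y where "y = log 2 (real n)"
  have lg: "real k \<le> 1 + log 2 (real z)" if "1 \<le> z" "2 ^ k \<le> 2 * z" for k z :: nat
  proof -
    have "2 powr real k \<le> 2 * real z"
      using that(2) by (simp add: powr_realpow) (metis of_nat_le_iff of_nat_mult of_nat_numeral of_nat_power)
    then have "real k \<le> log 2 (2 * real z)" using that(1) by (simp add: le_log_iff)
    then show ?thesis using that(1) by (simp add: log_mult)
  qed
  have px: "real p \<le> 1 + x" and qy: "real q \<le> 1 + y" using lg m n by (auto simp: x_def y_def)
  have xy: "0 \<le> x" "0 \<le> y" using m n by (auto simp: x_def y_def)
  have "real p * real p \<le> (1 + x) * (1 + x)" using px by (intro mult_mono) auto
  also have "\<dots> \<le> 2 + 2 * x\<^sup>2" using sum_squares_bound[of 1 x] by (simp add: power2_eq_square algebra_simps)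
  finally have "real p * real p + real q \<le> 3 + 2 * x\<^sup>2 + y" using qy by simp
  then have *: "real ((n + m) * (p * p + q)) \<le> real (n + m) * (3 + 2 * x\<^sup>2 + y)"
    unfolding of_nat_mult of_nat_add[of "p * p"] by (intro mult_left_mono) auto
  show ?thesis
  proof (cases "m = 1 \<and> n = 1")
    case True
    then show ?thesis using * by (simp add: x_def y_def)
  next
    case False
    then have "2 \<le> m \<or> 2 \<le> n" using m n by auto
    moreover have "1 \<le> log 2 (real z)" if "2 \<le> z" for z :: nat using that by (simp add: le_log_iff)
    ultimately have "1 \<le> x \<or> 1 \<le> y" by (auto simp: x_def y_def)
    then have "1 \<le> x\<^sup>2 + y" using xy one_le_power[of x 2] by (auto intro: add_increasing add_increasing2)
    then have "3 + 2 * x\<^sup>2 + y \<le> 6 * (x\<^sup>2 + y)" using xy by simp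
    then have "real (n + m) * (3 + 2 * x\<^sup>2 + y) \<le> real (n + m) * (6 * (x\<^sup>2 + y))" by (intro mult_left_mono) auto
    then show ?thesis using * by (simp add: x_def y_def algebra_simps)
  qed
qed

theorem theorem2:
  shows "\<exists>(P :: instr list) (C :: real).
    \<forall>(m :: nat) (n :: nat) (v :: nat \<Rightarrow> real) (d :: nat \<Rightarrow> real) (l :: nat \<Rightarrow> real).
      1 \<le> m \<longrightarrow> 1 \<le> n \<longrightarrow>
      (\<forall>j<m. 0 < v j) \<longrightarrow> (\<forall>i<n. 0 < l i) \<longrightarrow>
      (\<exists>j<m. \<forall>i<n. l i \<le> d j) \<longrightarrow>
      (\<exists>k :: nat.
         real k \<le> C * (real (n + m) * ((log 2 (real m))\<^sup>2 + log 2 (real n)) + 1) \<and>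
         halted P (steps P k (dwp_input m n v d l)) \<and>
         valid_schedule m n l d (dwp_output n (steps P k (dwp_input m n v d l))) \<and>
         (\<forall>g. valid_schedule m n l d g \<longrightarrow>
            delivery_time m l v (dwp_output n (steps P k (dwp_input m n v d l)))
              \<le> golden_ratio * delivery_time m l v g))"
\<comment> \<open>12000 = 2000 * 6, the product of the constants of the two time bounds.\<close>
proof (intro exI[of _ "compile 0 MAIN @ [Halt]"] exI[of _ "12000 :: real"] allI impI)
  fix m n :: nat and v d l :: "nat \<Rightarrow> real"
  assume m: "1 \<le> m" and n: "1 \<le> n" and "\<forall>j<m. 0 < v j" "\<forall>i<n. 0 < l i" "\<exists>j<m. \<forall>i<n. l i \<le> d j"
  then interpret dwp m n v d l by unfold_locales auto
  let ?P = "compile 0 MAIN @ [Halt]" and ?c = "dwp_input m n v d l"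
  obtain p where p: "m < 2 ^ p" "2 ^ p \<le> 2 * m" using ex_power_two[OF m] .
  obtain q where q: "n < 2 ^ q" "2 ^ q \<le> 2 * n" using ex_power_two[OF n] .
  have pq: "1 \<le> p" "1 \<le> q" using p(1) q(1) m n by (cases p; cases q; simp)+
  obtain k s where k: "k \<le> (2 * m + n) * 6 + m * (32 * p + 39) + n * (32 * q + 39) +
     ((n + m) * 25 + 5 * p + (5 + 2 * p) * ((n + m) * (20 * p + 51) + 21) + n * 7 + 118)"
    and s: "steps ?P k (0, snd ?c) = (length (compile 0 MAIN), s)" "solved s"
    using tc_steps[OF tc_MAIN[OF p less_imp_le[OF q(1)]] well_formed_MAIN] .
  have c: "?c = (0, snd ?c)" by (simp add: dwp_input_def)
  have st: "steps ?P k ?c = (length (compile 0 MAIN), s)" by (subst c) (rule s(1))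
  have "k \<le> 2000 * ((n + m) * (p * p + q))" using k time_bound_nat[OF m n pq] by (rule order_trans)
  then have "real k \<le> 2000 * real ((n + m) * (p * p + q))" by (metis of_nat_le_iff of_nat_mult of_nat_numeral)
  also have "\<dots> \<le> 2000 * (6 * (real (n + m) * ((log 2 (real m))\<^sup>2 + log 2 (real n)) + 1))"
    using time_bound_real[OF m p(2) n q(2)] by (intro mult_left_mono) auto
  finally have "real k \<le> 12000 * (real (n + m) * ((log 2 (real m))\<^sup>2 + log 2 (real n)) + 1)" by simp
  moreover have "halted ?P (steps ?P k ?c)" by (simp add: st halted_def)
  ultimately show "\<exists>k :: nat.
         real k \<le> 12000 * (real (n + m) * ((log 2 (real m))\<^sup>2 + log 2 (real n)) + 1) \<and>
         halted ?P (steps ?P k ?c) \<and>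
         valid_schedule m n l d (dwp_output n (steps ?P k ?c)) \<and>
         (\<forall>g. valid_schedule m n l d g \<longrightarrow>
            delivery_time m l v (dwp_output n (steps ?P k ?c)) \<le> golden_ratio * delivery_time m l v g)"
    using solved_output[OF s(2)] by (intro exI[of _ k]) (simp add: st)
qed

end
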